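(* Consider the sparse linear regression detection problem SLR-D (defined in the context) with $\beta\sim\mathcal{P}_{\|\beta\|_2}(\mathcal{D})$, in the regime $p\to\infty$, $k=O(p^\theta)\le\sqrt p$ with $\theta\in(0,1/2]$. For $n=\omega(\log p)$ and $$n\;\le\;(1-\epsilon)(1-2\theta)\,\frac{\|\beta\|_2^2}{\|\beta\|_\infty^2}\cdot\frac{\mathrm{SNR}+1}{\mathrm{SNR}}\,\log p$$ for any $\epsilon\in(0,1)$, the Low-Degree Conjecture (stated in the context) implies that any randomized algorithm requires running time $e^{\tilde\Omega(n)}$ to solve SLR-D (i.e. to achieve strong detection).
   Context: **Signal prior.** For $\mathcal{D}\subseteq\mathbb{R}$, $\beta\sim\mathcal{P}_{\|\beta\|_2}(\mathcal{D})$ means that $\beta$ is uniform over $k$-sparse vectors of $\mathbb{R}^p$ (exactly $k$ nonzero entries) whose nonzero entries lie in $\mathcal{D}$ and which have a fixed Euclidean norm, denoted $\|\beta\|_2$. It is assumed that $\min\{|b|:b\in\mathcal{D}\}>0$. $\|\beta\|_\infty$ denotes the largest absolute value of an entry of the signal. $\mathrm{SNR}:=\|\beta\|_2^2/\sigma^2$. **Detection problem SLR-D.** Let $\sigma>0$; $X\in\mathbb{R}^{n\times p}$ has i.i.d. $\mathcal{N}(0,1)$ entries, $w\in\mathbb{R}^n$ has i.i.d. $\mathcal{N}(0,1)$ entries, $\beta\sim\mathcal{P}_{\|\beta\|_2}(\mathcal{D})$, all independent. One observes $(X,y)$ and must distinguish the null $\mathbb{P}(X)\otimes\mathbb{P}(y)$: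 $y=\sqrt{\|\beta\|_2^2/\sigma^2+1}\;w$, from the alternative $\mathbb{P}(X,y)$: $y=\frac1\sigma X\beta+w$. **Strong detection:** the test succeeds with probability $1-o(1)$ as $p\to\infty$ (under both hypotheses). **Low-degree chi-square divergence.** For distributions $\mathbb{P}_N\ll\mathbb{Q}_N$ on $\mathbb{R}^N$ with likelihood ratio $L=d\mathbb{P}_N/d\mathbb{Q}_N$, let $L^{\le D}$ be the orthogonal projection of $L$ in $L^2(\mathbb{Q}_N)$ onto polynomials of degree at most $D$, and $\chi^2_{\le D}(\mathbb{P}_N\|\mathbb{Q}_N):=\mathbb{E}_{\mathbb{Q}_N}[(L^{\le D})^2]-1$. **Low-Degree Conjecture.** If $\chi^2_{\le D}(\mathbb{P}_N\|\mathbb{Q}_N)=O(1)$ for some $D=\omega(\log N)$, then strong detection between $\mathbb{P}_N$ and $\mathbb{Q}_N$ has no polynomial-time algorithm and furthermore requires runtime $\exp(\tilde\Omega(D))$. (If $\chi^2_{\le D}=o(1)$ for some $D=\omega(\log N)$, the same holds for weak detection, i.e. success with probability $\frac12+\epsilon'$ for a constant $\epsilon'>0$.) Here $N=np+n$ is the dimension of the data $(X,y)$. $\tilde\Omega$ hides polylogarithmic factors. *)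

theory Defs
  imports "HOL-Probability.Probability" "HOL-Library.Landau_Symbols"
begin

section \<open>Randomized algorithms on real data\<close>

text \<open>
  The model of computation is a probabilistic real RAM.  It has a memory of reals, which initially
  holds the data, a separate memory of natural numbers, and an unlimited supply of independent
  uniform draws from \<open>[0,1]\<close>.  Every instruction costs one step.  Reals can be combined by field
  operations and compared, but not rounded to naturals, and naturals can only be added and
  subtracted: unit-cost rounding of reals or multiplication of naturals would make the model
  unrealistically powerful.
\<close>

datatype instr =
    RConst nat real          \<comment> \<open>\<open>RConst a c\<close>: \<open>R[a] := c\<close>\<close>
  | RAdd nat nat nat         \<comment> \<open>\<open>RAdd a b c\<close>: \<open>R[a] := R[b] + R[c]\<close>; similarly below\<close>
  | RSub nat nat nat
  | RMul nat nat nat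
  | RDiv nat nat nat
  | RLoad nat nat            \<comment> \<open>\<open>RLoad a i\<close>: \<open>R[a] := R[I[i]]\<close>\<close>
  | RStore nat nat           \<comment> \<open>\<open>RStore i a\<close>: \<open>R[I[i]] := R[a]\<close>\<close>
  | RRandom nat              \<comment> \<open>\<open>RRandom a\<close>: \<open>R[a] :=\<close> next random draw\<close>
  | RJumpLess nat nat nat    \<comment> \<open>\<open>RJumpLess a b l\<close>: go to \<open>l\<close> if \<open>R[a] < R[b]\<close>\<close>
  | IConst nat nat
  | IAdd nat nat nat
  | ISub nat nat nat
  | ILoad nat nat
  | IStore nat nat
  | IJumpLess nat nat nat
  | Halt bool

type_synonym program = "instr list"

record config =
  pc :: nat
  ints :: "nat \<Rightarrow> nat"
  reals :: "nat \<Rightarrow> real"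
  draws :: nat  \<comment> \<open>number of random draws used so far\<close>

definition set_real :: "nat \<Rightarrow> real \<Rightarrow> config \<Rightarrow> config" where
  "set_real a x s = s\<lparr>pc := Suc (pc s), reals := (reals s)(a := x)\<rparr>"

definition set_int :: "nat \<Rightarrow> nat \<Rightarrow> config \<Rightarrow> config" where
  "set_int i m s = s\<lparr>pc := Suc (pc s), ints := (ints s)(i := m)\<rparr>"

fun step :: "(nat \<Rightarrow> real) \<Rightarrow> instr \<Rightarrow> config \<Rightarrow> config" where
  "step \<omega> (RConst a c) s = set_real a c s"
| "step \<omega> (RAdd a b c) s = set_real a (reals s b + reals s c) s"
| "step \<omega> (RSub a b c) s = set_real a (reals s b - reals s c) s"
| "step \<omega> (RMul a b c) s = set_real a (reals s b * reals s c) s"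
| "step \<omega> (RDiv a b c) s = set_real a (reals s b / reals s c) s"
| "step \<omega> (RLoad a i) s = set_real a (reals s (ints s i)) s"
| "step \<omega> (RStore i a) s = set_real (ints s i) (reals s a) s"
| "step \<omega> (RRandom a) s = (set_real a (\<omega> (draws s)) s)\<lparr>draws := Suc (draws s)\<rparr>"
| "step \<omega> (RJumpLess a b l) s = s\<lparr>pc := (if reals s a < reals s b then l else Suc (pc s))\<rparr>"
| "step \<omega> (IConst i m) s = set_int i m s"
| "step \<omega> (IAdd i j l) s = set_int i (ints s j + ints s l) s"
| "step \<omega> (ISub i j l) s = set_int i (ints s j - ints s l) s"
| "step \<omega> (ILoad i j) s = set_int i (ints s (ints s j)) s"
| "step \<omega> (IStore i j) s = set_int (ints s i) (ints s j) s"
| "step \<omega> (IJumpLess i j l) s = s\<lparr>pc := (if ints s i < ints s j then l else Suc (pc s))\<rparr>"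
| "step \<omega> (Halt b) s = s"

text \<open>
  \<open>exec T A \<omega> s\<close> is the answer reached from \<open>s\<close> within \<open>T\<close> steps, and \<open>None\<close> if there is none;
  a program that runs off its end never answers.
\<close>
fun exec :: "nat \<Rightarrow> program \<Rightarrow> (nat \<Rightarrow> real) \<Rightarrow> config \<Rightarrow> bool option" where
  "exec 0 A \<omega> s = None"
| "exec (Suc T) A \<omega> s =
     (if pc s < length A
      then (case A ! pc s of Halt b \<Rightarrow> Some b | ins \<Rightarrow> exec T A \<omega> (step \<omega> ins s))
      else None)"

definition initial :: "nat \<Rightarrow> (nat \<Rightarrow> real) \<Rightarrow> config" where
  "initial N z = \<lparr>pc = 0, ints = (\<lambda>i. if i = 0 then N else 0),
                  reals = (\<lambda>a. if a < N then z a else 0), draws = 0\<rparr>"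

definition answers :: "program \<Rightarrow> nat \<Rightarrow> (nat \<Rightarrow> real) \<Rightarrow> (nat \<Rightarrow> real) \<Rightarrow> bool \<Rightarrow> bool" where
  "answers A N z \<omega> b \<longleftrightarrow> (\<exists>T. exec T A \<omega> (initial N z) = Some b)"

abbreviation real_space :: "nat \<Rightarrow> (nat \<Rightarrow> real) measure" where
  "real_space N \<equiv> PiM {..<N} (\<lambda>_. borel)"

definition random_draws :: "(nat \<Rightarrow> real) measure" where
  "random_draws = PiM UNIV (\<lambda>_. uniform_measure lborel {0..1})"

text \<open>
  An algorithm for a sequence of problems of dimensions \<open>N t\<close> is a family of programs \<open>A t\<close>, so it
  may depend on all parameters of the problem.  Program length counts towards the running time;
  otherwise a fast program could contain a decision tree of exponential size.
\<close>
definition runs_in_time :: "(nat \<Rightarrow> nat) \<Rightarrow> (nat \<Rightarrow> program) \<Rightarrow> (nat \<Rightarrow> nat) \<Rightarrow> bool" where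
  "runs_in_time N A T \<longleftrightarrow>
     (\<forall>t. length (A t) \<le> T t \<and>
          (\<forall>z\<in>space (real_space (N t)). \<forall>\<omega>. (\<forall>i. \<omega> i \<in> {0..1}) \<longrightarrow>
             exec (T t) (A t) \<omega> (initial (N t) z) \<noteq> None))"

definition answer_prob :: "program \<Rightarrow> nat \<Rightarrow> (nat \<Rightarrow> real) measure \<Rightarrow> bool \<Rightarrow> real" where
  "answer_prob A N M b =
     measure (M \<Otimes>\<^sub>M random_draws) {(z, \<omega>) \<in> space (M \<Otimes>\<^sub>M random_draws). answers A N z \<omega> b}"


section \<open>Detection and the low-degree conjecture\<close>

text \<open>
  A detection problem is a sequence of dimensions \<open>N t\<close> with distributions \<open>P t\<close> (alternative,
  correct answer \<open>True\<close>) and \<open>Q t\<close> (null, correct answer \<open>False\<close>) on \<open>\<real>\<^sup>N\<close>.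
\<close>
type_synonym detection_problem =
  "(nat \<Rightarrow> nat) \<times> (nat \<Rightarrow> (nat \<Rightarrow> real) measure) \<times> (nat \<Rightarrow> (nat \<Rightarrow> real) measure)"

fun strong_detection :: "detection_problem \<Rightarrow> (nat \<Rightarrow> program) \<Rightarrow> bool" where
  "strong_detection (N, P, Q) A \<longleftrightarrow>
     (\<lambda>t. answer_prob (A t) (N t) (P t) True) \<longlonglongrightarrow> 1 \<and>
     (\<lambda>t. answer_prob (A t) (N t) (Q t) False) \<longlonglongrightarrow> 1"

fun weak_detection :: "detection_problem \<Rightarrow> (nat \<Rightarrow> program) \<Rightarrow> bool" where
  "weak_detection (N, P, Q) A \<longleftrightarrow>
     (\<exists>\<epsilon>>0. eventually (\<lambda>t. (answer_prob (A t) (N t) (P t) True +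
                               answer_prob (A t) (N t) (Q t) False) / 2 \<ge> 1/2 + \<epsilon>) sequentially)"

definition no_poly_time :: "(nat \<Rightarrow> nat) \<Rightarrow> ((nat \<Rightarrow> program) \<Rightarrow> bool) \<Rightarrow> bool" where
  "no_poly_time N succeeds \<longleftrightarrow>
     \<not> (\<exists>A T c. runs_in_time N A T \<and> succeeds A \<and>
                (\<lambda>t. real (T t)) \<in> O(\<lambda>t. real (N t) ^ c))"

text \<open>
  Every successful algorithm needs time \<open>exp (\<Omega>~(f))\<close>, where the tilde hides factors that are
  polylogarithmic in the dimension of the data.
\<close>
definition requires_exp_time ::
  "(nat \<Rightarrow> nat) \<Rightarrow> ((nat \<Rightarrow> program) \<Rightarrow> bool) \<Rightarrow> (nat \<Rightarrow> real) \<Rightarrow> bool" where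
  "requires_exp_time N succeeds f \<longleftrightarrow>
     (\<forall>A T. runs_in_time N A T \<and> succeeds A \<longrightarrow>
        (\<exists>c>0. \<exists>C::nat. eventually (\<lambda>t. real (T t) \<ge> exp (c * f t / ln (real (N t)) ^ C)) sequentially))"

definition exponents :: "nat \<Rightarrow> nat \<Rightarrow> (nat \<Rightarrow> nat) set" where
  "exponents N D = {\<alpha>. (\<forall>i\<ge>N. \<alpha> i = 0) \<and> (\<Sum>i<N. \<alpha> i) \<le> D}"

lemma finite_exponents: "finite (exponents N D)"
proof (rule finite_subset)
  show "exponents N D \<subseteq> {\<alpha>. \<forall>i. (i \<in> {..<N} \<longrightarrow> \<alpha> i \<in> {..D}) \<and> (i \<notin> {..<N} \<longrightarrow> \<alpha> i = 0)}"
    unfolding exponents_def by (auto intro: order_trans[OF member_le_sum])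
  show "finite {\<alpha>. \<forall>i. (i \<in> {..<N} \<longrightarrow> \<alpha> i \<in> {..D}) \<and> (i \<notin> {..<N} \<longrightarrow> \<alpha> i = (0::nat))}"
    by (rule finite_set_of_finite_funs) auto
qed

definition polynomials :: "nat \<Rightarrow> nat \<Rightarrow> ((nat \<Rightarrow> real) \<Rightarrow> real) set" where
  "polynomials N D =
     {f. \<exists>c. f = (\<lambda>z. \<Sum>\<alpha>\<in>exponents N D. c \<alpha> * (\<Prod>i<N. z i ^ \<alpha> i))}"

definition square_integrable :: "'a measure \<Rightarrow> ('a \<Rightarrow> real) \<Rightarrow> bool" where
  "square_integrable M f \<longleftrightarrow> f \<in> borel_measurable M \<and> integrable M (\<lambda>z. (f z)\<^sup>2)"

definition likelihood_ratio :: "'a measure \<Rightarrow> 'a measure \<Rightarrow> 'a \<Rightarrow> real" where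
  "likelihood_ratio P Q z = enn2real (RN_deriv Q P z)"

definition is_low_degree_projection ::
  "nat \<Rightarrow> (nat \<Rightarrow> real) measure \<Rightarrow> nat \<Rightarrow> ((nat \<Rightarrow> real) \<Rightarrow> real) \<Rightarrow> ((nat \<Rightarrow> real) \<Rightarrow> real) \<Rightarrow> bool" where
  "is_low_degree_projection N Q D L f \<longleftrightarrow>
     f \<in> polynomials N D \<and> square_integrable Q f \<and>
     (\<forall>g\<in>polynomials N D. square_integrable Q g \<longrightarrow> (\<integral>z. (L z - f z) * g z \<partial>Q) = 0)"

text \<open>For square integrable \<open>L\<close> the projection exists and is unique up to null sets.\<close>
definition low_degree_projection ::
  "nat \<Rightarrow> (nat \<Rightarrow> real) measure \<Rightarrow> nat \<Rightarrow> ((nat \<Rightarrow> real) \<Rightarrow> real) \<Rightarrow> (nat \<Rightarrow> real) \<Rightarrow> real" where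
  "low_degree_projection N Q D L = (SOME f. is_low_degree_projection N Q D L f)"

definition chi2_low_degree ::
  "nat \<Rightarrow> (nat \<Rightarrow> real) measure \<Rightarrow> (nat \<Rightarrow> real) measure \<Rightarrow> nat \<Rightarrow> real" where
  "chi2_low_degree N P Q D =
     (\<integral>z. (low_degree_projection N Q D (likelihood_ratio P Q) z)\<^sup>2 \<partial>Q) - 1"

fun admissible_problem :: "detection_problem \<Rightarrow> bool" where
  "admissible_problem (N, P, Q) \<longleftrightarrow>
     filterlim N at_top sequentially \<and>
     eventually (\<lambda>t. prob_space (P t) \<and> prob_space (Q t) \<and>
        sets (P t) = sets (real_space (N t)) \<and> sets (Q t) = sets (real_space (N t)) \<and>
        absolutely_continuous (Q t) (P t) \<and>
        square_integrable (Q t) (likelihood_ratio (P t) (Q t))) sequentially"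

text \<open>
  The low-degree conjecture for a class \<open>\<C>\<close> of problems.  The conjecture is meant for natural
  problems with some noise.  For \<open>\<C> = UNIV\<close> it reads as it is usually written, but then it has
  artificial counterexamples: for uniform signs and for signs with prescribed parities on long
  disjoint blocks, all low-degree moments agree.  Being parametric in \<open>\<C>\<close> covers both readings.
\<close>
definition low_degree_conjecture :: "detection_problem set \<Rightarrow> bool" where
  "low_degree_conjecture \<C> \<longleftrightarrow>
     (\<forall>(N, P, Q) \<in> \<C>. \<forall>D :: nat \<Rightarrow> nat.
        admissible_problem (N, P, Q) \<and> (\<lambda>t. real (D t)) \<in> \<omega>(\<lambda>t. ln (real (N t))) \<longrightarrow>
          ((\<lambda>t. chi2_low_degree (N t) (P t) (Q t) (D t)) \<in> O(\<lambda>_. 1) \<longrightarrow>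
             no_poly_time N (strong_detection (N, P, Q)) \<and>
             requires_exp_time N (strong_detection (N, P, Q)) (\<lambda>t. real (D t))) \<and>
          ((\<lambda>t. chi2_low_degree (N t) (P t) (Q t) (D t)) \<in> o(\<lambda>_. 1) \<longrightarrow>
             no_poly_time N (weak_detection (N, P, Q)) \<and>
             requires_exp_time N (weak_detection (N, P, Q)) (\<lambda>t. real (D t))))"


section \<open>The signal prior\<close>

text \<open>Vectors in \<open>\<real>\<^sup>p\<close> are functions that are extensional on \<open>{..<p}\<close>.\<close>

definition max_norm :: "nat \<Rightarrow> (nat \<Rightarrow> real) \<Rightarrow> real" where
  "max_norm p \<beta> = Max ((\<lambda>j. \<bar>\<beta> j\<bar>) ` {..<p})"

definition sparse_signals :: "nat \<Rightarrow> nat \<Rightarrow> real set \<Rightarrow> real \<Rightarrow> (nat \<Rightarrow> real) set" where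
  "sparse_signals p k \<D> r =
     {\<beta> \<in> extensional {..<p}. card {j. j < p \<and> \<beta> j \<noteq> 0} = k \<and>
        (\<forall>j<p. \<beta> j \<noteq> 0 \<longrightarrow> \<beta> j \<in> \<D>) \<and> L2_set \<beta> {..<p} = r}"

text \<open>
  If \<open>\<D>\<close> is infinite, the set of signals may be infinite as well.  ``Uniform'' therefore refers to
  the Hausdorff measure of the dimension \<open>s\<close> in which the set has positive finite measure.
  For finite sets this is \<open>s = 0\<close>, that is, counting measure; on smooth pieces of a sphere it is
  the surface measure up to a constant factor.
\<close>

definition euclid_dist :: "nat \<Rightarrow> (nat \<Rightarrow> real) \<Rightarrow> (nat \<Rightarrow> real) \<Rightarrow> real" where
  "euclid_dist p x y = L2_set (\<lambda>i. x i - y i) {..<p}"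

text \<open>The convention \<open>0\<^sup>0 = 1\<close> for singletons is needed here, while \<open>0 powr 0 = 0\<close>.\<close>
definition diam_power :: "nat \<Rightarrow> real \<Rightarrow> (nat \<Rightarrow> real) set \<Rightarrow> ennreal" where
  "diam_power p s U =
     (if U = {} then 0 else if s = 0 then 1
      else ennreal ((SUP (x, y)\<in>U \<times> U. euclid_dist p x y) powr s))"

definition hausdorff_measure :: "nat \<Rightarrow> real \<Rightarrow> (nat \<Rightarrow> real) set \<Rightarrow> ennreal" where
  "hausdorff_measure p s A =
     (SUP \<delta>\<in>{0<..}. INF U\<in>{U :: nat \<Rightarrow> (nat \<Rightarrow> real) set.
          A \<subseteq> (\<Union>i. U i) \<and> (\<forall>i. \<forall>x\<in>U i. \<forall>y\<in>U i. euclid_dist p x y \<le> \<delta>)}.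
        \<Sum>i. diam_power p s (U i))"

definition uniform_on :: "nat \<Rightarrow> (nat \<Rightarrow> real) set \<Rightarrow> (nat \<Rightarrow> real) measure \<Rightarrow> bool" where
  "uniform_on p A \<pi> \<longleftrightarrow>
     prob_space \<pi> \<and> sets \<pi> = sets (real_space p) \<and>
     (\<exists>s\<ge>0. 0 < hausdorff_measure p s A \<and> hausdorff_measure p s A < \<infinity> \<and>
        (\<forall>B\<in>sets (real_space p).
           emeasure \<pi> B = hausdorff_measure p s (A \<inter> B) / hausdorff_measure p s A))"


section \<open>Sparse linear regression\<close>

definition std_gaussian :: "'i set \<Rightarrow> ('i \<Rightarrow> real) measure" where
  "std_gaussian I = PiM I (\<lambda>_. density lborel std_normal_density)"

text \<open>The data \<open>(X, y)\<close> as a vector in \<open>\<real>\<^sup>N\<close>, \<open>N = n p + n\<close>: the rows of \<open>X\<close>, followed by \<open>y\<close>.\<close>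
definition data_vector :: "nat \<Rightarrow> nat \<Rightarrow> (nat \<times> nat \<Rightarrow> real) \<Rightarrow> (nat \<Rightarrow> real) \<Rightarrow> nat \<Rightarrow> real" where
  "data_vector n p X y =
     restrict (\<lambda>m. if m < n * p then X (m div p, m mod p) else y (m - n * p)) {..<n * p + n}"

definition slr_null :: "nat \<Rightarrow> nat \<Rightarrow> real \<Rightarrow> real \<Rightarrow> (nat \<Rightarrow> real) measure" where
  "slr_null n p r \<sigma> =
     distr (std_gaussian ({..<n} \<times> {..<p}) \<Otimes>\<^sub>M std_gaussian {..<n}) (real_space (n * p + n))
       (\<lambda>(X, w). data_vector n p X (\<lambda>i. sqrt (r\<^sup>2 / \<sigma>\<^sup>2 + 1) * w i))"

definition slr_alternative :: "nat \<Rightarrow> nat \<Rightarrow> real \<Rightarrow> (nat \<Rightarrow> real) measure \<Rightarrow> (nat \<Rightarrow> real) measure" where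
  "slr_alternative n p \<sigma> \<pi> =
     distr (std_gaussian ({..<n} \<times> {..<p}) \<Otimes>\<^sub>M \<pi> \<Otimes>\<^sub>M std_gaussian {..<n}) (real_space (n * p + n))
       (\<lambda>(X, \<beta>, w). data_vector n p X (\<lambda>i. (1 / \<sigma>) * (\<Sum>j<p. X (i, j) * \<beta> j) + w i))"

definition slr_dimension :: "(nat \<Rightarrow> nat) \<Rightarrow> nat \<Rightarrow> nat" where
  "slr_dimension n p = n p * p + n p"

definition slr_detection ::
  "(nat \<Rightarrow> nat) \<Rightarrow> (nat \<Rightarrow> real) \<Rightarrow> (nat \<Rightarrow> real) \<Rightarrow> (nat \<Rightarrow> (nat \<Rightarrow> real) measure) \<Rightarrow> detection_problem" where
  "slr_detection n r \<sigma> \<pi> =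
     (slr_dimension n, (\<lambda>p. slr_alternative (n p) p (\<sigma> p) (\<pi> p)), (\<lambda>p. slr_null (n p) p (r p) (\<sigma> p)))"

definition snr :: "real \<Rightarrow> real \<Rightarrow> real" where
  "snr r \<sigma> = r\<^sup>2 / \<sigma>\<^sup>2"

end

theory Submission
  imports Defs
begin

text \<open>
  Divide the response by \<open>\<tau> = \<surd>(SNR + 1)\<close>.  Given \<open>\<beta>\<close>, each row of the data is then a
  standard Gaussian vector \<open>x\<close> together with a standard Gaussian variable that has correlation
  \<open>u\<^sub>j = \<beta>\<^sub>j / (\<sigma> \<tau>)\<close> with \<open>x\<^sub>j\<close>.  The expectations of the Hermite basis under the alternative
  are explicit, and \<open>\<chi>\<^sup>2 + 1\<close> at degree \<open>D\<close> becomes the average, over two independent signals, of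
  \<open>\<Sum> t\<^bsup>\<bar>b\<bar>\<^esup>\<close> with \<open>t = \<langle>u, u'\<rangle>\<close>, where \<open>b\<close> runs over \<open>\<nat>\<^sup>n\<close> with \<open>2 \<bar>b\<bar> \<le> D\<close>.  This sum is at
  most \<open>exp ((n + D / 2) \<bar>t\<bar>)\<close>, and \<open>\<bar>t\<bar>\<close> is at most the overlap of the supports times
  \<open>max \<bar>u\<^sub>j\<bar>\<^sup>2\<close>.  For \<open>D = \<lfloor>\<epsilon> n\<rfloor>\<close> the bound on \<open>n\<close> turns this into \<open>p\<close> to the power \<open>1 - 2 \<theta>\<close> times
  the overlap.  The prior is invariant under permutations of the coordinates, because Hausdorff
  measure is, so the overlap is hypergeometric and its exponential moment is at most
  \<open>exp (p\<^bsup>1 - 2 \<theta>\<^esup> k\<^sup>2 / p) = O(1)\<close>.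
\<close>

section \<open>Hermite polynomials\<close>

text \<open>The conjecture speaks only about problems with a square integrable likelihood ratio, so
  the alternative also needs an explicit density. For a fixed signal it is a product over the rows
  of quotients of normal densities with second moment \<tau>^(2 n); Jensen's inequality passes this
  to the mixture. The bound serves only for finiteness.

  A basis element has nonzero mean only if in every row the degree in the design equals the degree
  in the response. Hence degree D leaves only \<bar>b\<bar> \<le> D / 2, and since at most (n + M)^M
  / M! vectors b have \<bar>b\<bar> = M, the exponential series appears with rate n + D / 2. The
  slack 1 - \<epsilon> in the bound on n pays for the extra D / 2 even when D is linear in n, and a
  linear D is what turns time exp (Omega~(D)) into exp (Omega~(n)).

  Nothing is known about the values of the signal beyond norm, sparsity and size. Bounding the inner
  product by the overlap of the supports discards the values and leaves a question about supports
  alone, which the symmetry of the prior answers.\<close>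

unbundle no vec_syntax and fps_syntax

text \<open>Normalised by \<open>1 / n!\<close>: \<open>v = 1\<close> gives \<open>He\<^sub>n x / n!\<close>, and \<open>v = 0\<close> gives \<open>x\<^sup>n / n!\<close>.\<close>
fun hermite :: "real \<Rightarrow> nat \<Rightarrow> real \<Rightarrow> real" where
  "hermite v 0 x = 1"
| "hermite v (Suc 0) x = x"
| "hermite v (Suc (Suc n)) x = (x * hermite v (Suc n) x - v * hermite v n x) / (real n + 2)"

section \<open>Generating functions of Hermite polynomials\<close>

definition hermite_fps :: "real \<Rightarrow> real \<Rightarrow> real fps" where
  "hermite_fps v x = Abs_fps (\<lambda>n. hermite v n x)"

lemma hermite_fps_nth [simp]: "hermite_fps v x $ n = hermite v n x"
  by (simp add: hermite_fps_def)

text \<open>The series exp (x X - v X^2 / 2), the generating function of the Hermite polynomials of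
  variance \<open>v\<close>, solves this equation. Comparing coefficients turns the equation into
  the three-term recurrence, so a solution is determined by its constant term.\<close>

lemma fps_linear_ode_nth:
  fixes F :: "real fps"
  assumes "fps_deriv F = (fps_const x - fps_const v * fps_X) * F"
  shows "F $ Suc 0 = x * F $ 0"
    and "F $ Suc (Suc n) = (x * F $ Suc n - v * F $ n) / (real n + 2)"
proof -
  have *: "fps_deriv F $ m = x * F $ m - v * (if m = 0 then 0 else F $ (m - 1))" for m
    unfolding assms by (simp add: left_diff_distrib mult.assoc)
  from *[of 0] show "F $ Suc 0 = x * F $ 0" by simp
  from *[of "Suc n"] show "F $ Suc (Suc n) = (x * F $ Suc n - v * F $ n) / (real n + 2)"
    by (simp add: field_simps)
qed

lemma hermite_fps_ode:
  "fps_deriv (hermite_fps v x) = (fps_const x - fps_const v * fps_X) * hermite_fps v x"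
proof (rule fps_ext)
  fix m
  show "fps_deriv (hermite_fps v x) $ m = ((fps_const x - fps_const v * fps_X) * hermite_fps v x) $ m"
    by (cases m) (simp_all add: left_diff_distrib mult.assoc field_simps)
qed

lemma hermite_fps_unique:
  assumes "fps_deriv F = (fps_const x - fps_const v * fps_X) * F" "F $ 0 = 1"
  shows "F = hermite_fps v x"
proof (rule fps_ext)
  fix n
  show "F $ n = hermite_fps v x $ n"
    using assms(2) fps_linear_ode_nth[OF assms(1)]
    by (induction v n x rule: hermite.induct) simp_all
qed

text \<open>The exponents x X - v X^2 / 2 add. Formally, the product solves the differential
  equation for the summed parameters, and the solution with constant term 1 is unique.\<close>

lemma hermite_fps_mult: "hermite_fps v x * hermite_fps w y = hermite_fps (v + w) (x + y)"
proof (rule hermite_fps_unique)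
  show "fps_deriv (hermite_fps v x * hermite_fps w y) =
      (fps_const (x + y) - fps_const (v + w) * fps_X) * (hermite_fps v x * hermite_fps w y)"
    by (simp add: hermite_fps_ode algebra_simps flip: fps_const_add)
qed simp

lemma hermite_fps_0: "hermite_fps 0 0 = 1"
  by (rule hermite_fps_unique[symmetric]) simp_all

text \<open>The value 0 outside \<open>J\<close> makes a multi-index a unique function, in
  accordance with \<open>exponents\<close>.\<close>

definition multi :: "'i set \<Rightarrow> nat \<Rightarrow> ('i \<Rightarrow> nat) set" where
  "multi J b = {a. (\<forall>j. j \<notin> J \<longrightarrow> a j = 0) \<and> sum a J = b}"

lemma finite_multi [simp]:
  assumes "finite J" shows "finite (multi J b)"
proof (rule finite_subset)
  show "multi J b \<subseteq> {a. \<forall>i. (i \<in> J \<longrightarrow> a i \<in> {..b}) \<and> (i \<notin> J \<longrightarrow> a i = 0)}"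
    using assms unfolding multi_def by (auto intro: member_le_sum)
  show "finite {a. \<forall>i. (i \<in> J \<longrightarrow> a i \<in> {..b}) \<and> (i \<notin> J \<longrightarrow> a i = (0::nat))}"
    by (rule finite_set_of_finite_funs) (auto simp: assms)
qed

lemma multi_empty: "multi {} b = (if b = 0 then {\<lambda>_. 0} else {})"
  by (auto simp: multi_def)

lemma fps_prod_nth_multi:
  fixes f :: "'i \<Rightarrow> 'a::comm_ring_1 fps"
  assumes "finite J"
  shows "(\<Prod>j\<in>J. f j) $ b = (\<Sum>a\<in>multi J b. \<Prod>j\<in>J. f j $ a j)"
  using assms
proof (induction J arbitrary: b)
  case empty
  then show ?case by (cases "b = 0") (simp_all add: multi_empty)
next
  case (insert x J)
  have "(\<Prod>j\<in>insert x J. f j) $ b = (\<Sum>i\<le>b. f x $ i * (\<Sum>a\<in>multi J (b - i). \<Prod>j\<in>J. f j $ a j))"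
    using insert by (simp add: fps_mult_nth atLeast0AtMost)
  also have "\<dots> = (\<Sum>(i, a)\<in>Sigma {..b} (\<lambda>i. multi J (b - i)). f x $ i * (\<Prod>j\<in>J. f j $ a j))"
    using insert by (simp add: sum_distrib_left sum.Sigma)
  also have "\<dots> = (\<Sum>a\<in>multi (insert x J) b. \<Prod>j\<in>insert x J. f j $ a j)"
  \<comment> \<open>A multi-index on \<open>insert x J\<close> is its value at \<open>x\<close>
    together with a multi-index on \<open>J\<close>; the latter has the default value 0 at
    \<open>x\<close>.\<close>
  proof (rule sum.reindex_bij_witness[where i = "\<lambda>a. (a x, a(x := 0))" and j = "\<lambda>(i, a). a(x := i)"])
    fix q assume "q \<in> Sigma {..b} (\<lambda>i. multi J (b - i))"
    then obtain i a where q: "q = (i, a)" "i \<le> b" and a: "a \<in> multi J (b - i)" by auto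
    have a0: "a x = 0" using a insert.hyps by (auto simp: multi_def)
    then have "a(x := 0) = a" by auto
    then show "(\<lambda>a. (a x, a(x := 0))) (case q of (i, a) \<Rightarrow> a(x := i)) = q"
      by (simp add: q)
    have s: "sum (a(x := i)) J = sum a J" using insert.hyps by (intro sum.cong) auto
    show "(case q of (i, a) \<Rightarrow> a(x := i)) \<in> multi (insert x J) b"
      using a insert.hyps q s by (auto simp: multi_def)
    have "(\<Prod>j\<in>J. f j $ (a(x := i)) j) = (\<Prod>j\<in>J. f j $ a j)"
      using insert.hyps by (intro prod.cong) auto
    then show "(\<Prod>j\<in>insert x J. f j $ (case q of (i, a) \<Rightarrow> a(x := i)) j) =
        (case q of (i, a) \<Rightarrow> f x $ i * (\<Prod>j\<in>J. f j $ a j))"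
      using insert.hyps by (simp add: q)
  next
    fix a assume a: "a \<in> multi (insert x J) b"
    show "(case (a x, a(x := 0)) of (i, a) \<Rightarrow> a(x := i)) = a" by simp
    have s: "sum (a(x := 0)) J = sum a J" using insert.hyps by (intro sum.cong) auto
    have "b = a x + sum a J" using a insert.hyps by (auto simp: multi_def)
    then show "(a x, a(x := 0)) \<in> Sigma {..b} (\<lambda>i. multi J (b - i))"
      using a s by (auto simp: multi_def)
  qed
  finally show ?case .
qed

text \<open>Compare coefficients in the product of the generating functions. The variance parameter
  gives the formula two uses: with variances of sum 1 it expands a Hermite polynomial of a standard
  normal combination, and with variances 0 it is the multinomial theorem.\<close>

lemma hermite_sum:
  assumes "finite J"
  shows "hermite (sum v J) b (sum x J) = (\<Sum>a\<in>multi J b. \<Prod>j\<in>J. hermite (v j) (a j) (x j))"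
proof -
  have "hermite_fps (sum v J) (sum x J) = (\<Prod>j\<in>J. hermite_fps (v j) (x j))"
    using assms by (induction J) (simp_all add: hermite_fps_0 flip: hermite_fps_mult)
  from arg_cong[OF this, of "\<lambda>F. F $ b"] show ?thesis
    using assms by (simp add: fps_prod_nth_multi)
qed

lemma hermite_variance_0: "hermite 0 n x = x ^ n / fact n"
  by (induction "0::real" n x rule: hermite.induct) (simp_all add: field_simps)

lemma multinomial_sum:
  fixes x :: "'i \<Rightarrow> real"
  assumes "finite J"
  shows "sum x J ^ b = fact b * (\<Sum>a\<in>multi J b. \<Prod>j\<in>J. x j ^ a j / fact (a j))"
  using hermite_sum[OF assms, of "\<lambda>_. 0" b x] by (simp add: hermite_variance_0 field_simps)

text \<open>Replacing X by c X in the generating function. With \<open>v = 1\<close> it turns the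
  variances \<open>(w j)\<^sup>2\<close> in the expansion of a linear form with weights
  \<open>w j\<close> into powers of the weights.\<close>

lemma hermite_scale: "hermite (c\<^sup>2 * v) n (c * x) = c ^ n * hermite v n x"
  by (induction v n x rule: hermite.induct) (simp_all add: field_simps power2_eq_square)

text \<open>The case \<open>v = 1\<close> as a formal polynomial, which makes derivative and degree
  available.\<close>

fun hermite_poly :: "nat \<Rightarrow> real poly" where
  "hermite_poly 0 = 1"
| "hermite_poly (Suc 0) = [:0, 1:]"
| "hermite_poly (Suc (Suc n)) =
     smult (1 / (real n + 2)) ([:0, 1:] * hermite_poly (Suc n) - hermite_poly n)"

lemma poly_hermite_poly: "poly (hermite_poly n) x = hermite 1 n x"
  by (induction n rule: hermite_poly.induct) simp_all

text \<open>In the normalisation by 1 / n! differentiation lowers the index without a factor. The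
  recurrence reaches back two indices, hence strong induction.\<close>

lemma pderiv_hermite_poly: "pderiv (hermite_poly (Suc n)) = hermite_poly n"
proof (induction n rule: less_induct)
  case (less n)
  show ?case
  proof (cases n)
    case 0 then show ?thesis by (simp add: pderiv_pCons)
  next
    case (Suc m)
    have "pderiv (hermite_poly (Suc (Suc m))) = smult (1 / (real m + 2))
        (hermite_poly (Suc m) + [:0, 1:] * hermite_poly m - pderiv (hermite_poly m))"
      using less[of m] Suc by (simp add: pderiv_smult pderiv_diff pderiv_mult pderiv_pCons)
    \<comment> \<open>The induction hypothesis turns the derivative of \<open>hermite_poly m\<close>
      into the lower term of the recurrence, so the difference is the next polynomial times its
      index.\<close>
    also have "[:0, 1:] * hermite_poly m - pderiv (hermite_poly m) = smult (real m + 1) (hermite_poly (Suc m))"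
    proof (cases m)
      case (Suc l)
      then show ?thesis using less[of l] \<open>n = Suc m\<close> by (simp add: field_simps)
    qed simp
    then have "hermite_poly (Suc m) + [:0, 1:] * hermite_poly m - pderiv (hermite_poly m) =
        smult (real m + 2) (hermite_poly (Suc m))"
      using smult_add_left[of 1 "real m + 1" "hermite_poly (Suc m)"]
      by (simp only: add_diff_eq[symmetric] smult_1_left) (simp add: add.commute)
    finally show ?thesis by (simp add: Suc)
  qed
qed

section \<open>Gaussian moments and orthogonality\<close>

abbreviation gauss :: "real measure" where
  "gauss \<equiv> density lborel std_normal_density"

lemma prob_space_gauss [simp]: "prob_space gauss"
  by (rule prob_space_normal_density) simp

lemma integrable_gauss_power [simp]: "integrable gauss (\<lambda>x. x ^ k)"
  using integrable_std_normal_moment[of k]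
  by (subst integrable_real_density) (auto simp: normal_density_nonneg)

lemma integrable_gauss_poly [simp]: "integrable gauss (\<lambda>x. poly q x)"
  by (simp add: poly_altdef)

text \<open>Integration by parts on monomials, read off from the closed forms of the even and odd
  moments. At \<open>k = 0\<close> the truncated \<open>k - 1\<close> is harmless because of the
  factor \<open>k\<close>.\<close>

lemma integral_gauss_power_Suc: "(\<integral>x. x ^ Suc k \<partial>gauss) = real k * (\<integral>x. x ^ (k - 1) \<partial>gauss)"
proof -
  have *: "(\<integral>x. x ^ m \<partial>gauss) = (\<integral>x. std_normal_density x * x ^ m \<partial>lborel)" for m
    by (subst integral_real_density) auto
  show ?thesis
  proof (cases "even k")
    case True
    then obtain l where l: "k = 2 * l" by (auto elim: evenE)
    have "(\<integral>x. x ^ (k - 1) \<partial>gauss) = 0 \<or> k = 0"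
      using integral_std_normal_moment_odd[of "l - 1"] unfolding * l
      by (cases l) auto
    then show ?thesis using integral_std_normal_moment_odd[of l] unfolding * l by auto
  next
    case False
    then obtain l where l: "k = 2 * l + 1" by (auto elim: oddE)
    have "(\<integral>x. x ^ Suc k \<partial>gauss) = fact (2 * Suc l) / (2 ^ Suc l * fact (Suc l))"
      using integral_std_normal_moment_even[of "Suc l"] unfolding * l by simp
    also have "\<dots> = real k * (fact (2 * l) / (2 ^ l * fact l))"
      by (simp add: l divide_simps)
    also have "fact (2 * l) / (2 ^ l * fact l) = (\<integral>x. x ^ (k - 1) \<partial>gauss)"
      using integral_std_normal_moment_even[of l] unfolding * l by simp
    finally show ?thesis .
  qed
qed

lemma gauss_stein: "(\<integral>x. x * poly q x \<partial>gauss) = (\<integral>x. poly (pderiv q) x \<partial>gauss)"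
proof -
  have "(\<integral>x. x * poly q x \<partial>gauss) = (\<integral>x. (\<Sum>i\<le>degree q. coeff q i * x ^ Suc i) \<partial>gauss)"
    by (simp add: poly_altdef sum_distrib_left mult_ac)
  also have "\<dots> = (\<Sum>i\<le>degree q. coeff q i * (\<integral>x. x ^ Suc i \<partial>gauss))"
    by (subst Bochner_Integration.integral_sum) (simp_all del: power_Suc)
  also have "\<dots> = (\<Sum>i\<le>degree q. coeff q i * (real i * (\<integral>x. x ^ (i - 1) \<partial>gauss)))"
    by (simp only: integral_gauss_power_Suc)
  also have "\<dots> = (\<integral>x. (\<Sum>i\<le>degree q. coeff q i * real i * x ^ (i - 1)) \<partial>gauss)"
    by (subst Bochner_Integration.integral_sum) (simp_all add: mult.assoc)
  also have "(\<lambda>x. \<Sum>i\<le>degree q. coeff q i * real i * x ^ (i - 1)) = (\<lambda>x. poly (pderiv q) x)"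
  proof
    fix x
    have "((\<lambda>x. poly q x) has_real_derivative (\<Sum>i\<le>degree q. coeff q i * real i * x ^ (i - 1))) (at x)"
      unfolding poly_altdef by (auto intro!: derivative_eq_intros sum.cong)
    then show "(\<Sum>i\<le>degree q. coeff q i * real i * x ^ (i - 1)) = poly (pderiv q) x"
      using poly_DERIV DERIV_unique by blast
  qed
  finally show ?thesis .
qed

lemma borel_measurable_hermite [measurable]: "hermite v n \<in> borel_measurable borel"
proof (induction v n "0::real" rule: hermite.induct)
  case (3 v n)
  have "hermite v (Suc (Suc n)) = (\<lambda>x. (x * hermite v (Suc n) x - v * hermite v n x) / (real n + 2))"
    by auto
  then show ?case using 3 by simp
qed (simp_all add: fun_eq_iff[of "hermite _ _"] cong: measurable_cong)

lemma integrable_hermite_mult [simp]: "integrable gauss (\<lambda>x. hermite 1 m x * hermite 1 n x)"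
  using integrable_gauss_poly[of "hermite_poly m * hermite_poly n"] by (simp add: poly_hermite_poly)

text \<open>Stein's identity for the product of two Hermite polynomials, combined with the
  recurrence, lowers both indices by one. This reduces everything to index 0, where the same
  argument gives 0 unless both indices vanish.\<close>

lemma integral_hermite_mult:
  "(\<integral>x. hermite 1 m x * hermite 1 n x \<partial>gauss) = (if m = n then 1 / fact n else 0)"
proof -
  define I where "I m n = (\<integral>x. hermite 1 m x * hermite 1 n x \<partial>gauss)" for m n
  have sym: "I m n = I n m" for m n by (simp add: I_def mult.commute)
  have poly: "I m n = (\<integral>x. poly (hermite_poly m * hermite_poly n) x \<partial>gauss)" for m n
    by (simp add: I_def poly_hermite_poly)
  have x_int: "integrable gauss (\<lambda>x. x * hermite 1 m x * hermite 1 n x)" for m n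
    using integrable_gauss_poly[of "[:0,1:] * hermite_poly m * hermite_poly n"]
    by (simp add: poly_hermite_poly mult.assoc)
  have stein: "(\<integral>x. x * hermite 1 m x * hermite 1 n x \<partial>gauss) =
      (\<integral>x. poly (pderiv (hermite_poly m) * hermite_poly n + hermite_poly m * pderiv (hermite_poly n)) x \<partial>gauss)"
    for m n
    using gauss_stein[of "hermite_poly m * hermite_poly n"]
    by (simp add: poly_hermite_poly pderiv_mult mult_ac add_ac)
  have rec2: "(real n + 2) * I m (Suc (Suc n)) =
      (\<integral>x. x * hermite 1 m x * hermite 1 (Suc n) x \<partial>gauss) - I m n" for m n
  proof -
    have "(real n + 2) * I m (Suc (Suc n)) =
        (\<integral>x. x * hermite 1 m x * hermite 1 (Suc n) x - hermite 1 m x * hermite 1 n x \<partial>gauss)"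
      unfolding I_def by (subst integral_mult_right_zero[symmetric], intro Bochner_Integration.integral_cong) (auto simp: field_simps)
    then show ?thesis using x_int[of m "Suc n"] by (simp add: I_def)
  qed
  \<comment> \<open>For \<open>n = Suc l\<close>, Stein's identity gives
    \<open>I m (Suc l) + I (Suc m) l\<close>, and the second summand is exactly what the recurrence
    \<open>rec2\<close> subtracts.\<close>
  have step: "(real n + 1) * I (Suc m) (Suc n) = I m n" for m n
  proof (cases n)
    case 0
    have "I (Suc m) (Suc 0) = (\<integral>x. x * hermite 1 (Suc m) x * hermite 1 0 x \<partial>gauss)"
      by (simp add: I_def mult_ac)
    also have "\<dots> = I m 0"
      unfolding stein pderiv_hermite_poly by (simp add: poly)
    finally show ?thesis by (simp add: 0)
  next
    case (Suc l)
    have "(\<integral>x. x * hermite 1 (Suc m) x * hermite 1 (Suc l) x \<partial>gauss) = I m (Suc l) + I (Suc m) l"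
      unfolding stein pderiv_hermite_poly poly poly_add
      by (subst Bochner_Integration.integral_add[OF integrable_gauss_poly integrable_gauss_poly])
        (simp add: mult.commute)
    then show ?thesis using rec2[of l "Suc m"] by (simp add: Suc add_ac)
  qed
  have zero: "I 0 (Suc n) = 0" for n
  proof (cases n)
    case 0 then show ?thesis using integral_gauss_power_Suc[of 0] by (simp add: I_def)
  next
    case (Suc l)
    have "(\<integral>x. x * hermite 1 0 x * hermite 1 (Suc l) x \<partial>gauss) = I 0 l"
      unfolding stein pderiv_hermite_poly poly by simp
    then show ?thesis using rec2[of l 0] by (simp add: Suc add_eq_0_iff)
  qed
  have I00: "I 0 0 = 1"
    using prob_space.prob_space[OF prob_space_gauss] by (simp add: I_def)
  have "I m n = (if m = n then 1 / fact n else 0)"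
  proof (induction m arbitrary: n)
    case 0
    show ?case using zero I00 by (cases n) auto
  next
    case (Suc m)
    show ?case
    proof (cases n)
      case 0 then show ?thesis using zero sym by simp
    next
      case (Suc l)
      have "I (Suc m) (Suc l) = I m l / (real l + 1)" using step[of l m] by (simp add: eq_divide_eq mult.commute)
      also have "I m l = (if m = l then 1 / fact l else 0)" by (rule Suc.IH)
      finally show ?thesis by (auto simp: Suc add.commute)
    qed
  qed
  then show ?thesis by (simp add: I_def)
qed

section \<open>The orthonormal polynomials He_n / sqrt (n!) and the monomials\<close>

definition nhermite :: "nat \<Rightarrow> real \<Rightarrow> real" where
  "nhermite n x = sqrt (fact n) * hermite 1 n x"

lemma borel_measurable_nhermite [measurable]: "nhermite n \<in> borel_measurable borel"
  unfolding nhermite_def[abs_def] by measurable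

lemma nhermite_0 [simp]: "nhermite 0 x = 1"
  by (simp add: nhermite_def)

lemma integrable_nhermite_mult: "integrable gauss (\<lambda>x. nhermite m x * nhermite n x)"
  using integrable_mult_right[OF integrable_hermite_mult, of "sqrt (fact m) * sqrt (fact n)" m n]
  by (simp add: nhermite_def mult_ac)

lemma integral_nhermite_mult:
  "(\<integral>x. nhermite m x * nhermite n x \<partial>gauss) = (if m = n then 1 else 0)"
proof -
  have "(\<integral>x. nhermite m x * nhermite n x \<partial>gauss) =
      sqrt (fact m) * sqrt (fact n) * (\<integral>x. hermite 1 m x * hermite 1 n x \<partial>gauss)"
    by (subst integral_mult_right_zero[symmetric], intro Bochner_Integration.integral_cong)
      (simp_all add: nhermite_def)
  then show ?thesis by (simp add: integral_hermite_mult)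
qed

text \<open>This and the converse below are triangular: only degrees up to \<open>n\<close> occur. A
  basis change in each coordinate therefore respects the bound on the total degree.\<close>

lemma nhermite_in_span_powers: "\<exists>c. \<forall>x. nhermite n x = (\<Sum>k\<le>n. c k * x ^ k)"
proof -
  have "degree (hermite_poly n) \<le> n"
  proof (induction n rule: hermite_poly.induct)
    case (3 n)
    have "degree ([:0, 1:] * hermite_poly (Suc n)) \<le> Suc (Suc n)"
      using 3 by (simp add: degree_pCons_eq_if)
    moreover have "degree (hermite_poly n) \<le> Suc (Suc n)"
      using 3 by simp
    ultimately have "degree ([:0, 1:] * hermite_poly (Suc n) - hermite_poly n) \<le> Suc (Suc n)"
      by (rule degree_diff_le)
    then show ?case
      unfolding hermite_poly.simps by (rule order_trans[OF degree_smult_le])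
  qed simp_all
  then have *: "poly (hermite_poly n) x = (\<Sum>k\<le>n. coeff (hermite_poly n) k * x ^ k)" for x
    by (subst poly_altdef, intro sum.mono_neutral_left) (auto simp: coeff_eq_0)
  show ?thesis
    by (intro exI[of _ "\<lambda>k. sqrt (fact n) * coeff (hermite_poly n) k"])
      (simp add: nhermite_def poly_hermite_poly[symmetric] * sum_distrib_left mult.assoc)
qed

lemma power_in_span_nhermite: "\<exists>c. \<forall>x. x ^ n = (\<Sum>k\<le>n. c k * nhermite k x)"
proof (induction n)
  case 0
  show ?case by (intro exI[of _ "\<lambda>_. 1"]) simp
next
  case (Suc n)
  then obtain c where c: "\<And>x. x ^ n = (\<Sum>k\<le>n. c k * nhermite k x)" by blast
  have "\<exists>d. \<forall>x. x * nhermite k x = (\<Sum>l\<le>Suc n. d l * nhermite l x)" if "k \<le> n" for k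
  proof -
    have rec: "x * hermite 1 k x = (real k + 1) * hermite 1 (Suc k) x +
        (if k = 0 then 0 else hermite 1 (k - 1) x)" for x
      by (cases k) (simp_all add: field_simps)
    \<comment> \<open>The coefficients in x He_k = He_(k+1) + k He_(k-1), rescaled to unit norm; for
      \<open>k = 0\<close> the second condition never holds.\<close>
    let ?d = "\<lambda>l. (if l = Suc k then sqrt (fact k) * (real k + 1) / sqrt (fact (Suc k)) else 0) +
      (if Suc l = k then sqrt (fact k) / sqrt (fact l) else 0)"
    have "x * nhermite k x = (\<Sum>l\<le>Suc n. ?d l * nhermite l x)" for x
    proof -
      have "(\<Sum>l\<le>Suc n. (if Suc l = k then sqrt (fact k) / sqrt (fact l) else 0) * nhermite l x) =
          (if k = 0 then 0 else sqrt (fact k) * hermite 1 (k - 1) x)"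
      proof (cases k)
        case (Suc l)
        have "(\<Sum>l\<le>Suc n. (if Suc l = k then sqrt (fact k) / sqrt (fact l) else 0) * nhermite l x) =
            (\<Sum>l'\<le>Suc n. if l' = l then sqrt (fact k) / sqrt (fact l) * nhermite l x else 0)"
          by (intro sum.cong) (auto simp: Suc)
        also have "\<dots> = sqrt (fact k) / sqrt (fact l) * nhermite l x"
          using that Suc by (subst sum.delta) auto
        finally show ?thesis by (simp add: Suc nhermite_def del: fact_Suc)
      qed simp
      moreover have "(\<Sum>l\<le>Suc n. (if l = Suc k then sqrt (fact k) * (real k + 1) / sqrt (fact (Suc k)) else 0) * nhermite l x)
          = sqrt (fact k) * (real k + 1) * hermite 1 (Suc k) x"
      proof -
        have "(\<Sum>l\<le>Suc n. (if l = Suc k then sqrt (fact k) * (real k + 1) / sqrt (fact (Suc k)) else 0) * nhermite l x)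
          = (\<Sum>l\<le>Suc n. if l = Suc k then sqrt (fact k) * (real k + 1) / sqrt (fact (Suc k)) * nhermite (Suc k) x else 0)"
          by (intro sum.cong) auto
        then show ?thesis using that by (simp add: nhermite_def del: fact_Suc sum.atMost_Suc hermite.simps)
      qed
      ultimately have "(\<Sum>l\<le>Suc n. ?d l * nhermite l x) = sqrt (fact k) *
          ((real k + 1) * hermite 1 (Suc k) x + (if k = 0 then 0 else hermite 1 (k - 1) x))"
        by (simp only: distrib_right sum.distrib) (simp add: algebra_simps del: hermite.simps)
      then show ?thesis
        by (simp only: rec[symmetric]) (simp add: nhermite_def del: sum.atMost_Suc)
    qed
    then have "\<forall>x. x * nhermite k x = (\<Sum>l\<le>Suc n. ?d l * nhermite l x)" ..
    then show ?thesis by (rule exI[of _ ?d])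
  qed
  then obtain d where d: "\<And>k x. k \<le> n \<Longrightarrow> x * nhermite k x = (\<Sum>l\<le>Suc n. d k l * nhermite l x)"
    by metis
  have "x ^ Suc n = (\<Sum>l\<le>Suc n. (\<Sum>k\<le>n. c k * d k l) * nhermite l x)" for x
  proof -
    have "x ^ Suc n = (\<Sum>k\<le>n. c k * (x * nhermite k x))"
      by (simp add: c sum_distrib_left mult_ac)
    also have "\<dots> = (\<Sum>k\<le>n. \<Sum>l\<le>Suc n. c k * d k l * nhermite l x)"
      by (intro sum.cong refl) (simp add: d sum_distrib_left mult.assoc del: sum.atMost_Suc)
    finally show ?thesis by (subst (asm) sum.swap) (simp add: sum_distrib_right del: sum.atMost_Suc)
  qed
  then have "\<forall>x. x ^ Suc n = (\<Sum>l\<le>Suc n. (\<Sum>k\<le>n. c k * d k l) * nhermite l x)" ..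
  then show ?case by (rule exI[of _ "\<lambda>l. \<Sum>k\<le>n. c k * d k l"])
qed

section \<open>Low-degree projections\<close>

text \<open>Distributivity with choice functions that take a fixed default outside \<open>A\<close>,
  as exponents do, instead of being undefined there. Restriction to \<open>A\<close> is a bijection
  between the two kinds.\<close>

lemma prod_sum_PiE_dflt:
  fixes f :: "'a \<Rightarrow> 'b \<Rightarrow> 'c :: comm_semiring_1"
  assumes "finite A" "\<And>x. x \<in> A \<Longrightarrow> finite (B x)"
  shows "(\<Prod>x\<in>A. \<Sum>y\<in>B x. f x y) = (\<Sum>g\<in>PiE_dflt A d B. \<Prod>x\<in>A. f x (g x))"
proof -
  have "(\<Prod>x\<in>A. \<Sum>y\<in>B x. f x y) = (\<Sum>g\<in>PiE A B. \<Prod>x\<in>A. f x (g x))"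
    using assms by (rule prod_sum_PiE)
  also have "PiE A B = (\<lambda>h. restrict h A) ` PiE_dflt A d B"
    by (rule restrict_PiE_dflt[symmetric])
  also have "(\<Sum>g\<in>\<dots>. \<Prod>x\<in>A. f x (g x)) = (\<Sum>g\<in>PiE_dflt A d B. \<Prod>x\<in>A. f x (g x))"
    by (subst sum.reindex) (force simp: inj_on_def restrict_def fun_eq_iff PiE_dflt_def)+
  finally show ?thesis .
qed

definition product_span :: "nat \<Rightarrow> nat \<Rightarrow> (nat \<Rightarrow> nat \<Rightarrow> real \<Rightarrow> real) \<Rightarrow> ((nat \<Rightarrow> real) \<Rightarrow> real) set" where
  "product_span N D h = {f. \<exists>c. f = (\<lambda>z. \<Sum>\<alpha>\<in>exponents N D. c \<alpha> * (\<Prod>i<N. h i (\<alpha> i) (z i)))}"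

text \<open>Expanding every factor of a product produces only exponents that are componentwise at
  most the old one, so the total degree does not grow.\<close>

lemma product_span_mono:
  assumes "\<And>i m. i < N \<Longrightarrow> \<exists>c. \<forall>x. g i m x = (\<Sum>k\<le>m. c k * h i k x)"
  shows "product_span N D g \<subseteq> product_span N D h"
proof -
  from assms obtain C where C: "\<And>i m x. i < N \<Longrightarrow> g i m x = (\<Sum>k\<le>m. C i m k * h i k x)"
    by metis
  define S where "S \<alpha> = PiE_dflt {..<N} 0 (\<lambda>i. {..\<alpha> i})" for \<alpha> :: "nat \<Rightarrow> nat"
  have S_fin: "finite (S \<alpha>)" for \<alpha>
    unfolding S_def by (rule finite_PiE_dflt) auto
  have S_sub: "S \<alpha> \<subseteq> exponents N D" if "\<alpha> \<in> exponents N D" for \<alpha>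
  proof
    fix \<gamma> assume \<gamma>: "\<gamma> \<in> S \<alpha>"
    then have "(\<Sum>i<N. \<gamma> i) \<le> (\<Sum>i<N. \<alpha> i)"
      by (intro sum_mono) (simp add: S_def PiE_dflt_def)
    with \<gamma> that show "\<gamma> \<in> exponents N D"
      by (simp add: S_def PiE_dflt_def exponents_def)
  qed
  have expand: "(\<Prod>i<N. g i (\<alpha> i) (z i)) =
      (\<Sum>\<gamma>\<in>exponents N D. (if \<gamma> \<in> S \<alpha> then \<Prod>i<N. C i (\<alpha> i) (\<gamma> i) else 0) * (\<Prod>i<N. h i (\<gamma> i) (z i)))"
    if "\<alpha> \<in> exponents N D" for \<alpha> z
  proof -
    have "(\<Prod>i<N. g i (\<alpha> i) (z i)) = (\<Prod>i<N. \<Sum>k\<le>\<alpha> i. C i (\<alpha> i) k * h i k (z i))"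
      by (intro prod.cong) (auto simp: C)
    also have "\<dots> = (\<Sum>\<gamma>\<in>S \<alpha>. \<Prod>i<N. C i (\<alpha> i) (\<gamma> i) * h i (\<gamma> i) (z i))"
      unfolding S_def by (rule prod_sum_PiE_dflt) auto
    also have "\<dots> = (\<Sum>\<gamma>\<in>exponents N D. if \<gamma> \<in> S \<alpha> then \<Prod>i<N. C i (\<alpha> i) (\<gamma> i) * h i (\<gamma> i) (z i) else 0)"
      using S_sub[OF that] finite_exponents by (simp add: sum.inter_restrict[symmetric] Int_absorb1)
    finally show ?thesis by (simp add: prod.distrib if_distrib[of "\<lambda>x. x * _"] cong: if_cong)
  qed
  show ?thesis
  proof
    fix f assume "f \<in> product_span N D g"
    then obtain c where f: "f = (\<lambda>z. \<Sum>\<alpha>\<in>exponents N D. c \<alpha> * (\<Prod>i<N. g i (\<alpha> i) (z i)))"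
      by (auto simp: product_span_def)
    have "f z = (\<Sum>\<gamma>\<in>exponents N D. (\<Sum>\<alpha>\<in>exponents N D. c \<alpha> *
        (if \<gamma> \<in> S \<alpha> then \<Prod>i<N. C i (\<alpha> i) (\<gamma> i) else 0)) * (\<Prod>i<N. h i (\<gamma> i) (z i)))" for z
    proof -
      have "f z = (\<Sum>\<alpha>\<in>exponents N D. \<Sum>\<gamma>\<in>exponents N D. c \<alpha> *
        (if \<gamma> \<in> S \<alpha> then \<Prod>i<N. C i (\<alpha> i) (\<gamma> i) else 0) * (\<Prod>i<N. h i (\<gamma> i) (z i)))"
        unfolding f by (intro sum.cong refl) (simp only: expand sum_distrib_left mult.assoc)
      then show ?thesis by (subst (asm) sum.swap) (simp add: sum_distrib_right)
    qed
    then show "f \<in> product_span N D h"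
      unfolding product_span_def mem_Collect_eq
      by (intro exI[of _ "\<lambda>\<gamma>. \<Sum>\<alpha>\<in>exponents N D. c \<alpha> *
        (if \<gamma> \<in> S \<alpha> then \<Prod>i<N. C i (\<alpha> i) (\<gamma> i) else 0)"] ext)
  qed
qed

section \<open>Parseval's identity for the low-degree likelihood ratio\<close>

lemma integrable_mult_square_integrable:
  assumes "square_integrable M f" "square_integrable M g"
  shows "integrable M (\<lambda>x. f x * g x)"
proof (rule Bochner_Integration.integrable_bound)
  show "integrable M (\<lambda>x. (f x)\<^sup>2 + (g x)\<^sup>2)"
    using assms by (simp add: square_integrable_def)
  show "(\<lambda>x. f x * g x) \<in> borel_measurable M"
    using assms by (intro borel_measurable_times) (simp_all add: square_integrable_def)
  have "\<bar>a * b\<bar> \<le> a\<^sup>2 + b\<^sup>2" for a b :: real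
  proof -
    have "2 * \<bar>a * b\<bar> \<le> a\<^sup>2 + b\<^sup>2"
      using sum_squares_bound[of "\<bar>a\<bar>" "\<bar>b\<bar>"] by (simp add: abs_mult mult.assoc)
    then show ?thesis using abs_ge_zero[of "a * b"] by linarith
  qed
  then show "AE x in M. norm (f x * g x) \<le> norm ((f x)\<^sup>2 + (g x)\<^sup>2)"
    by (auto intro: order_trans[OF _ abs_ge_self])
qed

text \<open>The Radon-Nikodym derivative of a finite measure is finite almost everywhere, so its
  real-valued version still represents \<open>P\<close>.\<close>

lemma likelihood_ratio_integral:
  assumes "prob_space P" "prob_space Q" "sets P = sets Q" "absolutely_continuous Q P"
    and "f \<in> borel_measurable Q"
  shows "(\<integral>z. f z \<partial>P) = (\<integral>z. likelihood_ratio P Q z * f z \<partial>Q)"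
    and "integrable P f \<longleftrightarrow> integrable Q (\<lambda>z. likelihood_ratio P Q z * f z)"
proof -
  interpret P: prob_space P by fact
  interpret Q: prob_space Q by fact
  have [measurable]: "likelihood_ratio P Q \<in> borel_measurable Q"
    unfolding likelihood_ratio_def[abs_def] by measurable
  have "AE z in Q. RN_deriv Q P z \<noteq> \<infinity>"
    using assms by (intro Q.RN_deriv_finite) (auto intro: P.sigma_finite_measure_axioms)
  then have "density Q (RN_deriv Q P) = density Q (\<lambda>z. ennreal (likelihood_ratio P Q z))"
    by (intro density_cong) (auto simp: likelihood_ratio_def top.not_eq_extremum)
  with Q.density_RN_deriv[OF assms(4)] assms(3)
  have P: "P = density Q (\<lambda>z. ennreal (likelihood_ratio P Q z))" by simp
  have nn: "AE z in Q. 0 \<le> likelihood_ratio P Q z" by (simp add: likelihood_ratio_def)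
  show "(\<integral>z. f z \<partial>P) = (\<integral>z. likelihood_ratio P Q z * f z \<partial>Q)"
    by (subst P, subst integral_real_density) (use assms nn in auto)
  show "integrable P f \<longleftrightarrow> integrable Q (\<lambda>z. likelihood_ratio P Q z * f z)"
    by (subst P, subst integrable_real_density) (use assms nn in auto)
qed

text \<open>The coefficient of the likelihood ratio at a basis element is the mean of that element
  under \<open>P\<close>, and the squared norm of the projection is the sum of the squared
  coefficients.\<close>

lemma chi2_low_degree_orthonormal:
  assumes "prob_space P" "prob_space Q" "sets P = sets Q" "absolutely_continuous Q P"
    and L: "square_integrable Q (likelihood_ratio P Q)"
    and poly: "polynomials N D = product_span N D h"
    and H: "\<And>\<alpha>. H \<alpha> = (\<lambda>z. \<Prod>i<N. h i (\<alpha> i) (z i))"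
    and sq: "\<And>\<alpha>. square_integrable Q (H \<alpha>)"
    and orth: "\<And>\<alpha> \<beta>. \<alpha> \<in> exponents N D \<Longrightarrow> \<beta> \<in> exponents N D \<Longrightarrow>
      (\<integral>z. H \<alpha> z * H \<beta> z \<partial>Q) = (if \<alpha> = \<beta> then 1 else 0)"
  shows "chi2_low_degree N P Q D + 1 = (\<Sum>\<alpha>\<in>exponents N D. (\<integral>z. H \<alpha> z \<partial>P)\<^sup>2)"
proof -
  define E where "E = exponents N D"
  define L where "L = likelihood_ratio P Q"
  note fin = finite_exponents[of N D, folded E_def]
  have poly: "f \<in> polynomials N D \<longleftrightarrow> (\<exists>c. f = (\<lambda>z. \<Sum>\<alpha>\<in>E. c \<alpha> * H \<alpha> z))" for f
    unfolding poly product_span_def H E_def by simp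
  have sqL: "square_integrable Q L" using assms(5) by (simp add: L_def)
  have [simp]: "integrable Q (\<lambda>z. H \<alpha> z * H \<beta> z)" "integrable Q (\<lambda>z. L z * H \<alpha> z)" for \<alpha> \<beta>
    by (intro integrable_mult_square_integrable sq sqL)+
  define c where "c \<alpha> = (\<integral>z. H \<alpha> z \<partial>P)" for \<alpha>
  have c: "(\<integral>z. L z * H \<alpha> z \<partial>Q) = c \<alpha>" for \<alpha>
    unfolding c_def L_def using sq[of \<alpha>] assms
    by (subst likelihood_ratio_integral[of P Q]) (auto simp: square_integrable_def)
  define F where "F d = (\<lambda>z. \<Sum>\<alpha>\<in>E. d \<alpha> * H \<alpha> z)" for d
  have F_meas: "F d \<in> borel_measurable Q" for d
    unfolding F_def using sq
    by (intro borel_measurable_sum borel_measurable_times) (simp_all add: square_integrable_def)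
  have FH: "integrable Q (\<lambda>z. F d z * H \<beta> z)" for d \<beta>
    unfolding F_def by (simp add: sum_distrib_right mult.assoc)
  have FH_int: "(\<integral>z. F d z * H \<beta> z \<partial>Q) = d \<beta>" if "\<beta> \<in> E" for d \<beta>
  proof -
    have "(\<integral>z. F d z * H \<beta> z \<partial>Q) = (\<Sum>\<alpha>\<in>E. d \<alpha> * (\<integral>z. H \<alpha> z * H \<beta> z \<partial>Q))"
      unfolding F_def by (simp add: sum_distrib_right mult.assoc)
    also have "\<dots> = (\<Sum>\<alpha>\<in>E. if \<alpha> = \<beta> then d \<beta> else 0)"
      using orth that by (intro sum.cong) (auto simp: E_def)
    finally show ?thesis using that fin by simp
  qed
  have FF: "(F d z)\<^sup>2 = (\<Sum>\<beta>\<in>E. d \<beta> * (F d z * H \<beta> z))" for d z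
    by (subst (2) F_def) (simp add: power2_eq_square F_def sum_distrib_left mult_ac)
  have FF_int: "(\<integral>z. (F d z)\<^sup>2 \<partial>Q) = (\<Sum>\<beta>\<in>E. (d \<beta>)\<^sup>2)" for d
    unfolding FF by (subst Bochner_Integration.integral_sum) (simp_all add: FH FH_int power2_eq_square)
  have F_sq: "square_integrable Q (F d)" for d
    unfolding square_integrable_def FF by (simp add: F_meas FH)
  have LF: "(\<integral>z. (L z - F d z) * F e z \<partial>Q) = (\<Sum>\<beta>\<in>E. e \<beta> * (c \<beta> - d \<beta>))" for d e
  proof -
    have "(\<lambda>z. (L z - F d z) * F e z) = (\<lambda>z. \<Sum>\<beta>\<in>E. e \<beta> * (L z * H \<beta> z - F d z * H \<beta> z))"
      unfolding F_def[of e] by (simp add: sum_distrib_left algebra_simps)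
    then show ?thesis using FH by (simp add: c FH_int)
  qed
  have "is_low_degree_projection N Q D L (F c)"
    unfolding is_low_degree_projection_def
  proof (intro conjI ballI impI F_sq)
    show "F c \<in> polynomials N D" unfolding poly F_def by blast
    fix g assume "g \<in> polynomials N D"
    then obtain e where "g = F e" unfolding poly F_def by blast
    then show "(\<integral>z. (L z - F c z) * g z \<partial>Q) = 0" by (simp add: LF)
  qed
  then have proj: "is_low_degree_projection N Q D L (low_degree_projection N Q D L)"
    unfolding low_degree_projection_def by (rule someI[of "is_low_degree_projection N Q D L"])
  then obtain d where d: "low_degree_projection N Q D L = F d"
    unfolding is_low_degree_projection_def poly F_def by blast
  \<comment> \<open>The projection is an arbitrary choice among the functions with its defining
    property. Testing that property against one basis element shows that every choice has the same
    coefficients.\<close>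
  have "d \<beta> = c \<beta>" if "\<beta> \<in> E" for \<beta>
  proof -
    let ?e = "\<lambda>\<alpha>. if \<alpha> = \<beta> then 1 else (0::real)"
    have "F ?e \<in> polynomials N D" unfolding poly F_def by (rule exI[of _ ?e]) (rule refl)
    then have "(\<integral>z. (L z - F d z) * F ?e z \<partial>Q) = 0"
      using proj F_sq unfolding d is_low_degree_projection_def by blast
    then show ?thesis
      using that fin by (simp add: LF if_distrib[of "\<lambda>x. x * _"] cong: if_cong)
  qed
  then have "(\<integral>z. (low_degree_projection N Q D L z)\<^sup>2 \<partial>Q) = (\<Sum>\<alpha>\<in>E. (c \<alpha>)\<^sup>2)"
    by (simp add: d FF_int)
  then show ?thesis
    unfolding chi2_low_degree_def L_def c_def E_def by simp
qed

section \<open>Counting the exponents of the responses\<close>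

lemma card_multi_le: "card (multi {..<n} M) * fact M \<le> (n + M) ^ M"
proof -
  have "card (multi {..<n} M) \<le> card {l::nat list. size l = n \<and> sum_list l = M}"
  proof (rule card_inj_on_le[where f = "\<lambda>a. map a [0..<n]"])
    show "inj_on (\<lambda>a. map a [0..<n]) (multi {..<n} M)"
    proof (rule inj_onI, rule ext)
      fix a b i assume "a \<in> multi {..<n} M" "b \<in> multi {..<n} M" "map a [0..<n] = map b [0..<n]"
      then show "a i = b i" by (cases "i < n") (auto simp: multi_def)
    qed
    show "(\<lambda>a. map a [0..<n]) ` multi {..<n} M \<subseteq> {l. size l = n \<and> sum_list l = M}"
      by (auto simp: multi_def interv_sum_list_conv_sum_set_nat atLeast0LessThan)
    show "finite {l::nat list. size l = n \<and> sum_list l = M}"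
    proof (rule finite_subset)
      show "{l::nat list. size l = n \<and> sum_list l = M} \<subseteq> {l. set l \<subseteq> {..M} \<and> length l = n}"
        using member_le_sum_list by fastforce
    qed (rule finite_lists_length_eq, simp)
  qed
  also have "\<dots> = (M + n - 1) choose M" by (rule card_length_sum_list)
  also have "((M + n - 1) choose M) * fact M \<le> (M + n - 1) ^ M"
    by (rule binomial_fact_pow)
  then have "((M + n - 1) choose M) * fact M \<le> (n + M) ^ M"
    by (rule order_trans) (intro power_mono, auto)
  finally show ?thesis by (simp add: mult_le_mono1)
qed

text \<open>Each level \<open>M\<close> is bounded by one term of the exponential series. Since
  \<open>M \<le> m\<close>, the base \<open>n + M\<close> from the counting bound may be replaced by
  the common \<open>n + m\<close>.\<close>

lemma sum_multi_power_le:
  fixes t x :: real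
  assumes "\<bar>t\<bar> \<le> x"
  shows "(\<Sum>M\<le>m. \<Sum>b\<in>multi {..<n} M. t ^ sum b {..<n}) \<le> exp ((real n + real m) * x)"
proof -
  have x: "0 \<le> x" using assms by linarith
  have "(\<Sum>b\<in>multi {..<n} M. t ^ sum b {..<n}) \<le> ((real n + real m) * x) ^ M / fact M" if "M \<le> m" for M
  proof -
    have "(\<Sum>b\<in>multi {..<n} M. t ^ sum b {..<n}) \<le> (\<Sum>b\<in>multi {..<n} M. x ^ M)"
    proof (rule sum_mono)
      fix b assume "b \<in> multi {..<n} M"
      then have "t ^ sum b {..<n} = t ^ M" by (simp add: multi_def)
      also have "\<dots> \<le> \<bar>t\<bar> ^ M" by (simp add: power_abs[symmetric])
      also have "\<dots> \<le> x ^ M" using assms by (intro power_mono) auto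
      finally show "t ^ sum b {..<n} \<le> x ^ M" .
    qed
    also have "\<dots> = real (card (multi {..<n} M)) * x ^ M" by simp
    also have "real (card (multi {..<n} M)) \<le> (real n + real m) ^ M / fact M"
    proof -
      have "real (card (multi {..<n} M) * fact M) \<le> real ((n + M) ^ M)"
        using card_multi_le[of n M] by (simp only: of_nat_le_iff)
      also have "\<dots> \<le> (real n + real m) ^ M"
        using that by (simp add: power_mono)
      finally show ?thesis by (simp add: pos_le_divide_eq)
    qed
    finally show ?thesis using x by (simp add: power_mult_distrib mult_right_mono)
  qed
  then have "(\<Sum>M\<le>m. \<Sum>b\<in>multi {..<n} M. t ^ sum b {..<n}) \<le>
      (\<Sum>M\<le>m. ((real n + real m) * x) ^ M / fact M)"
    by (intro sum_mono) auto
  also have "\<dots> \<le> exp ((real n + real m) * x)"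
    unfolding exp_def using x summable_exp_generic[of "(real n + real m) * x"]
    by (intro order_trans[OF _ sum_le_suminf[of _ "{..m}"]]) (auto simp: field_simps scaleR_conv_of_real)
  finally show ?thesis .
qed

section \<open>Gaussian rows\<close>

interpretation gauss: product_prob_space "\<lambda>_. gauss" I for I :: "'i set"
  by (rule product_prob_spaceI) simp

lemma prob_space_std_gaussian [simp]: "prob_space (std_gaussian I)"
  unfolding std_gaussian_def by (rule prob_space_PiM) simp

lemma sigma_finite_std_gaussian [simp]: "sigma_finite_measure (std_gaussian I)"
  by (rule prob_space_imp_sigma_finite) simp

lemma product_prob_space_std_gaussian: "product_prob_space (\<lambda>_. std_gaussian J)"
  by (rule product_prob_spaceI) simp

lemma sets_std_gaussian [measurable_cong]: "sets (std_gaussian I) = sets (PiM I (\<lambda>_. borel))"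
  unfolding std_gaussian_def by (rule sets_PiM_cong) simp_all

lemma space_std_gaussian: "space (std_gaussian I) = extensional I"
  unfolding std_gaussian_def by (auto simp: space_PiM PiE_def extensional_def)

lemma measurable_component_std_gaussian:
  "i \<in> I \<Longrightarrow> (\<lambda>x. x i) \<in> borel_measurable (std_gaussian I)"
  by measurable

lemma measurable_linear_std_gaussian:
  "J \<subseteq> I \<Longrightarrow> (\<lambda>x. \<Sum>j\<in>J. u j * x j) \<in> borel_measurable (std_gaussian I)"
  by (intro borel_measurable_sum borel_measurable_times measurable_component_std_gaussian) auto

text \<open>Column \<open>p\<close> of the rows plays the role of the noise or of the normalised response.\<close>
definition gauss_rows :: "nat \<Rightarrow> nat \<Rightarrow> (nat \<Rightarrow> nat \<Rightarrow> real) measure" where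
  "gauss_rows n p = PiM {..<n} (\<lambda>_. std_gaussian {..p})"

lemma prob_space_gauss_rows [simp]: "prob_space (gauss_rows n p)"
  unfolding gauss_rows_def by (rule prob_space_PiM) simp

lemma sets_gauss_rows [measurable_cong]:
  "sets (gauss_rows n p) = sets (PiM {..<n} (\<lambda>_. PiM {..p} (\<lambda>_. borel)))"
  unfolding gauss_rows_def by (rule sets_PiM_cong) (simp_all add: sets_std_gaussian)

lemma space_gauss_rows: "space (gauss_rows n p) = PiE {..<n} (\<lambda>_. extensional {..p})"
  by (simp add: gauss_rows_def space_PiM space_std_gaussian)

lemma measurable_to_gauss: "measurable M gauss = borel_measurable M"
  by (rule measurable_cong_sets) simp_all

lemma measurable_gauss_rows_component:
  assumes "i < n" "j \<le> p"
  shows "(\<lambda>r. r i j) \<in> borel_measurable (gauss_rows n p)"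
proof -
  have "(\<lambda>r. r i) \<in> measurable (gauss_rows n p) (std_gaussian {..p})"
    unfolding gauss_rows_def using assms by (intro measurable_component_singleton) simp
  moreover have "(\<lambda>x. x j) \<in> borel_measurable (std_gaussian {..p})"
    using assms by (intro measurable_component_std_gaussian) simp
  ultimately show ?thesis
    by (rule measurable_compose)
qed

section \<open>Reshaping Gaussian arrays\<close>

definition uncurry_rows :: "nat \<Rightarrow> nat \<Rightarrow> (nat \<Rightarrow> nat \<Rightarrow> real) \<Rightarrow> nat \<times> nat \<Rightarrow> real" where
  "uncurry_rows n p r = (\<lambda>ij\<in>{..<n} \<times> {..p}. r (fst ij) (snd ij))"

text \<open>With the noise stored as an additional column, design and noise form a single Gaussian
  array with independent rows, the common source of null and alternative.\<close>

definition join_noise :: "nat \<Rightarrow> nat \<Rightarrow> (nat \<times> nat \<Rightarrow> real) \<Rightarrow> (nat \<Rightarrow> real) \<Rightarrow> nat \<times> nat \<Rightarrow> real" where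
  "join_noise n p X w = (\<lambda>ij\<in>{..<n} \<times> {..p}. if snd ij < p then X ij else w (fst ij))"

lemma measurable_uncurry_rows [measurable]:
  "uncurry_rows n p \<in> measurable (gauss_rows n p) (std_gaussian ({..<n} \<times> {..p}))"
  unfolding uncurry_rows_def std_gaussian_def
  by (rule measurable_restrict) (auto simp only: measurable_to_gauss fst_conv snd_conv mem_Times_iff lessThan_iff atMost_iff
      intro!: measurable_gauss_rows_component)

lemma measurable_join_noise [measurable]:
  "case_prod (join_noise n p) \<in> measurable
     (std_gaussian ({..<n} \<times> {..<p}) \<Otimes>\<^sub>M std_gaussian {..<n}) (std_gaussian ({..<n} \<times> {..p}))"
proof -
  have "(\<lambda>Xw. \<lambda>ij\<in>{..<n} \<times> {..p}. if snd ij < p then fst Xw ij else snd Xw (fst ij)) \<in> measurable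
     (std_gaussian ({..<n} \<times> {..<p}) \<Otimes>\<^sub>M std_gaussian {..<n}) (std_gaussian ({..<n} \<times> {..p}))"
    unfolding std_gaussian_def[of "{..<n} \<times> {..p}"]
  proof (rule measurable_restrict)
    fix ij assume "ij \<in> {..<n} \<times> {..p}"
    then obtain i j where ij: "ij = (i, j)" "i < n" "j \<le> p" by auto
    show "(\<lambda>Xw. if snd ij < p then fst Xw ij else snd Xw (fst ij)) \<in> measurable
     (std_gaussian ({..<n} \<times> {..<p}) \<Otimes>\<^sub>M std_gaussian {..<n}) gauss"
      using ij by (cases "j < p")
        (simp_all add: measurable_to_gauss measurable_compose[OF measurable_fst]
          measurable_compose[OF measurable_snd] measurable_component_std_gaussian)
  qed
  then show ?thesis by (simp add: join_noise_def split_beta')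
qed

text \<open>A finite product measure is determined by its values on rectangles, and the preimage of
  a rectangle is a product of rectangles, one for each row.\<close>

lemma distr_uncurry_rows:
  "distr (gauss_rows n p) (std_gaussian ({..<n} \<times> {..p})) (uncurry_rows n p) =
   std_gaussian ({..<n} \<times> {..p})"
  (is "?D = _")
proof -
  interpret rows: product_prob_space "\<lambda>_. std_gaussian {..p}" "{..<n}"
    by (rule product_prob_space_std_gaussian)
  have "?D = PiM ({..<n} \<times> {..p}) (\<lambda>_. gauss)"
  proof (rule gauss.PiM_eqI)
    fix A :: "nat \<times> nat \<Rightarrow> real set" assume A: "\<And>ij. ij \<in> {..<n} \<times> {..p} \<Longrightarrow> A ij \<in> sets gauss"
    have "emeasure ?D (PiE ({..<n} \<times> {..p}) A) =
        emeasure (gauss_rows n p) (uncurry_rows n p -` PiE ({..<n} \<times> {..p}) A \<inter> space (gauss_rows n p))"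
      using A by (intro emeasure_distr measurable_uncurry_rows)
        (auto simp: std_gaussian_def intro!: sets_PiM_I_finite)
    also have "uncurry_rows n p -` PiE ({..<n} \<times> {..p}) A \<inter> space (gauss_rows n p) =
        PiE {..<n} (\<lambda>i. PiE {..p} (\<lambda>j. A (i, j)))"
      by (auto simp: uncurry_rows_def space_gauss_rows PiE_def Pi_def)
    also have "emeasure (gauss_rows n p) \<dots> = (\<Prod>i<n. emeasure (std_gaussian {..p}) (PiE {..p} (\<lambda>j. A (i, j))))"
      unfolding gauss_rows_def using A
      by (intro rows.emeasure_PiM) (auto simp: std_gaussian_def intro!: sets_PiM_I_finite)
    also have "\<dots> = (\<Prod>i<n. \<Prod>j\<le>p. emeasure gauss (A (i, j)))"
      unfolding std_gaussian_def using A by (intro prod.cong refl gauss.emeasure_PiM) auto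
    also have "\<dots> = (\<Prod>ij\<in>{..<n} \<times> {..p}. emeasure gauss (A ij))"
      by (simp add: prod.cartesian_product)
    finally show "emeasure ?D (PiE ({..<n} \<times> {..p}) A) = \<dots>" .
  qed (simp_all add: std_gaussian_def)
  then show ?thesis by (simp add: std_gaussian_def)
qed

lemma distr_join_noise:
  "distr (std_gaussian ({..<n} \<times> {..<p}) \<Otimes>\<^sub>M std_gaussian {..<n}) (std_gaussian ({..<n} \<times> {..p}))
     (case_prod (join_noise n p)) = std_gaussian ({..<n} \<times> {..p})"
  (is "distr ?\<Omega> _ _ = _" is "?D = _")
proof -
  have "?D = PiM ({..<n} \<times> {..p}) (\<lambda>_. gauss)"
  proof (rule gauss.PiM_eqI)
    fix A :: "nat \<times> nat \<Rightarrow> real set" assume A: "\<And>ij. ij \<in> {..<n} \<times> {..p} \<Longrightarrow> A ij \<in> sets gauss"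
    have "emeasure ?D (PiE ({..<n} \<times> {..p}) A) =
        emeasure ?\<Omega> (case_prod (join_noise n p) -` PiE ({..<n} \<times> {..p}) A \<inter> space ?\<Omega>)"
      using A by (intro emeasure_distr measurable_join_noise)
        (auto simp: std_gaussian_def[of "{..<n} \<times> {..p}"] intro!: sets_PiM_I_finite)
    also have "case_prod (join_noise n p) -` PiE ({..<n} \<times> {..p}) A \<inter> space ?\<Omega> =
        PiE ({..<n} \<times> {..<p}) A \<times> PiE {..<n} (\<lambda>i. A (i, p))"
    proof -
      have "join_noise n p X w \<in> PiE ({..<n} \<times> {..p}) A \<longleftrightarrow>
          X \<in> Pi ({..<n} \<times> {..<p}) A \<and> w \<in> Pi {..<n} (\<lambda>i. A (i, p))" for X w
        by (auto simp: join_noise_def PiE_def Pi_def le_less)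
      then show ?thesis
        unfolding set_eq_iff
        by (simp add: space_pair_measure space_std_gaussian PiE_iff Pi_iff split_paired_all) blast
    qed
    also have "emeasure ?\<Omega> \<dots> = emeasure (std_gaussian ({..<n} \<times> {..<p})) (PiE ({..<n} \<times> {..<p}) A) *
        emeasure (std_gaussian {..<n}) (PiE {..<n} (\<lambda>i. A (i, p)))"
      using A by (intro sigma_finite_measure.emeasure_pair_measure_Times sigma_finite_std_gaussian)
        (auto simp: std_gaussian_def intro!: sets_PiM_I_finite)
    also have "\<dots> = (\<Prod>ij\<in>{..<n} \<times> {..<p}. emeasure gauss (A ij)) * (\<Prod>i<n. emeasure gauss (A (i, p)))"
      unfolding std_gaussian_def using A by (intro arg_cong2[where f = "(*)"] gauss.emeasure_PiM) auto
    also have "\<dots> = (\<Prod>i<n. \<Prod>j\<le>p. emeasure gauss (A (i, j)))"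
      by (simp add: prod.cartesian_product prod.distrib lessThan_Suc_atMost[symmetric])
    also have "\<dots> = (\<Prod>ij\<in>{..<n} \<times> {..p}. emeasure gauss (A ij))"
      by (simp add: prod.cartesian_product)
    finally show "emeasure ?D (PiE ({..<n} \<times> {..p}) A) = \<dots>" .
  qed (simp_all add: std_gaussian_def)
  then show ?thesis by (simp add: std_gaussian_def)
qed

lemma nn_integral_join_noise:
  assumes [measurable]: "f \<in> borel_measurable (std_gaussian ({..<n} \<times> {..p}))"
  shows "(\<integral>\<^sup>+X. \<integral>\<^sup>+w. f (join_noise n p X w) \<partial>std_gaussian {..<n} \<partial>std_gaussian ({..<n} \<times> {..<p})) =
    (\<integral>\<^sup>+r. f (uncurry_rows n p r) \<partial>gauss_rows n p)"
proof -
  have "(\<integral>\<^sup>+X. \<integral>\<^sup>+w. f (join_noise n p X w) \<partial>std_gaussian {..<n} \<partial>std_gaussian ({..<n} \<times> {..<p})) =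
    (\<integral>\<^sup>+Xw. f (case_prod (join_noise n p) Xw) \<partial>(std_gaussian ({..<n} \<times> {..<p}) \<Otimes>\<^sub>M std_gaussian {..<n}))"
    by (subst sigma_finite_measure.nn_integral_fst[OF sigma_finite_std_gaussian, symmetric]) (simp_all add: measurable_compose[OF measurable_join_noise])
  also have "\<dots> = (\<integral>\<^sup>+Z. f Z \<partial>std_gaussian ({..<n} \<times> {..p}))"
    by (subst nn_integral_distr[symmetric, OF measurable_join_noise]) (simp_all add: distr_join_noise)
  also have "\<dots> = (\<integral>\<^sup>+r. f (uncurry_rows n p r) \<partial>gauss_rows n p)"
    by (subst distr_uncurry_rows[symmetric], subst nn_integral_distr) simp_all
  finally show ?thesis .
qed

section \<open>The change of measure that introduces the signal\<close>

definition tilt :: "nat \<Rightarrow> (nat \<Rightarrow> real) \<Rightarrow> real \<Rightarrow> (nat \<Rightarrow> real) \<Rightarrow> nat \<Rightarrow> real" where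
  "tilt p u \<kappa> x = x(p := (\<Sum>j<p. u j * x j) + \<kappa> * x p)"

text \<open>The likelihood ratio of one row. Given the first \<open>p\<close> coordinates, the new
  last coordinate is normal with mean \<open>\<Sum>j<p. u j * x j\<close> and standard deviation
  \<open>\<kappa>\<close>; the old one is standard normal, and nothing else changes.\<close>

definition tilt_density :: "nat \<Rightarrow> (nat \<Rightarrow> real) \<Rightarrow> real \<Rightarrow> (nat \<Rightarrow> real) \<Rightarrow> real" where
  "tilt_density p u \<kappa> x = normal_density (\<Sum>j<p. u j * x j) \<kappa> (x p) / std_normal_density (x p)"

lemma tilt_density_nonneg [simp]: "0 \<le> tilt_density p u \<kappa> x"
  by (simp add: tilt_density_def)

lemma normal_density_affine_eq:
  "\<kappa> > 0 \<Longrightarrow> normal_density m \<kappa> (m + \<kappa> * y) = std_normal_density y / \<kappa>"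
  by (simp add: normal_density_def power_mult_distrib real_sqrt_mult field_simps)

lemma measurable_tilt [measurable]: "tilt p u \<kappa> \<in> measurable (std_gaussian {..p}) (std_gaussian {..p})"
proof -
  have "(\<lambda>x. \<lambda>j\<in>{..p}. if j < p then x j else (\<Sum>j<p. u j * x j) + \<kappa> * x p)
      \<in> measurable (std_gaussian {..p}) (std_gaussian {..p})"
  proof (subst (2) std_gaussian_def, rule measurable_restrict)
    fix j assume j: "j \<in> {..p}"
    show "(\<lambda>x. if j < p then x j else (\<Sum>j<p. u j * x j) + \<kappa> * x p) \<in> measurable (std_gaussian {..p}) gauss"
    proof (cases "j < p")
      case True
      then show ?thesis by (simp add: measurable_to_gauss measurable_component_std_gaussian)
    next
      case False
      have "(\<lambda>x. (\<Sum>j<p. u j * x j) + \<kappa> * x p) \<in> borel_measurable (std_gaussian {..p})"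
        by (intro borel_measurable_add borel_measurable_times measurable_linear_std_gaussian
            measurable_component_std_gaussian borel_measurable_const) auto
      with False show ?thesis by (simp add: measurable_to_gauss)
    qed
  qed
  moreover have "(\<lambda>j\<in>{..p}. if j < p then x j else (\<Sum>j<p. u j * x j) + \<kappa> * x p) = tilt p u \<kappa> x"
    if "x \<in> space (std_gaussian {..p})" for x
    using that by (auto simp: tilt_def fun_eq_iff space_std_gaussian extensional_def)
  ultimately show ?thesis by (subst measurable_cong[symmetric])
qed

lemma measurable_normal_density [measurable (raw)]:
  assumes [measurable]: "f \<in> borel_measurable M" "g \<in> borel_measurable M"
  shows "(\<lambda>x. normal_density (f x) \<kappa> (g x)) \<in> borel_measurable M"
  unfolding normal_density_def by measurable

lemma measurable_tilt_density [measurable]: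
  "tilt_density p u \<kappa> \<in> borel_measurable (std_gaussian {..p})"
  unfolding tilt_density_def[abs_def]
  by (intro borel_measurable_divide measurable_normal_density measurable_linear_std_gaussian
      measurable_component_std_gaussian borel_measurable_const) auto

lemma nn_integral_std_gaussian_Suc:
  fixes p :: nat
  assumes [measurable]: "f \<in> borel_measurable (std_gaussian {..p})"
  shows "(\<integral>\<^sup>+x. f x \<partial>std_gaussian {..p}) = (\<integral>\<^sup>+x. \<integral>\<^sup>+y. f (x(p := y)) \<partial>gauss \<partial>std_gaussian {..<p})"
proof -
  have "{..p} = insert p {..<p}" by auto
  then show ?thesis
    using gauss.product_nn_integral_insert[of "{..<p}" p f] assms
    by (simp add: std_gaussian_def)
qed

lemma measurable_upd_std_gaussian:
  fixes p :: nat
  assumes "x \<in> space (std_gaussian {..<p})"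
  shows "(\<lambda>y. x(p := y)) \<in> measurable borel (std_gaussian {..p})"
proof -
  have "(\<lambda>y. \<lambda>j\<in>{..p}. if j < p then x j else y) \<in> measurable borel (std_gaussian {..p})"
    unfolding std_gaussian_def[of "{..p}"]
    by (rule measurable_restrict) (simp add: measurable_to_gauss)
  also have "(\<lambda>y. \<lambda>j\<in>{..p}. if j < p then x j else y) = (\<lambda>y. x(p := y))"
    using assms by (auto simp: fun_eq_iff space_std_gaussian extensional_def)
  finally show ?thesis .
qed

text \<open>With the first \<open>p\<close> coordinates fixed, this is the substitution of
  \<open>m + \<kappa> * y\<close> for \<open>y\<close> in the last one; the Jacobian
  \<open>\<kappa>\<close> cancels against the normalisation of the normal density.\<close>

lemma nn_integral_tilt:
  assumes \<kappa>: "\<kappa> > 0" and f [measurable]: "f \<in> borel_measurable (std_gaussian {..p})"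
  shows "(\<integral>\<^sup>+x. f (tilt p u \<kappa> x) \<partial>std_gaussian {..p}) =
    (\<integral>\<^sup>+x. ennreal (tilt_density p u \<kappa> x) * f x \<partial>std_gaussian {..p})"
proof -
  have *: "(\<integral>\<^sup>+y. f (tilt p u \<kappa> (x(p := y))) \<partial>gauss) =
      (\<integral>\<^sup>+y. ennreal (tilt_density p u \<kappa> (x(p := y))) * f (x(p := y)) \<partial>gauss)"
    if x: "x \<in> space (std_gaussian {..<p})" for x
  proof -
    define m where "m = (\<Sum>j<p. u j * x j)"
    note measurable_upd_std_gaussian[OF x, measurable]
    have m: "(\<Sum>j<p. u j * (x(p := y)) j) = m" for y
      unfolding m_def by (intro sum.cong) auto
    have "(\<integral>\<^sup>+y. f (tilt p u \<kappa> (x(p := y))) \<partial>gauss) = (\<integral>\<^sup>+y. f (x(p := m + \<kappa> * y)) \<partial>gauss)"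
      using m by (simp add: tilt_def)
    also have "\<dots> = (\<integral>\<^sup>+y. ennreal (std_normal_density y) * f (x(p := m + \<kappa> * y)) \<partial>lborel)"
      by (subst nn_integral_density) simp_all
    also have "\<dots> = (\<integral>\<^sup>+y. ennreal \<kappa> * (ennreal (normal_density m \<kappa> (m + \<kappa> * y)) * f (x(p := m + \<kappa> * y))) \<partial>lborel)"
      using \<kappa> by (intro nn_integral_cong)
        (simp add: normal_density_affine_eq mult.assoc[symmetric] ennreal_mult'[symmetric])
    also have "\<dots> = ennreal \<bar>\<kappa>\<bar> * (\<integral>\<^sup>+y. ennreal (normal_density m \<kappa> (m + \<kappa> * y)) * f (x(p := m + \<kappa> * y)) \<partial>lborel)"
      using \<kappa> by (subst nn_integral_cmult) auto
    also have "\<dots> = (\<integral>\<^sup>+y. ennreal (normal_density m \<kappa> y) * f (x(p := y)) \<partial>lborel)"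
      using \<kappa> by (subst nn_integral_real_affine[where c = \<kappa> and t = m]) auto
    also have "\<dots> = (\<integral>\<^sup>+y. ennreal (std_normal_density y) * (ennreal (tilt_density p u \<kappa> (x(p := y))) * f (x(p := y))) \<partial>lborel)"
      unfolding tilt_density_def m using normal_density_pos[of 1 0]
      by (intro nn_integral_cong) (simp add: mult.assoc[symmetric] ennreal_mult'[symmetric] less_imp_neq[symmetric])
    also have "\<dots> = (\<integral>\<^sup>+y. ennreal (tilt_density p u \<kappa> (x(p := y))) * f (x(p := y)) \<partial>gauss)"
      by (subst nn_integral_density) simp_all
    finally show ?thesis .
  qed
  then show ?thesis
    by (subst (1 2) nn_integral_std_gaussian_Suc) (simp_all add: * cong: nn_integral_cong)
qed

lemma distr_tilt:
  assumes "\<kappa> > 0"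
  shows "distr (std_gaussian {..p}) (std_gaussian {..p}) (tilt p u \<kappa>) =
    density (std_gaussian {..p}) (\<lambda>x. ennreal (tilt_density p u \<kappa> x))"
proof (rule measure_eqI)
  fix A assume "A \<in> sets (distr (std_gaussian {..p}) (std_gaussian {..p}) (tilt p u \<kappa>))"
  then have [measurable]: "A \<in> sets (std_gaussian {..p})" by simp
  have "emeasure (distr (std_gaussian {..p}) (std_gaussian {..p}) (tilt p u \<kappa>)) A =
      (\<integral>\<^sup>+x. indicator A (tilt p u \<kappa> x) \<partial>std_gaussian {..p})"
    by (subst nn_integral_indicator[symmetric], simp, subst nn_integral_distr) auto
  also have "\<dots> = (\<integral>\<^sup>+x. ennreal (tilt_density p u \<kappa> x) * indicator A x \<partial>std_gaussian {..p})"
    using assms by (rule nn_integral_tilt) simp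
  also have "\<dots> = emeasure (density (std_gaussian {..p}) (\<lambda>x. ennreal (tilt_density p u \<kappa> x))) A"
    by (simp add: emeasure_density)
  finally show "emeasure (distr (std_gaussian {..p}) (std_gaussian {..p}) (tilt p u \<kappa>)) A = \<dots>" .
qed simp

text \<open>Densities of independent coordinates multiply. On a rectangle the indicator factorises
  too, so the integral splits into one factor for each coordinate.\<close>

lemma (in product_sigma_finite) PiM_density:
  assumes I: "finite I" and D: "\<And>i. i \<in> I \<Longrightarrow> D i \<in> borel_measurable (M i)"
    and sf: "product_sigma_finite (\<lambda>i. density (M i) (D i))"
  shows "PiM I (\<lambda>i. density (M i) (D i)) = density (PiM I M) (\<lambda>x. \<Prod>i\<in>I. D i (x i))"
proof -
  interpret d: product_sigma_finite "\<lambda>i. density (M i) (D i)" by fact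
  have [measurable]: "(\<lambda>x. \<Prod>i\<in>I. D i (x i)) \<in> borel_measurable (PiM I M)"
    using D by (intro borel_measurable_prod_ennreal measurable_compose[OF measurable_component_singleton])
  show ?thesis
  proof (rule d.PiM_eqI[symmetric, OF I])
    show "sets (density (PiM I M) (\<lambda>x. \<Prod>i\<in>I. D i (x i))) = sets (PiM I (\<lambda>i. density (M i) (D i)))"
      by (simp cong: sets_PiM_cong)
    fix A assume "\<And>i. i \<in> I \<Longrightarrow> A i \<in> sets (density (M i) (D i))"
    then have A: "\<And>i. i \<in> I \<Longrightarrow> A i \<in> sets (M i)" by simp
    have "emeasure (density (PiM I M) (\<lambda>x. \<Prod>i\<in>I. D i (x i))) (PiE I A) =
        (\<integral>\<^sup>+x. (\<Prod>i\<in>I. D i (x i)) * indicator (PiE I A) x \<partial>PiM I M)"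
      using A I by (intro emeasure_density) (auto intro!: sets_PiM_I_finite)
    also have "\<dots> = (\<integral>\<^sup>+x. (\<Prod>i\<in>I. D i (x i) * indicator (A i) (x i)) \<partial>PiM I M)"
    proof (rule nn_integral_cong)
      fix x assume "x \<in> space (PiM I M)"
      then have "indicator (PiE I A) x = (\<Prod>i\<in>I. indicator (A i) (x i) :: ennreal)"
        using I by (auto simp: space_PiM PiE_iff indicator_def prod_zero_iff)
      then show "(\<Prod>i\<in>I. D i (x i)) * indicator (PiE I A) x = (\<Prod>i\<in>I. D i (x i) * indicator (A i) (x i))"
        by (simp add: prod.distrib)
    qed
    also have "\<dots> = (\<Prod>i\<in>I. \<integral>\<^sup>+y. D i y * indicator (A i) y \<partial>M i)"
      using I A D by (intro product_nn_integral_prod) auto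
    also have "\<dots> = (\<Prod>i\<in>I. emeasure (density (M i) (D i)) (A i))"
      using A D by (intro prod.cong refl) (simp add: emeasure_density)
    finally show "emeasure (density (PiM I M) (\<lambda>x. \<Prod>i\<in>I. D i (x i))) (PiE I A) = \<dots>" .
  qed
qed

definition tilt_rows :: "nat \<Rightarrow> nat \<Rightarrow> (nat \<Rightarrow> real) \<Rightarrow> real \<Rightarrow> (nat \<Rightarrow> nat \<Rightarrow> real) \<Rightarrow> nat \<Rightarrow> nat \<Rightarrow> real" where
  "tilt_rows n p u \<kappa> r = (\<lambda>i\<in>{..<n}. tilt p u \<kappa> (r i))"

lemma distr_tilt_rows:
  assumes \<kappa>: "\<kappa> > 0"
  shows "distr (gauss_rows n p) (gauss_rows n p) (tilt_rows n p u \<kappa>) =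
    density (gauss_rows n p) (\<lambda>r. \<Prod>i<n. ennreal (tilt_density p u \<kappa> (r i)))"
proof -
  interpret rows: product_prob_space "\<lambda>_. std_gaussian {..p}" "{..<n}"
    by (rule product_prob_space_std_gaussian)
  have "distr (gauss_rows n p) (gauss_rows n p) (compose {..<n} (tilt p u \<kappa>)) =
      PiM {..<n} (\<lambda>_. distr (std_gaussian {..p}) (std_gaussian {..p}) (tilt p u \<kappa>))"
    unfolding gauss_rows_def by (rule distr_PiM_finite_prob_space') simp_all
  also have "\<dots> = density (gauss_rows n p) (\<lambda>r. \<Prod>i<n. ennreal (tilt_density p u \<kappa> (r i)))"
    unfolding distr_tilt[OF \<kappa>] gauss_rows_def
  proof (rule rows.PiM_density)
    have "prob_space (density (std_gaussian {..p}) (\<lambda>x. ennreal (tilt_density p u \<kappa> x)))"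
      unfolding distr_tilt[OF \<kappa>, symmetric] by (rule prob_space.prob_space_distr) simp_all
    then show "product_sigma_finite (\<lambda>_. density (std_gaussian {..p}) (\<lambda>x. ennreal (tilt_density p u \<kappa> x)))"
      by (simp add: product_sigma_finite_def prob_space_imp_sigma_finite)
  qed simp_all
  finally show ?thesis
    by (simp add: tilt_rows_def[abs_def] compose_def[abs_def])
qed

section \<open>The second moment of the tilting density\<close>

text \<open>The mean, over a standard normal last coordinate, of the squared density quotient of a
  row whose conditional mean is \<open>m\<close>.\<close>

definition tilt_square_mean :: "real \<Rightarrow> real \<Rightarrow> real" where
  "tilt_square_mean \<kappa> m = exp (m\<^sup>2 / (2 - \<kappa>\<^sup>2)) / (\<kappa> * sqrt (2 - \<kappa>\<^sup>2))"

lemma tilt_square_mean_nonneg: "0 < \<kappa> \<Longrightarrow> \<kappa>\<^sup>2 < 1 \<Longrightarrow> 0 \<le> tilt_square_mean \<kappa> m"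
  by (simp add: tilt_square_mean_def)

text \<open>Completing the square in \<open>y\<close>.\<close>
lemma normal_density_square_quotient:
  assumes \<kappa>: "0 < \<kappa>" "\<kappa> < 1"
  shows "(normal_density m \<kappa> y)\<^sup>2 / std_normal_density y =
    tilt_square_mean \<kappa> m * normal_density (2 * m / (2 - \<kappa>\<^sup>2)) (\<kappa> / sqrt (2 - \<kappa>\<^sup>2)) y"
proof -
  define a where "a = 2 - \<kappa>\<^sup>2"
  have "\<kappa>\<^sup>2 < 1" using \<kappa> by (simp add: power_less_one_iff)
  then have a: "a > 0" and ka: "\<kappa>\<^sup>2 = 2 - a" by (auto simp: a_def)
  have k2: "\<kappa>\<^sup>2 > 0" using \<kappa> by simp
  have e: "- (y - m)\<^sup>2 / \<kappa>\<^sup>2 + y\<^sup>2 / 2 = m\<^sup>2 / a + - (y - 2 * m / a)\<^sup>2 / (2 * (\<kappa> / sqrt a)\<^sup>2)"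
  proof -
    have "- (y - 2 * m / a)\<^sup>2 / (2 * (\<kappa> / sqrt a)\<^sup>2) = - (a * y - 2 * m)\<^sup>2 / (2 * a * \<kappa>\<^sup>2)"
    proof -
      have "- (z / a)\<^sup>2 / (2 * (\<kappa> / sqrt a)\<^sup>2) = - z\<^sup>2 / (2 * a * \<kappa>\<^sup>2)" for z
        using a k2 by (simp add: power_divide divide_simps power2_eq_square)
      moreover have "y - 2 * m / a = (a * y - 2 * m) / a" using a by (simp add: field_simps)
      ultimately show ?thesis by simp
    qed
    moreover have "(- (y - m)\<^sup>2 / \<kappa>\<^sup>2 + y\<^sup>2 / 2) * (2 * a * \<kappa>\<^sup>2) =
        (m\<^sup>2 / a + - (a * y - 2 * m)\<^sup>2 / (2 * a * \<kappa>\<^sup>2)) * (2 * a * \<kappa>\<^sup>2)"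
    proof -
      have "(- (y - m)\<^sup>2 / \<kappa>\<^sup>2 + y\<^sup>2 / 2) * (2 * a * \<kappa>\<^sup>2) = - 2 * a * (y - m)\<^sup>2 + a * \<kappa>\<^sup>2 * y\<^sup>2"
        using k2 by (simp add: field_simps)
      also have "\<dots> = 2 * m\<^sup>2 * \<kappa>\<^sup>2 - (a * y - 2 * m)\<^sup>2"
        unfolding ka by (simp add: power2_eq_square algebra_simps)
      also have "\<dots> = (m\<^sup>2 / a + - (a * y - 2 * m)\<^sup>2 / (2 * a * \<kappa>\<^sup>2)) * (2 * a * \<kappa>\<^sup>2)"
        using k2 a by (simp add: field_simps)
      finally show ?thesis .
    qed
    ultimately show ?thesis using a k2 by simp
  qed
  have "(normal_density m \<kappa> y)\<^sup>2 / std_normal_density y =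
      sqrt (2 * pi) / (2 * pi * \<kappa>\<^sup>2) * exp (- (y - m)\<^sup>2 / \<kappa>\<^sup>2 + y\<^sup>2 / 2)"
  proof -
    have "(exp (- (y - m)\<^sup>2 / (2 * \<kappa>\<^sup>2)))\<^sup>2 = exp (- (y - m)\<^sup>2 / \<kappa>\<^sup>2)"
      by (simp add: power2_eq_square exp_add[symmetric])
    then have "(normal_density m \<kappa> y)\<^sup>2 = 1 / (2 * pi * \<kappa>\<^sup>2) * exp (- (y - m)\<^sup>2 / \<kappa>\<^sup>2)"
      by (simp add: normal_density_def power_mult_distrib power_divide)
    moreover have "1 / std_normal_density y = sqrt (2 * pi) * exp (y\<^sup>2 / 2)"
      by (simp add: std_normal_density_def exp_minus field_simps)
    moreover have "(normal_density m \<kappa> y)\<^sup>2 / std_normal_density y =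
        (normal_density m \<kappa> y)\<^sup>2 * (1 / std_normal_density y)"
      by simp
    ultimately show ?thesis by (simp add: mult_exp_exp)
  qed
  also have "\<dots> = tilt_square_mean \<kappa> m * normal_density (2 * m / a) (\<kappa> / sqrt a) y"
  proof -
    have "sqrt (2 * pi * (\<kappa> / sqrt a)\<^sup>2) = sqrt (2 * pi) * \<kappa> / sqrt a"
      using \<kappa> a by (simp add: real_sqrt_mult real_sqrt_divide)
    then have c: "sqrt (2 * pi) / (2 * pi * \<kappa>\<^sup>2) = 1 / (\<kappa> * sqrt a) * (1 / sqrt (2 * pi * (\<kappa> / sqrt a)\<^sup>2))"
      using a \<kappa> by (simp add: field_simps power2_eq_square)
    show ?thesis
      unfolding e exp_add c tilt_square_mean_def normal_density_def a_def[symmetric]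
      by simp
  qed
  finally show ?thesis by (simp add: a_def)
qed

lemma nn_integral_normal_density: "0 < s \<Longrightarrow> (\<integral>\<^sup>+y. ennreal (normal_density m s y) \<partial>lborel) = 1"
  by (subst nn_integral_eq_integral) auto

text \<open>The first factor is the density of the conditional mean. It multiplies the exponential
  in \<open>tilt_square_mean\<close> to another centred normal density, up to the constant
  \<open>1 / \<kappa>\<^sup>2\<close>.\<close>

lemma nn_integral_tilt_square_mean:
  assumes \<kappa>: "0 < \<kappa>" "\<kappa> < 1"
  shows "(\<integral>\<^sup>+m. ennreal (normal_density 0 (sqrt (1 - \<kappa>\<^sup>2)) m) * ennreal (tilt_square_mean \<kappa> m) \<partial>lborel) =
    ennreal (1 / \<kappa>\<^sup>2)"
proof -
  \<comment> \<open>The value of \<open>s\<close> is forced by 1 / (2 v^2) - 1 / a = 1 / (2 s^2),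
    which holds because \<open>a - 2 * v\<^sup>2 = \<kappa>\<^sup>2\<close>.\<close>
  define a v s where "a = 2 - \<kappa>\<^sup>2" and "v = sqrt (1 - \<kappa>\<^sup>2)" and "s = v * sqrt a / \<kappa>"
  have k: "\<kappa>\<^sup>2 < 1" "\<kappa>\<^sup>2 > 0" using \<kappa> by (simp_all add: power_less_one_iff)
  then have a: "a > 0" and v: "v > 0" and v2: "v\<^sup>2 = 1 - \<kappa>\<^sup>2" by (auto simp: a_def v_def)
  have s: "s > 0" using a v \<kappa> by (simp add: s_def)
  have s2: "s\<^sup>2 = v\<^sup>2 * a / \<kappa>\<^sup>2" using a by (simp add: s_def power_divide power_mult_distrib)
  have "normal_density 0 v m * tilt_square_mean \<kappa> m = 1 / \<kappa>\<^sup>2 * normal_density 0 s m" for m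
  proof -
    have "- m\<^sup>2 / (2 * v\<^sup>2) + m\<^sup>2 / a = - m\<^sup>2 / (2 * s\<^sup>2)"
    proof -
      have "a - 2 * v\<^sup>2 = \<kappa>\<^sup>2" by (simp add: a_def v2)
      then have "- m\<^sup>2 / (2 * v\<^sup>2) + m\<^sup>2 / a = - m\<^sup>2 * \<kappa>\<^sup>2 / (2 * v\<^sup>2 * a)"
        using a v by (simp add: divide_simps) (simp add: algebra_simps)
      then show ?thesis by (simp add: s2)
    qed
    then have "exp (- m\<^sup>2 / (2 * v\<^sup>2)) * exp (m\<^sup>2 / a) = exp (- m\<^sup>2 / (2 * s\<^sup>2))"
      by (simp add: exp_add[symmetric])
    moreover have "sqrt (2 * pi * s\<^sup>2) = sqrt (2 * pi * v\<^sup>2) * sqrt a / \<kappa>"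
      using \<kappa> by (simp add: s2 real_sqrt_mult real_sqrt_divide)
    moreover have "tilt_square_mean \<kappa> m = exp (m\<^sup>2 / a) / (\<kappa> * sqrt a)"
      by (simp add: tilt_square_mean_def a_def)
    moreover have "1 / q * e1 * (e2 / (\<kappa> * A)) = 1 / \<kappa>\<^sup>2 * (1 / q' * e3)"
      if "e1 * e2 = e3" "q' = q * A / \<kappa>" "q > 0" "A > 0" for e1 e2 e3 q q' A :: real
      using that \<kappa> by (auto simp: field_simps power2_eq_square)
    ultimately show ?thesis
      using v a by (simp add: normal_density_def)
  qed
  then have "(\<integral>\<^sup>+m. ennreal (normal_density 0 v m) * ennreal (tilt_square_mean \<kappa> m) \<partial>lborel) =
      (\<integral>\<^sup>+m. ennreal (1 / \<kappa>\<^sup>2) * ennreal (normal_density 0 s m) \<partial>lborel)"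
    by (intro nn_integral_cong) (simp add: ennreal_mult'[symmetric])
  also have "\<dots> = ennreal (1 / \<kappa>\<^sup>2)"
    by (subst nn_integral_cmult) (simp_all add: nn_integral_normal_density s)
  finally show ?thesis by (simp add: v_def)
qed

lemma distributed_linear_std_gaussian:
  assumes J: "finite J" and u: "(\<Sum>j\<in>J. (u j)\<^sup>2) > 0"
  shows "distributed (std_gaussian J) lborel (\<lambda>x. \<Sum>j\<in>J. u j * x j)
    (\<lambda>y. ennreal (normal_density 0 (sqrt (\<Sum>j\<in>J. (u j)\<^sup>2)) y))"
proof -
  interpret G: prob_space "std_gaussian J" by simp
  \<comment> \<open>Vanishing coefficients are removed first: the rule for sums of independent
    normal variables requires positive standard deviations.\<close>
  define S where "S = {j\<in>J. u j \<noteq> 0}"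
  have S: "finite S" "S \<subseteq> J" using J by (auto simp: S_def)
  have sum_eq: "(\<Sum>j\<in>S. (u j)\<^sup>2) = (\<Sum>j\<in>J. (u j)\<^sup>2)" "(\<Sum>j\<in>S. u j * x j) = (\<Sum>j\<in>J. u j * x j)" for x
    using J by (auto simp: S_def intro!: sum.mono_neutral_left)
  have "S \<noteq> {}" using u by (auto simp flip: sum_eq)
  then have "J \<noteq> {}" using S by auto
  have dist: "distr (std_gaussian J) borel (\<lambda>x. x j) = gauss" if "j \<in> J" for j
  proof -
    have "distr (std_gaussian J) borel (\<lambda>x. x j) = distr (std_gaussian J) gauss (\<lambda>x. x j)"
      by (rule distr_cong) auto
    also have "\<dots> = gauss"
      unfolding std_gaussian_def using that by (intro distr_PiM_component) auto
    finally show ?thesis .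
  qed
  have "G.indep_vars (\<lambda>_. borel) (\<lambda>j x. x j) J"
  proof (subst G.indep_vars_iff_distr_eq_PiM'[OF \<open>J \<noteq> {}\<close>])
    show "G.random_variable borel (\<lambda>x. x i)" if "i \<in> J" for i
      using that by (rule measurable_component_std_gaussian)
    have "distr (std_gaussian J) (PiM J (\<lambda>_. borel)) (\<lambda>x. \<lambda>i\<in>J. x i) = distr (std_gaussian J) (std_gaussian J) (\<lambda>x. x)"
      by (rule distr_cong) (auto simp: sets_std_gaussian space_std_gaussian extensional_def fun_eq_iff)
    also have "\<dots> = PiM J (\<lambda>_. gauss)" by (simp add: distr_id2) (simp add: std_gaussian_def)
    also have "\<dots> = PiM J (\<lambda>i. distr (std_gaussian J) borel (\<lambda>x. x i))"
      by (rule PiM_cong) (simp_all add: dist)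
    finally show "distr (std_gaussian J) (PiM J (\<lambda>_. borel)) (\<lambda>x. \<lambda>i\<in>J. x i) = \<dots>" .
  qed
  then have "G.indep_vars (\<lambda>_. borel) (\<lambda>j x. x j) S"
    using S by (blast intro: G.indep_vars_subset)
  then have indep: "G.indep_vars (\<lambda>_. borel) (\<lambda>j x. u j * x j) S"
    by (rule G.indep_vars_compose2[where Y = "\<lambda>j y. u j * y"]) simp
  have "distributed (std_gaussian J) lborel (\<lambda>x. \<Sum>j\<in>S. u j * x j)
      (normal_density (\<Sum>j\<in>S. 0) (sqrt (\<Sum>j\<in>S. (\<bar>u j\<bar>)\<^sup>2)))"
  proof (rule G.sum_indep_normal[OF \<open>finite S\<close> \<open>S \<noteq> {}\<close> indep])
    fix j assume j: "j \<in> S"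
    then show "0 < \<bar>u j\<bar>" by (simp add: S_def)
    have "distributed (std_gaussian J) lborel (\<lambda>x. x j) std_normal_density"
      using j S dist[of j] measurable_component_std_gaussian[of j J]
      by (auto simp: distributed_def cong: distr_cong)
    from G.normal_density_affine[OF this, of "u j" 0] j
    show "distributed (std_gaussian J) lborel (\<lambda>x. u j * x j) (normal_density 0 \<bar>u j\<bar>)"
      by (simp add: S_def)
  qed
  then show ?thesis by (simp add: sum_eq)
qed

text \<open>Integrate the last coordinate first; the result depends on the others only through the
  linear form, which is normal with variance \<open>1 - \<kappa>\<^sup>2\<close>. For
  \<open>\<kappa> = 1 / \<tau>\<close> the value is SNR + 1 for each row.\<close>

lemma nn_integral_tilt_density_square:
  assumes \<kappa>: "0 < \<kappa>" "\<kappa> < 1" and u: "(\<Sum>j<p. (u j)\<^sup>2) = 1 - \<kappa>\<^sup>2"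
  shows "(\<integral>\<^sup>+x. ennreal (tilt_density p u \<kappa> x) * ennreal (tilt_density p u \<kappa> x) \<partial>std_gaussian {..p}) =
    ennreal (1 / \<kappa>\<^sup>2)"
proof -
  have k: "\<kappa>\<^sup>2 < 1" using \<kappa> by (simp add: power_less_one_iff)
  have [measurable]: "tilt_square_mean \<kappa> \<in> borel_measurable borel"
    unfolding tilt_square_mean_def by measurable
  have inner: "(\<integral>\<^sup>+y. ennreal (tilt_density p u \<kappa> (x(p := y))) * ennreal (tilt_density p u \<kappa> (x(p := y))) \<partial>gauss) =
      ennreal (tilt_square_mean \<kappa> (\<Sum>j<p. u j * x j))"
    if x: "x \<in> space (std_gaussian {..<p})" for x
  proof -
    define m where "m = (\<Sum>j<p. u j * x j)"
    have m: "(\<Sum>j<p. u j * (x(p := y)) j) = m" for y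
      unfolding m_def by (intro sum.cong) auto
    have td: "tilt_density p u \<kappa> (x(p := y)) = normal_density m \<kappa> y / std_normal_density y" for y
      unfolding tilt_density_def m by simp
    have "(\<integral>\<^sup>+y. ennreal (tilt_density p u \<kappa> (x(p := y))) * ennreal (tilt_density p u \<kappa> (x(p := y))) \<partial>gauss) =
      (\<integral>\<^sup>+y. ennreal (std_normal_density y) * (ennreal (normal_density m \<kappa> y / std_normal_density y) *
         ennreal (normal_density m \<kappa> y / std_normal_density y)) \<partial>lborel)"
      unfolding td by (subst nn_integral_density) auto
    also have "\<dots> = (\<integral>\<^sup>+y. ennreal (tilt_square_mean \<kappa> m) *
        ennreal (normal_density (2 * m / (2 - \<kappa>\<^sup>2)) (\<kappa> / sqrt (2 - \<kappa>\<^sup>2)) y) \<partial>lborel)"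
    proof (rule nn_integral_cong)
      fix y :: real
      have "std_normal_density y > 0" by (rule normal_density_pos) simp
      then have "std_normal_density y * (normal_density m \<kappa> y / std_normal_density y *
          (normal_density m \<kappa> y / std_normal_density y)) = (normal_density m \<kappa> y)\<^sup>2 / std_normal_density y"
        by (simp add: power2_eq_square)
      also note normal_density_square_quotient[OF \<kappa>]
      finally show "ennreal (std_normal_density y) * (ennreal (normal_density m \<kappa> y / std_normal_density y) *
         ennreal (normal_density m \<kappa> y / std_normal_density y)) = ennreal (tilt_square_mean \<kappa> m) *
        ennreal (normal_density (2 * m / (2 - \<kappa>\<^sup>2)) (\<kappa> / sqrt (2 - \<kappa>\<^sup>2)) y)"
        using \<kappa> k by (simp only: ennreal_mult'[symmetric] normal_density_nonneg divide_nonneg_nonneg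
          mult_nonneg_nonneg tilt_square_mean_nonneg)
    qed
    also have "\<dots> = ennreal (tilt_square_mean \<kappa> m)"
      using \<kappa> k by (subst nn_integral_cmult) (simp_all add: nn_integral_normal_density)
    finally show ?thesis by (simp add: m_def)
  qed
  have "(\<integral>\<^sup>+x. ennreal (tilt_density p u \<kappa> x) * ennreal (tilt_density p u \<kappa> x) \<partial>std_gaussian {..p}) =
      (\<integral>\<^sup>+x. ennreal (tilt_square_mean \<kappa> (\<Sum>j<p. u j * x j)) \<partial>std_gaussian {..<p})"
    by (subst nn_integral_std_gaussian_Suc) (simp_all add: inner cong: nn_integral_cong)
  also have "\<dots> = (\<integral>\<^sup>+m. ennreal (normal_density 0 (sqrt (1 - \<kappa>\<^sup>2)) m) * ennreal (tilt_square_mean \<kappa> m) \<partial>lborel)"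
    using distributed_linear_std_gaussian[of "{..<p}" u] u k
    by (subst distributed_nn_integral[symmetric, where M = "std_gaussian {..<p}"]) (auto simp: u)
  finally show ?thesis using nn_integral_tilt_square_mean[OF \<kappa>] by simp
qed

section \<open>The regression model\<close>

definition flatten_rows :: "nat \<Rightarrow> nat \<Rightarrow> real \<Rightarrow> (nat \<times> nat \<Rightarrow> real) \<Rightarrow> nat \<Rightarrow> real" where
  "flatten_rows n p \<tau> Z =
     (\<lambda>m\<in>{..<n * p + n}. if m < n * p then Z (m div p, m mod p) else \<tau> * Z (m - n * p, p))"

definition row_data :: "nat \<Rightarrow> nat \<Rightarrow> real \<Rightarrow> (nat \<Rightarrow> nat \<Rightarrow> real) \<Rightarrow> nat \<Rightarrow> real" where
  "row_data n p \<tau> r =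
     (\<lambda>m\<in>{..<n * p + n}. if m < n * p then r (m div p) (m mod p) else \<tau> * r (m - n * p) p)"

text \<open>A left inverse of \<open>row_data\<close>, needed because a density of the alternative
  has to be a function of the data, whereas the computation takes place on the rows.\<close>

definition unflatten_rows :: "nat \<Rightarrow> nat \<Rightarrow> real \<Rightarrow> (nat \<Rightarrow> real) \<Rightarrow> nat \<Rightarrow> nat \<Rightarrow> real" where
  "unflatten_rows n p \<tau> z =
     (\<lambda>i\<in>{..<n}. \<lambda>j\<in>{..p}. if j < p then z (i * p + j) else z (n * p + i) / \<tau>)"

lemma div_mod_less:
  assumes "m < n * (p::nat)"
  shows "m div p < n" "m mod p < p"
proof -
  from assms have "p > 0" by (cases p) auto
  then show "m mod p < p" by simp
  from assms show "m div p < n" by (simp add: less_mult_imp_div_less)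
qed

lemma mult_add_less:
  assumes "i < n" "j < (p::nat)"
  shows "i * p + j < n * p"
proof -
  have "i * p + j < Suc i * p" using assms by simp
  also have "\<dots> \<le> n * p" using assms by (intro mult_le_mono1) simp
  finally show ?thesis .
qed

lemma row_data_nth:
  assumes "i < n"
  shows "j < p \<Longrightarrow> row_data n p \<tau> r (i * p + j) = r i j"
    and "row_data n p \<tau> r (n * p + i) = \<tau> * r i p"
  using assms mult_add_less[of i n j p] by (simp_all add: row_data_def)

lemma unflatten_row_data:
  assumes "\<tau> \<noteq> 0" "r \<in> space (gauss_rows n p)"
  shows "unflatten_rows n p \<tau> (row_data n p \<tau> r) = r"
proof (rule ext)
  fix i
  show "unflatten_rows n p \<tau> (row_data n p \<tau> r) i = r i"
  proof (cases "i < n")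
    case True
    then have "r i \<in> extensional {..p}" using assms by (auto simp: space_gauss_rows)
    then show ?thesis
      using True assms
      by (auto simp: unflatten_rows_def fun_eq_iff row_data_nth extensional_def le_less)
  next
    case False
    then show ?thesis using assms by (auto simp: space_gauss_rows unflatten_rows_def PiE_def extensional_def)
  qed
qed

lemma flatten_uncurry_rows: "flatten_rows n p \<tau> (uncurry_rows n p r) = row_data n p \<tau> r"
  using div_mod_less[of _ n p]
  by (auto simp: flatten_rows_def row_data_def uncurry_rows_def fun_eq_iff less_imp_le)

lemma flatten_join_noise:
  "flatten_rows n p \<tau> (join_noise n p X w) = data_vector n p X (\<lambda>i. \<tau> * w i)"
  using div_mod_less[of _ n p]
  by (auto simp: flatten_rows_def data_vector_def join_noise_def fun_eq_iff less_imp_le)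

lemma measurable_real_space_restrict:
  assumes "\<And>m. m < N \<Longrightarrow> f m \<in> borel_measurable M"
  shows "(\<lambda>x. \<lambda>m\<in>{..<N}. f m x) \<in> measurable M (real_space N)"
  using assms by (intro measurable_restrict) auto

lemma measurable_flatten_rows [measurable]:
  "flatten_rows n p \<tau> \<in> measurable (std_gaussian ({..<n} \<times> {..p})) (real_space (n * p + n))"
  unfolding flatten_rows_def
proof (rule measurable_real_space_restrict)
  fix m assume "m < n * p + n"
  then show "(\<lambda>Z. if m < n * p then Z (m div p, m mod p) else \<tau> * Z (m - n * p, p))
      \<in> borel_measurable (std_gaussian ({..<n} \<times> {..p}))"
    using div_mod_less[of m n p]
    by (cases "m < n * p")
      (auto intro!: borel_measurable_times measurable_component_std_gaussian simp: less_imp_le)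
qed

lemma measurable_row_data [measurable]:
  "row_data n p \<tau> \<in> measurable (gauss_rows n p) (real_space (n * p + n))"
  using measurable_compose[OF measurable_uncurry_rows[of n p] measurable_flatten_rows[of n p \<tau>]]
  by (simp add: flatten_uncurry_rows)

lemma measurable_unflatten_rows [measurable]:
  "unflatten_rows n p \<tau> \<in> measurable (real_space (n * p + n)) (gauss_rows n p)"
  unfolding unflatten_rows_def gauss_rows_def
proof (rule measurable_restrict)
  fix i assume i: "i \<in> {..<n}"
  show "(\<lambda>z. \<lambda>j\<in>{..p}. if j < p then z (i * p + j) else z (n * p + i) / \<tau>)
      \<in> measurable (real_space (n * p + n)) (std_gaussian {..p})"
    unfolding std_gaussian_def
  proof (rule measurable_restrict)
    fix j assume "j \<in> {..p}"
    then show "(\<lambda>z. if j < p then z (i * p + j) else z (n * p + i) / \<tau>)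
        \<in> measurable (real_space (n * p + n)) gauss"
      using i mult_add_less[of i n j p]
      by (cases "j < p")
        (auto simp: measurable_to_gauss intro!: borel_measurable_divide measurable_component_singleton)
  qed
qed

text \<open>Under the null the normalised response is itself the independent standard normal column
  \<open>p\<close>, so the rows need no tilting.\<close>

lemma slr_null_eq:
  "slr_null n p r \<sigma> = distr (gauss_rows n p) (real_space (n * p + n)) (row_data n p (sqrt (r\<^sup>2 / \<sigma>\<^sup>2 + 1)))"
proof -
  define \<tau> where "\<tau> = sqrt (r\<^sup>2 / \<sigma>\<^sup>2 + 1)"
  let ?\<Omega> = "std_gaussian ({..<n} \<times> {..<p}) \<Otimes>\<^sub>M std_gaussian {..<n}"
  let ?G = "std_gaussian ({..<n} \<times> {..p})"
  have "slr_null n p r \<sigma> = distr ?\<Omega> (real_space (n * p + n)) (flatten_rows n p \<tau> \<circ> case_prod (join_noise n p))"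
    unfolding slr_null_def \<tau>_def[symmetric] by (simp add: comp_def split_beta' flatten_join_noise)
  also have "\<dots> = distr (distr ?\<Omega> ?G (case_prod (join_noise n p))) (real_space (n * p + n)) (flatten_rows n p \<tau>)"
    by (rule distr_distr[symmetric]) (rule measurable_flatten_rows measurable_join_noise)+
  also have "\<dots> = distr (distr (gauss_rows n p) ?G (uncurry_rows n p)) (real_space (n * p + n)) (flatten_rows n p \<tau>)"
    by (simp only: distr_join_noise distr_uncurry_rows)
  also have "\<dots> = distr (gauss_rows n p) (real_space (n * p + n)) (flatten_rows n p \<tau> \<circ> uncurry_rows n p)"
    by (rule distr_distr) (rule measurable_flatten_rows measurable_uncurry_rows)+
  finally show ?thesis by (simp add: comp_def flatten_uncurry_rows \<tau>_def)
qed

section \<open>One instance of the regression model\<close>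

locale slr_model =
  fixes n p :: nat and r \<sigma> :: real and \<pi> :: "(nat \<Rightarrow> real) measure"
  assumes \<sigma>: "\<sigma> > 0" and r: "r > 0"
    and prob_prior: "prob_space \<pi>" and sets_prior [measurable_cong]: "sets \<pi> = sets (real_space p)"
    and norm_prior: "AE \<beta> in \<pi>. L2_set \<beta> {..<p} = r"
begin

abbreviation "N \<equiv> n * p + n"
abbreviation "R \<equiv> gauss_rows n p"

definition \<tau> :: real where "\<tau> = sqrt (r\<^sup>2 / \<sigma>\<^sup>2 + 1)"

text \<open>The response is \<open>\<tau>\<close> times a standard normal variable that has correlations
  \<open>direction \<beta>\<close> with the entries of its row, and \<open>1 / \<tau>\<close> with the noise.\<close>
definition direction :: "(nat \<Rightarrow> real) \<Rightarrow> nat \<Rightarrow> real" where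
  "direction \<beta> j = \<beta> j / (\<sigma> * \<tau>)"

abbreviation "Q \<equiv> slr_null n p r \<sigma>"
abbreviation "P \<equiv> slr_alternative n p \<sigma> \<pi>"

lemma \<tau>_gt_1: "\<tau> > 1"
  unfolding \<tau>_def using \<sigma> r by (simp add: real_less_rsqrt)

lemma \<tau>_nonzero: "\<tau> > 0" "\<tau> \<noteq> 0" "0 < 1 / \<tau>" "1 / \<tau> < 1"
  using \<tau>_gt_1 by (auto simp: field_simps)

lemma Q_eq: "Q = distr R (real_space N) (row_data n p \<tau>)"
  by (simp add: slr_null_eq \<tau>_def)

text \<open>The squared norm is SNR / (SNR + 1). Together with the noise weight
  \<open>1 / \<tau>\<close> the direction forms a unit vector, so the normalised response is
  standard normal under the alternative too.\<close>

lemma direction_norm: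
  assumes "L2_set \<beta> {..<p} = r"
  shows "(\<Sum>j<p. (direction \<beta> j)\<^sup>2) = 1 - (1 / \<tau>)\<^sup>2"
proof -
  have "(\<Sum>j<p. (\<beta> j)\<^sup>2) = r\<^sup>2"
    using assms by (auto simp: L2_set_def sum_nonneg)
  then have "(\<Sum>j<p. (direction \<beta> j)\<^sup>2) = (r\<^sup>2 / \<sigma>\<^sup>2) / \<tau>\<^sup>2"
    by (simp add: direction_def power_divide power_mult_distrib sum_divide_distrib[symmetric])
  also have "r\<^sup>2 / \<sigma>\<^sup>2 = \<tau>\<^sup>2 - 1" by (simp add: \<tau>_def)
  finally show ?thesis using \<tau>_nonzero by (simp add: power_divide diff_divide_distrib)
qed

lemma measurable_prior_component: "j < p \<Longrightarrow> (\<lambda>\<beta>. \<beta> j) \<in> borel_measurable \<pi>"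
  by measurable

lemma measurable_direction [measurable]: "j < p \<Longrightarrow> (\<lambda>\<beta>. direction \<beta> j) \<in> borel_measurable \<pi>"
  unfolding direction_def by measurable

abbreviation tilted :: "(nat \<Rightarrow> real) \<Rightarrow> (nat \<Rightarrow> nat \<Rightarrow> real) \<Rightarrow> nat \<Rightarrow> real" where
  "tilted \<beta> x \<equiv> row_data n p \<tau> (tilt_rows n p (direction \<beta>) (1 / \<tau>) x)"

text \<open>The factor \<open>\<tau>\<close> of \<open>row_data\<close> cancels the
  \<open>\<tau>\<close> in \<open>direction\<close> and in the noise weight. What remains is the
  original response with signal \<open>\<beta>\<close> and noise in column \<open>p\<close>.\<close>

lemma tilted_eq:
  "tilted \<beta> x = (\<lambda>m\<in>{..<N}. if m < n * p then x (m div p) (m mod p)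
     else (\<Sum>j<p. \<beta> j / \<sigma> * x (m - n * p) j) + x (m - n * p) p)"
proof (rule ext)
  fix m
  show "tilted \<beta> x m = (\<lambda>m\<in>{..<N}. if m < n * p then x (m div p) (m mod p)
     else (\<Sum>j<p. \<beta> j / \<sigma> * x (m - n * p) j) + x (m - n * p) p) m"
    using div_mod_less[of m n p] \<tau>_nonzero
    by (auto simp: row_data_def tilt_rows_def tilt_def direction_def distrib_left sum_distrib_left)
qed

lemma measurable_tilted: "case_prod tilted \<in> measurable (\<pi> \<Otimes>\<^sub>M R) (real_space N)"
proof -
  have "(\<lambda>\<beta>x. \<lambda>m\<in>{..<N}. if m < n * p then snd \<beta>x (m div p) (m mod p)
      else (\<Sum>j<p. fst \<beta>x j / \<sigma> * snd \<beta>x (m - n * p) j) + snd \<beta>x (m - n * p) p)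
      \<in> measurable (\<pi> \<Otimes>\<^sub>M R) (real_space N)"
  proof (rule measurable_real_space_restrict)
    fix m assume m: "m < N"
    have x: "(\<lambda>\<beta>x. snd \<beta>x i j) \<in> borel_measurable (\<pi> \<Otimes>\<^sub>M R)" if "i < n" "j \<le> p" for i j
      using measurable_compose[OF measurable_snd measurable_gauss_rows_component[OF that]] .
    have \<beta>: "(\<lambda>\<beta>x. fst \<beta>x j) \<in> borel_measurable (\<pi> \<Otimes>\<^sub>M R)" if "j < p" for j
      using measurable_compose[OF measurable_fst measurable_prior_component[OF that]] .
    show "(\<lambda>\<beta>x. if m < n * p then snd \<beta>x (m div p) (m mod p)
      else (\<Sum>j<p. fst \<beta>x j / \<sigma> * snd \<beta>x (m - n * p) j) + snd \<beta>x (m - n * p) p)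
      \<in> borel_measurable (\<pi> \<Otimes>\<^sub>M R)"
    proof (cases "m < n * p")
      case True
      then show ?thesis using div_mod_less[OF True] by (simp add: x less_imp_le)
    next
      case False
      then have "m - n * p < n" using m by simp
      with False show ?thesis
        by (simp only: if_False)
          (intro borel_measurable_add borel_measurable_sum borel_measurable_times borel_measurable_divide
            x \<beta> borel_measurable_const; simp)
    qed
  qed
  then show ?thesis by (simp add: tilted_eq split_beta')
qed

lemma nn_integral_P_noise:
  assumes f [measurable]: "f \<in> borel_measurable (real_space N)"
  shows "(\<integral>\<^sup>+X. \<integral>\<^sup>+w. f (data_vector n p X (\<lambda>i. 1 / \<sigma> * (\<Sum>j<p. X (i, j) * \<beta> j) + w i))
      \<partial>std_gaussian {..<n} \<partial>std_gaussian ({..<n} \<times> {..<p})) = (\<integral>\<^sup>+x. f (tilted \<beta> x) \<partial>R)"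
proof -
  define T where "T Z = (\<lambda>m\<in>{..<N}. if m < n * p then Z (m div p, m mod p)
     else (\<Sum>j<p. \<beta> j / \<sigma> * Z (m - n * p, j)) + Z (m - n * p, p))" for Z :: "nat \<times> nat \<Rightarrow> real"
  have T: "T \<in> measurable (std_gaussian ({..<n} \<times> {..p})) (real_space N)"
    unfolding T_def
  proof (rule measurable_real_space_restrict)
    fix m assume m: "m < N"
    show "(\<lambda>Z. if m < n * p then Z (m div p, m mod p)
     else (\<Sum>j<p. \<beta> j / \<sigma> * Z (m - n * p, j)) + Z (m - n * p, p))
      \<in> borel_measurable (std_gaussian ({..<n} \<times> {..p}))"
    proof (cases "m < n * p")
      case True
      then show ?thesis using div_mod_less[OF True] by (simp add: measurable_component_std_gaussian less_imp_le)
    next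
      case False
      then have "m - n * p < n" using m by simp
      with False show ?thesis
        by (simp only: if_False)
          (intro borel_measurable_add borel_measurable_sum borel_measurable_times
            measurable_component_std_gaussian borel_measurable_const; simp)
    qed
  qed
  have TX: "T (join_noise n p X w) = data_vector n p X (\<lambda>i. 1 / \<sigma> * (\<Sum>j<p. X (i, j) * \<beta> j) + w i)" for X w
  proof (rule ext)
    fix m
    show "T (join_noise n p X w) m = data_vector n p X (\<lambda>i. 1 / \<sigma> * (\<Sum>j<p. X (i, j) * \<beta> j) + w i) m"
      using div_mod_less[of m n p]
      by (auto simp: T_def data_vector_def join_noise_def less_imp_le sum_divide_distrib mult_ac intro!: sum.cong)
  qed
  have Tx: "T (uncurry_rows n p x) = tilted \<beta> x" for x
  proof (rule ext)
    fix m
    show "T (uncurry_rows n p x) m = tilted \<beta> x m"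
      unfolding tilted_eq using div_mod_less[of m n p]
      by (auto simp: T_def uncurry_rows_def less_imp_le intro!: sum.cong)
  qed
  have "(\<lambda>Z. f (T Z)) \<in> borel_measurable (std_gaussian ({..<n} \<times> {..p}))"
    using T f by (rule measurable_compose)
  from nn_integral_join_noise[OF this] show ?thesis by (simp only: TX Tx)
qed

lemma sigma_finite_prior: "sigma_finite_measure \<pi>"
  using prob_prior by (rule prob_space_imp_sigma_finite)

lemma sigma_finite_R: "sigma_finite_measure R"
  by (rule prob_space_imp_sigma_finite) simp

lemma measurable_alternative_map:
  "(\<lambda>((X, \<beta>), w). data_vector n p X (\<lambda>i. 1 / \<sigma> * (\<Sum>j<p. X (i, j) * \<beta> j) + w i)) \<in> measurable
     ((std_gaussian ({..<n} \<times> {..<p}) \<Otimes>\<^sub>M \<pi>) \<Otimes>\<^sub>M std_gaussian {..<n}) (real_space N)"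
proof -
  let ?M = "(std_gaussian ({..<n} \<times> {..<p}) \<Otimes>\<^sub>M \<pi>) \<Otimes>\<^sub>M std_gaussian {..<n}"
  have "(\<lambda>\<omega>. \<lambda>m\<in>{..<N}. if m < n * p then fst (fst \<omega>) (m div p, m mod p)
      else 1 / \<sigma> * (\<Sum>j<p. fst (fst \<omega>) (m - n * p, j) * snd (fst \<omega>) j) + snd \<omega> (m - n * p))
      \<in> measurable ?M (real_space N)"
  proof (rule measurable_real_space_restrict)
    fix m assume m: "m < N"
    have X: "(\<lambda>\<omega>. fst (fst \<omega>) (i, j)) \<in> borel_measurable ?M" if "i < n" "j < p" for i j
      using that by (intro measurable_compose[OF measurable_fst measurable_compose[OF measurable_fst
            measurable_component_std_gaussian]]) auto
    have b: "(\<lambda>\<omega>. snd (fst \<omega>) j) \<in> borel_measurable ?M" if "j < p" for j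
      using that by (intro measurable_compose[OF measurable_fst measurable_compose[OF measurable_snd
            measurable_prior_component]])
    have w: "(\<lambda>\<omega>. snd \<omega> i) \<in> borel_measurable ?M" if "i < n" for i
      using that by (intro measurable_compose[OF measurable_snd measurable_component_std_gaussian]) auto
    show "(\<lambda>\<omega>. if m < n * p then fst (fst \<omega>) (m div p, m mod p)
      else 1 / \<sigma> * (\<Sum>j<p. fst (fst \<omega>) (m - n * p, j) * snd (fst \<omega>) j) + snd \<omega> (m - n * p))
      \<in> borel_measurable ?M"
    proof (cases "m < n * p")
      case True
      then show ?thesis using div_mod_less[OF True] by (simp add: X)
    next
      case False
      then have "m - n * p < n" using m by simp
      with False show ?thesis
        by (simp only: if_False)
          (intro borel_measurable_add borel_measurable_sum borel_measurable_times
            X b w borel_measurable_const; simp)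
    qed
  qed
  then show ?thesis by (simp only: data_vector_def split_beta')
qed

text \<open>The definition draws the signal between design and noise. Fubini moves it outermost,
  after which design and noise can be merged into rows for each fixed signal.\<close>

lemma P_eq: "P = distr (\<pi> \<Otimes>\<^sub>M R) (real_space N) (case_prod tilted)"
proof (rule measure_eqI)
  show "sets P = sets (distr (\<pi> \<Otimes>\<^sub>M R) (real_space N) (case_prod tilted))"
    by (simp add: slr_alternative_def)
  fix B assume "B \<in> sets P"
  then have B [measurable]: "B \<in> sets (real_space N)" by (simp add: slr_alternative_def)
  let ?GX = "std_gaussian ({..<n} \<times> {..<p})" and ?Gw = "std_gaussian {..<n}"
  define F where "F X \<beta> w = data_vector n p X (\<lambda>i. 1 / \<sigma> * (\<Sum>j<p. X (i, j) * \<beta> j) + w i)" for X \<beta> w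
  have F1 [measurable]: "(\<lambda>((X, \<beta>), w). F X \<beta> w) \<in> measurable ((?GX \<Otimes>\<^sub>M \<pi>) \<Otimes>\<^sub>M ?Gw) (real_space N)"
    unfolding F_def by (rule measurable_alternative_map)
  have F2: "(\<lambda>(X, \<beta>, w). F X \<beta> w) \<in> measurable (?GX \<Otimes>\<^sub>M \<pi> \<Otimes>\<^sub>M ?Gw) (real_space N)"
  proof -
    have "(\<lambda>\<omega>. (\<lambda>((X, \<beta>), w). F X \<beta> w) ((fst \<omega>, fst (snd \<omega>)), snd (snd \<omega>)))
        \<in> measurable (?GX \<Otimes>\<^sub>M \<pi> \<Otimes>\<^sub>M ?Gw) (real_space N)"
      by (rule measurable_compose[OF _ F1])
        (intro measurable_Pair measurable_fst measurable_compose[OF measurable_snd measurable_fst]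
          measurable_compose[OF measurable_snd measurable_snd])
    then show ?thesis by (simp add: split_beta')
  qed
  have ind: "(indicator B :: _ \<Rightarrow> ennreal) \<in> borel_measurable (real_space N)" by simp
  interpret w: pair_sigma_finite \<pi> ?Gw
    by (simp add: pair_sigma_finite_def sigma_finite_prior)
  interpret X: pair_sigma_finite ?GX \<pi>
    by (simp add: pair_sigma_finite_def sigma_finite_prior)
  interpret R: pair_sigma_finite \<pi> R
    by (simp add: pair_sigma_finite_def sigma_finite_prior sigma_finite_R)
  have "emeasure P B = (\<integral>\<^sup>+\<omega>. indicator B ((\<lambda>(X, \<beta>, w). F X \<beta> w) \<omega>) \<partial>(?GX \<Otimes>\<^sub>M \<pi> \<Otimes>\<^sub>M ?Gw))"
    unfolding slr_alternative_def F_def[symmetric] using B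
    by (subst nn_integral_indicator[symmetric], simp, subst nn_integral_distr[OF F2]) auto
  also have "\<dots> = (\<integral>\<^sup>+X. \<integral>\<^sup>+\<beta>w. indicator B ((\<lambda>(X, \<beta>, w). F X \<beta> w) (X, \<beta>w)) \<partial>(\<pi> \<Otimes>\<^sub>M ?Gw) \<partial>?GX)"
    by (rule w.P.nn_integral_fst[symmetric]) (rule measurable_compose[OF F2 ind])
  also have "\<dots> = (\<integral>\<^sup>+X. \<integral>\<^sup>+\<beta>. \<integral>\<^sup>+w. indicator B (F X \<beta> w) \<partial>?Gw \<partial>\<pi> \<partial>?GX)"
  proof (rule nn_integral_cong)
    fix X assume X: "X \<in> space ?GX"
    have "(\<lambda>\<beta>w. (\<lambda>(X, \<beta>, w). F X \<beta> w) (X, \<beta>w)) \<in> measurable (\<pi> \<Otimes>\<^sub>M ?Gw) (real_space N)"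
      using X by (intro measurable_compose[OF measurable_Pair1' F2]) simp
    from w.M2.nn_integral_fst[OF measurable_compose[OF this ind]]
    show "(\<integral>\<^sup>+\<beta>w. indicator B ((\<lambda>(X, \<beta>, w). F X \<beta> w) (X, \<beta>w)) \<partial>(\<pi> \<Otimes>\<^sub>M ?Gw)) =
        (\<integral>\<^sup>+\<beta>. \<integral>\<^sup>+w. indicator B (F X \<beta> w) \<partial>?Gw \<partial>\<pi>)"
      by simp
  qed
  also have "\<dots> = (\<integral>\<^sup>+\<beta>. \<integral>\<^sup>+X. \<integral>\<^sup>+w. indicator B (F X \<beta> w) \<partial>?Gw \<partial>?GX \<partial>\<pi>)"
  proof (rule X.Fubini'[symmetric])
    have "(\<lambda>\<omega>. \<integral>\<^sup>+w. (indicator B ((\<lambda>((X, \<beta>), w). F X \<beta> w) (\<omega>, w)) :: ennreal) \<partial>?Gw)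
        \<in> borel_measurable (?GX \<Otimes>\<^sub>M \<pi>)"
      by (rule w.M2.borel_measurable_nn_integral_fst) (rule measurable_compose[OF F1 ind])
    then show "(\<lambda>(X, \<beta>). \<integral>\<^sup>+w. (indicator B (F X \<beta> w) :: ennreal) \<partial>?Gw) \<in> borel_measurable (?GX \<Otimes>\<^sub>M \<pi>)"
      by (simp add: split_beta')
  qed
  also have "\<dots> = (\<integral>\<^sup>+\<beta>. \<integral>\<^sup>+x. indicator B (tilted \<beta> x) \<partial>R \<partial>\<pi>)"
    unfolding F_def using ind by (simp only: nn_integral_P_noise)
  also have "\<dots> = (\<integral>\<^sup>+\<omega>. indicator B (case_prod tilted \<omega>) \<partial>(\<pi> \<Otimes>\<^sub>M R))"
    by (subst R.M2.nn_integral_fst[symmetric]) (simp_all add: measurable_compose[OF measurable_tilted ind])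
  also have "\<dots> = emeasure (distr (\<pi> \<Otimes>\<^sub>M R) (real_space N) (case_prod tilted)) B"
    using B by (subst nn_integral_distr[symmetric, OF measurable_tilted]) auto
  finally show "emeasure P B = \<dots>" .
qed

section \<open>The likelihood ratio and its second moment\<close>

definition row_density :: "(nat \<Rightarrow> real) \<Rightarrow> (nat \<Rightarrow> nat \<Rightarrow> real) \<Rightarrow> ennreal" where
  "row_density \<beta> x = (\<Prod>i<n. ennreal (tilt_density p (direction \<beta>) (1 / \<tau>) (x i)))"

lemma measurable_row_density: "case_prod row_density \<in> borel_measurable (\<pi> \<Otimes>\<^sub>M R)"
proof -
  have "(\<lambda>\<omega>. tilt_density p (direction (fst \<omega>)) (1 / \<tau>) (snd \<omega> i)) \<in> borel_measurable (\<pi> \<Otimes>\<^sub>M R)"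
    if i: "i < n" for i
  proof -
    have x: "(\<lambda>\<omega>. snd \<omega> i j) \<in> borel_measurable (\<pi> \<Otimes>\<^sub>M R)" if "j \<le> p" for j
      using measurable_compose[OF measurable_snd measurable_gauss_rows_component[OF i that]] .
    have \<beta>: "(\<lambda>\<omega>. direction (fst \<omega>) j) \<in> borel_measurable (\<pi> \<Otimes>\<^sub>M R)" if "j < p" for j
      using measurable_compose[OF measurable_fst measurable_direction[OF that]] .
    show ?thesis
      unfolding tilt_density_def
      by (intro borel_measurable_divide measurable_normal_density borel_measurable_sum
          borel_measurable_times x \<beta> borel_measurable_const) auto
  qed
  then show ?thesis
    unfolding row_density_def split_beta'
    by (intro borel_measurable_prod_ennreal measurable_compose[OF _ measurable_ennreal]) auto
qed

lemma measurable_row_density1 [measurable]: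
  "\<beta> \<in> space \<pi> \<Longrightarrow> row_density \<beta> \<in> borel_measurable R"
  using measurable_compose[OF measurable_Pair1' measurable_row_density] by simp

lemma measurable_row_density2:
  "x \<in> space R \<Longrightarrow> (\<lambda>\<beta>. row_density \<beta> x) \<in> borel_measurable \<pi>"
  using measurable_compose[OF measurable_Pair2' measurable_row_density] by simp

lemma measurable_tilt_rows: "tilt_rows n p u \<kappa> \<in> measurable R R"
  unfolding tilt_rows_def gauss_rows_def
  by (rule measurable_restrict, rule measurable_compose[OF _ measurable_tilt],
      rule measurable_component_singleton)

lemma nn_integral_tilted:
  assumes \<beta>: "\<beta> \<in> space \<pi>" and f: "f \<in> borel_measurable (real_space N)"
  shows "(\<integral>\<^sup>+x. f (tilted \<beta> x) \<partial>R) = (\<integral>\<^sup>+x. row_density \<beta> x * f (row_data n p \<tau> x) \<partial>R)"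
proof -
  have g: "(\<lambda>x. f (row_data n p \<tau> x)) \<in> borel_measurable R"
    by (rule measurable_compose[OF measurable_row_data f])
  have "(\<integral>\<^sup>+x. f (tilted \<beta> x) \<partial>R) =
      (\<integral>\<^sup>+x. f (row_data n p \<tau> x) \<partial>distr R R (tilt_rows n p (direction \<beta>) (1 / \<tau>)))"
    by (rule nn_integral_distr[OF measurable_tilt_rows, symmetric]) (simp add: g)
  also have "distr R R (tilt_rows n p (direction \<beta>) (1 / \<tau>)) = density R (row_density \<beta>)"
    using \<tau>_nonzero by (simp add: distr_tilt_rows row_density_def[abs_def])
  finally show ?thesis
    using measurable_row_density1[OF \<beta>] g by (simp add: nn_integral_density)
qed

definition mixture_density :: "(nat \<Rightarrow> real) \<Rightarrow> ennreal" where
  "mixture_density z = (\<integral>\<^sup>+\<beta>. row_density \<beta> (unflatten_rows n p \<tau> z) \<partial>\<pi>)"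

lemma measurable_mixture_density [measurable]:
  "mixture_density \<in> borel_measurable (real_space N)"
proof -
  interpret prior: sigma_finite_measure \<pi> by (rule sigma_finite_prior)
  have "(\<lambda>(x, \<beta>). row_density \<beta> x) \<in> borel_measurable (R \<Otimes>\<^sub>M \<pi>)"
    using measurable_compose[OF measurable_pair_swap' measurable_row_density]
    by (simp add: split_beta')
  then have "(\<lambda>x. \<integral>\<^sup>+\<beta>. row_density \<beta> x \<partial>\<pi>) \<in> borel_measurable R"
    by (rule prior.borel_measurable_nn_integral)
  from measurable_compose[OF measurable_unflatten_rows this] show ?thesis
    by (simp add: mixture_density_def[abs_def])
qed

lemma sets_Q [measurable_cong]: "sets Q = sets (real_space N)"
  by (simp add: slr_null_def)

lemma sets_P [measurable_cong]: "sets P = sets (real_space N)"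
  by (simp add: slr_alternative_def)

lemma mixture_density_row_data:
  "x \<in> space R \<Longrightarrow> mixture_density (row_data n p \<tau> x) = (\<integral>\<^sup>+\<beta>. row_density \<beta> x \<partial>\<pi>)"
  using \<tau>_nonzero by (simp add: mixture_density_def unflatten_row_data)

lemma nn_integral_Q:
  assumes "f \<in> borel_measurable (real_space N)"
  shows "(\<integral>\<^sup>+z. f z \<partial>Q) = (\<integral>\<^sup>+x. f (row_data n p \<tau> x) \<partial>R)"
  unfolding Q_eq using assms by (intro nn_integral_distr measurable_row_data) simp

text \<open>For a fixed signal the alternative has density \<open>row_density \<beta>\<close> on the
  rows; exchanging the integrals over signal and rows leaves the average of these densities.\<close>

lemma P_density: "P = density Q mixture_density"
proof (rule measure_eqI)
  show "sets P = sets (density Q mixture_density)" by (simp add: sets_Q sets_P)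
  fix B assume "B \<in> sets P"
  then have B [measurable]: "B \<in> sets (real_space N)" by (simp add: sets_P)
  interpret R: pair_sigma_finite \<pi> R
    by (simp add: pair_sigma_finite_def sigma_finite_prior sigma_finite_R)
  have ind: "(indicator B :: _ \<Rightarrow> ennreal) \<in> borel_measurable (real_space N)" by simp
  have indR: "(\<lambda>x. indicator B (row_data n p \<tau> x) :: ennreal) \<in> borel_measurable R"
    by (rule measurable_compose[OF measurable_row_data]) simp
  have "emeasure P B = (\<integral>\<^sup>+\<omega>. indicator B (case_prod tilted \<omega>) \<partial>(\<pi> \<Otimes>\<^sub>M R))"
    unfolding P_eq using B
    by (subst nn_integral_indicator[symmetric], simp, subst nn_integral_distr[OF measurable_tilted]) auto
  also have "\<dots> = (\<integral>\<^sup>+\<beta>. \<integral>\<^sup>+x. indicator B (tilted \<beta> x) \<partial>R \<partial>\<pi>)"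
    by (subst R.M2.nn_integral_fst[symmetric]) (simp_all add: measurable_compose[OF measurable_tilted ind])
  also have "\<dots> = (\<integral>\<^sup>+\<beta>. \<integral>\<^sup>+x. row_density \<beta> x * indicator B (row_data n p \<tau> x) \<partial>R \<partial>\<pi>)"
    by (intro nn_integral_cong nn_integral_tilted) simp_all
  also have "\<dots> = (\<integral>\<^sup>+x. \<integral>\<^sup>+\<beta>. row_density \<beta> x * indicator B (row_data n p \<tau> x) \<partial>\<pi> \<partial>R)"
  proof (rule R.Fubini'[symmetric])
    show "(\<lambda>(\<beta>, x). row_density \<beta> x * indicator B (row_data n p \<tau> x)) \<in> borel_measurable (\<pi> \<Otimes>\<^sub>M R)"
      using borel_measurable_times_ennreal[OF measurable_row_density measurable_compose[OF measurable_snd indR]]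
      by (simp add: split_beta')
  qed
  also have "\<dots> = (\<integral>\<^sup>+x. mixture_density (row_data n p \<tau> x) * indicator B (row_data n p \<tau> x) \<partial>R)"
    by (intro nn_integral_cong)
      (simp add: mixture_density_row_data nn_integral_multc measurable_row_density2)
  also have "\<dots> = (\<integral>\<^sup>+z. mixture_density z * indicator B z \<partial>Q)"
    by (rule nn_integral_Q[symmetric]) simp
  also have "\<dots> = emeasure (density Q mixture_density) B"
    by (subst emeasure_density) (simp_all add: sets_Q)
  finally show "emeasure P B = \<dots>" .
qed

lemma nn_integral_row_density_square:
  assumes "L2_set \<beta> {..<p} = r"
  shows "(\<integral>\<^sup>+x. (row_density \<beta> x)\<^sup>2 \<partial>R) = ennreal (\<tau>\<^sup>2) ^ n"
proof -
  interpret rows: product_prob_space "\<lambda>_. std_gaussian {..p}" "{..<n}"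
    by (rule product_prob_space_std_gaussian)
  have "(\<integral>\<^sup>+x. (row_density \<beta> x)\<^sup>2 \<partial>R) = (\<integral>\<^sup>+x. (\<Prod>i<n. ennreal (tilt_density p (direction \<beta>) (1 / \<tau>) (x i)) *
      ennreal (tilt_density p (direction \<beta>) (1 / \<tau>) (x i))) \<partial>R)"
    by (simp add: row_density_def power2_eq_square prod.distrib)
  also have "\<dots> = (\<Prod>i<n. ennreal (1 / (1 / \<tau>)\<^sup>2))"
    unfolding gauss_rows_def
    using \<tau>_nonzero direction_norm[OF assms]
    by (subst rows.product_nn_integral_prod) (simp_all add: nn_integral_tilt_density_square)
  finally show ?thesis by (simp add: power_divide)
qed

text \<open>Jensen's inequality, in the form of Cauchy-Schwarz against the constant 1, moves the
  square inside the average over the prior. There the second moment is the same for almost every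
  signal, because it depends only on the norm.\<close>

lemma nn_integral_mixture_density_square: "(\<integral>\<^sup>+z. (mixture_density z)\<^sup>2 \<partial>Q) \<le> ennreal (\<tau>\<^sup>2) ^ n"
proof -
  interpret R: pair_sigma_finite \<pi> R
    by (simp add: pair_sigma_finite_def sigma_finite_prior sigma_finite_R)
  interpret prior: prob_space \<pi> by (rule prob_prior)
  have "(\<integral>\<^sup>+z. (mixture_density z)\<^sup>2 \<partial>Q) = (\<integral>\<^sup>+x. (mixture_density (row_data n p \<tau> x))\<^sup>2 \<partial>R)"
    by (rule nn_integral_Q) simp
  also have "\<dots> \<le> (\<integral>\<^sup>+x. \<integral>\<^sup>+\<beta>. (row_density \<beta> x)\<^sup>2 \<partial>\<pi> \<partial>R)"
  proof (rule nn_integral_mono)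
    fix x assume x: "x \<in> space R"
    have "(\<integral>\<^sup>+\<beta>. row_density \<beta> x * 1 \<partial>\<pi>)\<^sup>2 \<le> (\<integral>\<^sup>+\<beta>. (row_density \<beta> x)\<^sup>2 \<partial>\<pi>) * (\<integral>\<^sup>+\<beta>. 1\<^sup>2 \<partial>\<pi>)"
      by (rule Cauchy_Schwarz_nn_integral) (simp_all add: measurable_row_density2 x)
    then show "(mixture_density (row_data n p \<tau> x))\<^sup>2 \<le> (\<integral>\<^sup>+\<beta>. (row_density \<beta> x)\<^sup>2 \<partial>\<pi>)"
      using x by (simp add: mixture_density_row_data prior.emeasure_space_1)
  qed
  also have "\<dots> = (\<integral>\<^sup>+\<beta>. \<integral>\<^sup>+x. (row_density \<beta> x)\<^sup>2 \<partial>R \<partial>\<pi>)"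
  proof (rule R.Fubini')
    show "(\<lambda>(\<beta>, x). (row_density \<beta> x)\<^sup>2) \<in> borel_measurable (\<pi> \<Otimes>\<^sub>M R)"
      using borel_measurable_power_ennreal[OF measurable_row_density, of 2] by (simp add: split_beta')
  qed
  also have "\<dots> = (\<integral>\<^sup>+\<beta>. ennreal (\<tau>\<^sup>2) ^ n \<partial>\<pi>)"
    using norm_prior by (intro nn_integral_cong_AE) (auto simp: nn_integral_row_density_square)
  also have "\<dots> = ennreal (\<tau>\<^sup>2) ^ n"
    by (simp add: prior.emeasure_space_1)
  finally show ?thesis .
qed

lemma prob_space_Q: "prob_space Q"
  unfolding Q_eq by (intro prob_space.prob_space_distr measurable_row_data) simp

lemma prob_space_P: "prob_space P"
proof -
  interpret prior: prob_space \<pi> by (rule prob_prior)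
  interpret R: prob_space R by simp
  interpret pair_prob_space \<pi> R ..
  show ?thesis
    unfolding P_eq by (intro prob_space_distr measurable_tilted)
qed

lemma absolutely_continuous_P: "absolutely_continuous Q P"
  unfolding P_density by (rule absolutely_continuousI_density) (simp add: measurable_mixture_density sets_Q cong: measurable_cong_sets)

lemma square_integrable_likelihood_ratio: "square_integrable Q (likelihood_ratio P Q)"
proof -
  interpret Q: prob_space Q by (rule prob_space_Q)
  have g [measurable]: "mixture_density \<in> borel_measurable Q"
    using measurable_mixture_density by (simp add: measurable_cong_sets[OF sets_Q refl])
  have [measurable]: "likelihood_ratio P Q \<in> borel_measurable Q"
    unfolding likelihood_ratio_def[abs_def] by measurable
  have ae: "AE z in Q. mixture_density z = RN_deriv Q P z"
    by (rule Q.RN_deriv_unique[OF g]) (rule P_density[symmetric])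
  have "(\<integral>\<^sup>+z. ennreal (norm ((likelihood_ratio P Q z)\<^sup>2)) \<partial>Q) \<le> (\<integral>\<^sup>+z. (mixture_density z)\<^sup>2 \<partial>Q)"
  proof (rule nn_integral_mono_AE)
    \<comment> \<open>Also true for infinite \<open>a\<close>, where the conversion to a real
      returns 0.\<close>
    have "ennreal (norm ((enn2real a)\<^sup>2)) \<le> a\<^sup>2" for a :: ennreal
      by (cases a) (simp_all add: ennreal_power[symmetric])
    then show "AE z in Q. ennreal (norm ((likelihood_ratio P Q z)\<^sup>2)) \<le> (mixture_density z)\<^sup>2"
      using ae by (auto simp: likelihood_ratio_def)
  qed
  also have "\<dots> < \<infinity>"
    using nn_integral_mixture_density_square
    by (rule le_less_trans) (simp add: power_less_top_ennreal)
  finally have "integrable Q (\<lambda>z. (likelihood_ratio P Q z)\<^sup>2)"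
    by (intro integrableI_bounded) simp_all
  then show ?thesis by (simp add: square_integrable_def)
qed

end

section \<open>Hermite moments of the alternative\<close>

lemma integral_nhermite_hermite:
  "(\<integral>x. nhermite k x * hermite 1 l x \<partial>gauss) = (if k = l then 1 / sqrt (fact k) else 0)"
  "integrable gauss (\<lambda>x. nhermite k x * hermite 1 l x)"
proof -
  have eq: "nhermite k x * hermite 1 l x = sqrt (fact k) * (hermite 1 k x * hermite 1 l x)" for x
    by (simp add: nhermite_def)
  show "integrable gauss (\<lambda>x. nhermite k x * hermite 1 l x)"
    unfolding eq by (intro integrable_mult_right integrable_hermite_mult)
  have "sqrt (fact k) / fact k = 1 / sqrt (fact k)"
    by (simp add: divide_simps)
  then show "(\<integral>x. nhermite k x * hermite 1 l x \<partial>gauss) = (if k = l then 1 / sqrt (fact k) else 0)"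
    unfolding eq by (auto simp: integral_hermite_mult)
qed

lemma integral_std_gaussian_prod:
  fixes f :: "'i \<Rightarrow> real \<Rightarrow> real"
  assumes "finite J" "\<And>j. j \<in> J \<Longrightarrow> integrable gauss (f j)"
  shows "integrable (std_gaussian J) (\<lambda>x. \<Prod>j\<in>J. f j (x j))"
    and "(\<integral>x. (\<Prod>j\<in>J. f j (x j)) \<partial>std_gaussian J) = (\<Prod>j\<in>J. \<integral>y. f j y \<partial>gauss)"
  unfolding std_gaussian_def using assms
  by (intro gauss.product_integrable_prod gauss.product_integral_prod; simp)+

lemma integral_gauss_rows_prod:
  fixes f :: "nat \<Rightarrow> (nat \<Rightarrow> real) \<Rightarrow> real"
  assumes "\<And>i. i < n \<Longrightarrow> integrable (std_gaussian {..p}) (f i)"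
  shows "integrable (gauss_rows n p) (\<lambda>x. \<Prod>i<n. f i (x i))"
    and "(\<integral>x. (\<Prod>i<n. f i (x i)) \<partial>gauss_rows n p) = (\<Prod>i<n. \<integral>y. f i y \<partial>std_gaussian {..p})"
proof -
  interpret rows: product_prob_space "\<lambda>_. std_gaussian {..p}" "{..<n}"
    by (rule product_prob_space_std_gaussian)
  show "integrable (gauss_rows n p) (\<lambda>x. \<Prod>i<n. f i (x i))"
    and "(\<integral>x. (\<Prod>i<n. f i (x i)) \<partial>gauss_rows n p) = (\<Prod>i<n. \<integral>y. f i y \<partial>std_gaussian {..p})"
    unfolding gauss_rows_def using assms
    by (intro rows.product_integrable_prod rows.product_integral_prod; simp)+
qed

definition row_moment :: "nat \<Rightarrow> (nat \<Rightarrow> real) \<Rightarrow> (nat \<Rightarrow> nat) \<Rightarrow> nat \<Rightarrow> real" where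
  "row_moment p u a b =
     (if (\<Sum>j<p. a j) = b then sqrt (fact b) * (\<Prod>j<p. u j ^ a j / sqrt (fact (a j))) else 0)"

text \<open>Expand the Hermite polynomial of the response by \<open>hermite_sum\<close> with
  variances \<open>(w j)\<^sup>2\<close>. By orthogonality a single multi-index survives, and it has
  total degree \<open>b\<close>; so the moment vanishes unless the design factors have the same
  total degree.\<close>

lemma integral_row_moment:
  assumes w: "(\<Sum>j\<le>p. (w j)\<^sup>2) = 1"
  shows "integrable (std_gaussian {..p}) (\<lambda>x. (\<Prod>j<p. nhermite (a j) (x j)) * nhermite b (\<Sum>j\<le>p. w j * x j))"
    and "(\<integral>x. (\<Prod>j<p. nhermite (a j) (x j)) * nhermite b (\<Sum>j\<le>p. w j * x j) \<partial>std_gaussian {..p}) =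
      row_moment p w a b"
proof -
  \<comment> \<open>The noise column \<open>p\<close> carries no Hermite factor of its own and hence
    exponent 0.\<close>
  define a' where "a' j = (if j < p then a j else 0)" for j
  have herm: "hermite 1 b (\<Sum>j\<le>p. w j * x j) =
      (\<Sum>c\<in>multi {..p} b. \<Prod>j\<le>p. w j ^ c j * hermite 1 (c j) (x j))" for x
    using hermite_sum[of "{..p}" "\<lambda>j. (w j)\<^sup>2" b "\<lambda>j. w j * x j"] hermite_scale[of _ 1]
    by (simp add: w)
  have a': "(\<Prod>j<p. nhermite (a j) (x j)) = (\<Prod>j\<le>p. nhermite (a' j) (x j))" for x
    by (simp add: lessThan_Suc_atMost[symmetric] a'_def)
  have eq: "(\<Prod>j<p. nhermite (a j) (x j)) * nhermite b (\<Sum>j\<le>p. w j * x j) =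
      (\<Sum>c\<in>multi {..p} b. sqrt (fact b) * (\<Prod>j\<le>p. w j ^ c j * (nhermite (a' j) (x j) * hermite 1 (c j) (x j))))" for x
    unfolding a' nhermite_def[of b] herm
    by (simp add: sum_distrib_left prod.distrib mult_ac)
  have int: "integrable gauss (\<lambda>y. w j ^ c j * (nhermite (a' j) y * hermite 1 (c j) y))" for c j
    by (intro integrable_mult_right integral_nhermite_hermite)
  have int_prod: "integrable (std_gaussian {..p}) (\<lambda>x. \<Prod>j\<le>p. w j ^ c j * (nhermite (a' j) (x j) * hermite 1 (c j) (x j)))" for c
    using int by (intro integral_std_gaussian_prod) auto
  show "integrable (std_gaussian {..p}) (\<lambda>x. (\<Prod>j<p. nhermite (a j) (x j)) * nhermite b (\<Sum>j\<le>p. w j * x j))"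
    unfolding eq by (intro Bochner_Integration.integrable_sum integrable_mult_right int_prod)
  have val: "(\<integral>x. (\<Prod>j\<le>p. w j ^ c j * (nhermite (a' j) (x j) * hermite 1 (c j) (x j))) \<partial>std_gaussian {..p}) =
      (if c = a' then \<Prod>j<p. w j ^ a j / sqrt (fact (a j)) else 0)" if "c \<in> multi {..p} b" for c
  proof -
    have "(\<integral>x. (\<Prod>j\<le>p. w j ^ c j * (nhermite (a' j) (x j) * hermite 1 (c j) (x j))) \<partial>std_gaussian {..p}) =
        (\<Prod>j\<le>p. w j ^ c j * (if a' j = c j then 1 / sqrt (fact (a' j)) else 0))"
      using int by (subst integral_std_gaussian_prod) (simp_all add: integral_nhermite_hermite)
    also have "\<dots> = (if c = a' then \<Prod>j<p. w j ^ a j / sqrt (fact (a j)) else 0)"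
    proof (cases "c = a'")
      case True
      then show ?thesis by (simp add: lessThan_Suc_atMost[symmetric] a'_def)
    next
      case False
      then obtain j where j: "c j \<noteq> a' j" by auto
      then have "j \<le> p" using that by (cases "j \<le> p") (auto simp: multi_def a'_def)
      with j have "\<exists>j\<in>{..p}. w j ^ c j * (if a' j = c j then 1 / sqrt (fact (a' j)) else 0) = 0"
        by (intro bexI[of _ j]) auto
      then have "(\<Prod>j\<le>p. w j ^ c j * (if a' j = c j then 1 / sqrt (fact (a' j)) else 0)) = 0"
        by (intro prod_zero) auto
      with False show ?thesis by simp
    qed
    finally show ?thesis .
  qed
  have mem: "a' \<in> multi {..p} b \<longleftrightarrow> (\<Sum>j<p. a j) = b"
    by (auto simp: multi_def a'_def lessThan_Suc_atMost[symmetric])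
  have "(\<integral>x. (\<Prod>j<p. nhermite (a j) (x j)) * nhermite b (\<Sum>j\<le>p. w j * x j) \<partial>std_gaussian {..p}) =
      (\<Sum>c\<in>multi {..p} b. sqrt (fact b) * (if c = a' then \<Prod>j<p. w j ^ a j / sqrt (fact (a j)) else 0))"
    unfolding eq using int_prod
    by (subst Bochner_Integration.integral_sum) (auto simp: val intro!: sum.cong)
  also have "\<dots> = row_moment p w a b"
    by (simp add: mem row_moment_def if_distrib[of "\<lambda>x. _ * x"] cong: if_cong)
  finally show "(\<integral>x. (\<Prod>j<p. nhermite (a j) (x j)) * nhermite b (\<Sum>j\<le>p. w j * x j) \<partial>std_gaussian {..p}) =
      row_moment p w a b" .
qed

text \<open>The layout of the data vector, regrouped by rows. It is stated for commutative monoids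
  because the total degree needs it for sums and the Hermite basis for products.\<close>

lemma (in comm_monoid_set) split_rows:
  fixes n p :: nat
  shows "F g {..<n * p + n} = F (\<lambda>i. F (\<lambda>j. g (i * p + j)) {..<p} \<^bold>* g (n * p + i)) {..<n}"
proof -
  have "F g {..<n * p + n} = F g ({..<n * p} \<union> {n * p..<n * p + n})"
    by (rule arg_cong[where f = "F g"]) auto
  also have "\<dots> = F g {..<n * p} \<^bold>* F g {n * p..<n * p + n}"
    by (rule union_disjoint) auto
  also have "F g {..<n * p} = F (\<lambda>i. F g {i * p..<i * p + p}) {..<n}"
    by (rule nat_group[symmetric])
  also have "\<dots> = F (\<lambda>i. F (\<lambda>j. g (i * p + j)) {..<p}) {..<n}"
  proof (rule cong[OF refl])
    fix i
    show "F g {i * p..<i * p + p} = F (\<lambda>j. g (i * p + j)) {..<p}"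
      by (rule reindex_bij_witness[where i = "\<lambda>j. i * p + j" and j = "\<lambda>m. m - i * p"]) auto
  qed
  also have "F g {n * p..<n * p + n} = F (\<lambda>i. g (n * p + i)) {..<n}"
    by (rule reindex_bij_witness[where i = "\<lambda>i. n * p + i" and j = "\<lambda>m. m - n * p"]) auto
  finally show ?thesis by (simp add: distrib)
qed

definition moment :: "nat \<Rightarrow> nat \<Rightarrow> (nat \<Rightarrow> real) \<Rightarrow> (nat \<Rightarrow> nat) \<Rightarrow> real" where
  "moment n p u \<alpha> = (\<Prod>i<n. row_moment p u (\<lambda>j. \<alpha> (i * p + j)) (\<alpha> (n * p + i)))"

text \<open>The nonzero terms are given by the exponents \<open>b i\<close> of the responses and, for each row,
  a multi-index of degree \<open>b i\<close>.\<close>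
lemma sum_moment_mult:
  "(\<Sum>\<alpha>\<in>exponents (n * p + n) D. moment n p u \<alpha> * moment n p v \<alpha>) =
   (\<Sum>M\<le>D div 2. \<Sum>b\<in>multi {..<n} M. (\<Sum>j<p. u j * v j) ^ sum b {..<n})"
proof -
  define N where "N = n * p + n"
  define t where "t = (\<Sum>j<p. u j * v j)"
  define row where "row \<alpha> i = (\<lambda>j. if j < p then \<alpha> (i * p + j) else 0)" for \<alpha> :: "nat \<Rightarrow> nat" and i
  \<comment> \<open>The product of two moments of one row: the square roots pair up to a multinomial
    coefficient, and the two directions enter only through \<open>u j * v j\<close>.\<close>
  define G where "G a b = fact b * (\<Prod>j<p. (u j * v j) ^ a j / fact (a j))" for a :: "nat \<Rightarrow> nat" and b
  define K where "K = {\<alpha>\<in>exponents N D. \<forall>i<n. (\<Sum>j<p. \<alpha> (i * p + j)) = \<alpha> (n * p + i)}"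
  \<comment> \<open>A balanced row spends every degree twice, once on its response and once on its
    design entries. This is the origin of \<open>D div 2\<close>.\<close>
  define B where "B = {b. (\<forall>i. i \<notin> {..<n} \<longrightarrow> b i = 0) \<and> 2 * sum b {..<n} \<le> D}"
  define S where "S b = PiE_dflt {..<n} (\<lambda>_. 0) (\<lambda>i. multi {..<p} (b i))" for b :: "nat \<Rightarrow> nat"
  have row_mult: "row_moment p u a b * row_moment p v a b = (if (\<Sum>j<p. a j) = b then G a b else 0)" for a b
  proof -
    have "(\<Prod>j<p. u j ^ a j / sqrt (fact (a j))) * (\<Prod>j<p. v j ^ a j / sqrt (fact (a j))) =
        (\<Prod>j<p. (u j * v j) ^ a j / fact (a j))"
      by (simp add: prod.distrib[symmetric] power_mult_distrib)
    moreover have "sqrt (fact b) * x * (sqrt (fact b) * y) = fact b * (x * y)" for x y :: real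
    proof -
      have "sqrt (fact b) * x * (sqrt (fact b) * y) = (sqrt (fact b) * sqrt (fact b)) * (x * y)"
        by (simp only: mult_ac)
      then show ?thesis by simp
    qed
    ultimately have "sqrt (fact b) * (\<Prod>j<p. u j ^ a j / sqrt (fact (a j))) *
        (sqrt (fact b) * (\<Prod>j<p. v j ^ a j / sqrt (fact (a j)))) = G a b"
      by (simp only: G_def)
    then show ?thesis by (simp add: row_moment_def)
  qed
  have "moment n p u \<alpha> * moment n p v \<alpha> =
      (if \<alpha> \<in> K then \<Prod>i<n. G (row \<alpha> i) (\<alpha> (n * p + i)) else 0)" if "\<alpha> \<in> exponents N D" for \<alpha>
  proof -
    have G_row: "G (row \<alpha> i) b = G (\<lambda>j. \<alpha> (i * p + j)) b" for i b
      by (simp add: G_def row_def)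
    have "moment n p u \<alpha> * moment n p v \<alpha> = (\<Prod>i<n. if (\<Sum>j<p. \<alpha> (i * p + j)) = \<alpha> (n * p + i)
        then G (\<lambda>j. \<alpha> (i * p + j)) (\<alpha> (n * p + i)) else 0)"
      by (simp add: moment_def prod.distrib[symmetric] row_mult)
    also have "\<dots> = (if \<alpha> \<in> K then \<Prod>i<n. G (row \<alpha> i) (\<alpha> (n * p + i)) else 0)"
      using that by (auto simp: K_def G_row intro!: prod.cong prod_zero)
    finally show ?thesis .
  qed
  then have "(\<Sum>\<alpha>\<in>exponents N D. moment n p u \<alpha> * moment n p v \<alpha>) =
      (\<Sum>\<alpha>\<in>exponents N D. if \<alpha> \<in> K then \<Prod>i<n. G (row \<alpha> i) (\<alpha> (n * p + i)) else 0)"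
    by (rule sum.cong[OF refl])
  also have "\<dots> = (\<Sum>\<alpha>\<in>K. \<Prod>i<n. G (row \<alpha> i) (\<alpha> (n * p + i)))"
  proof -
    have "exponents N D \<inter> K = K" by (auto simp: K_def)
    then show ?thesis using finite_exponents by (simp add: sum.inter_restrict[symmetric])
  qed
  also have "\<dots> = (\<Sum>(b, g)\<in>Sigma B S. \<Prod>i<n. G (g i) (b i))"
  \<comment> \<open>A balanced exponent is cut into the response exponents \<open>b\<close> and the
    row exponents \<open>g\<close>. Fixing all values outside the index ranges to 0 makes the two
    maps inverse to each other.\<close>
  proof (rule sum.reindex_bij_witness[where
        j = "\<lambda>\<alpha>. (\<lambda>i. if i < n then \<alpha> (n * p + i) else 0, \<lambda>i. if i < n then row \<alpha> i else (\<lambda>_. 0))" and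
        i = "\<lambda>(b, g) m. if m < n * p then g (m div p) (m mod p) else if m < N then b (m - n * p) else 0"])
    fix \<alpha> assume \<alpha>: "\<alpha> \<in> K"
    let ?b = "\<lambda>i. if i < n then \<alpha> (n * p + i) else 0"
    let ?g = "\<lambda>i. if i < n then row \<alpha> i else (\<lambda>_. 0)"
    show "(case (?b, ?g) of (b, g) \<Rightarrow> \<lambda>m. if m < n * p then g (m div p) (m mod p)
        else if m < N then b (m - n * p) else 0) = \<alpha>"
    proof (rule ext)
      fix m
      show "(case (?b, ?g) of (b, g) \<Rightarrow> \<lambda>m. if m < n * p then g (m div p) (m mod p)
        else if m < N then b (m - n * p) else 0) m = \<alpha> m"
        using \<alpha> div_mod_less[of m n p] by (auto simp: row_def K_def exponents_def N_def)
    qed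
    have eqs: "\<And>i. i < n \<Longrightarrow> (\<Sum>j<p. \<alpha> (i * p + j)) = \<alpha> (n * p + i)" using \<alpha> by (simp add: K_def)
    have "(\<Sum>m<N. \<alpha> m) = (\<Sum>i<n. (\<Sum>j<p. \<alpha> (i * p + j)) + \<alpha> (n * p + i))"
      unfolding N_def by (rule sum.split_rows)
    also have "\<dots> = 2 * (\<Sum>i<n. \<alpha> (n * p + i))"
      by (simp add: eqs sum_distrib_left mult_2)
    finally have "2 * (\<Sum>i<n. \<alpha> (n * p + i)) \<le> D" using \<alpha> by (simp add: K_def exponents_def)
    then have "?b \<in> B" by (simp add: B_def)
    moreover have "?g \<in> S ?b"
      by (auto simp: S_def PiE_dflt_def multi_def row_def eqs)
    ultimately show "(?b, ?g) \<in> Sigma B S" by simp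
    show "(case (?b, ?g) of (b, g) \<Rightarrow> \<Prod>i<n. G (g i) (b i)) = (\<Prod>i<n. G (row \<alpha> i) (\<alpha> (n * p + i)))"
      by simp
  next
    fix q assume "q \<in> Sigma B S"
    then obtain b g where q: "q = (b, g)" and b: "b \<in> B" and g: "g \<in> S b" by auto
    let ?\<alpha> = "\<lambda>m. if m < n * p then g (m div p) (m mod p) else if m < N then b (m - n * p) else 0"
    have A1: "?\<alpha> (i * p + j) = g i j" if "i < n" "j < p" for i j
      using mult_add_less[OF that] that by simp
    have A2: "?\<alpha> (n * p + i) = b i" if "i < n" for i
      using that by (simp add: N_def)
    have gs: "(\<Sum>j<p. g i j) = b i" "\<And>j. \<not> j < p \<Longrightarrow> g i j = 0" if "i < n" for i
      using g that by (auto simp: S_def PiE_dflt_def multi_def)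
    have g0: "g i = (\<lambda>_. 0)" if "\<not> i < n" for i
      using g that by (auto simp: S_def PiE_dflt_def)
    have b0: "b i = 0" if "\<not> i < n" for i
      using b that by (auto simp: B_def)
    have row_g: "row ?\<alpha> i = g i" if "i < n" for i
      unfolding row_def fun_eq_iff using gs(2)[OF that] A1[OF that] by simp
    have "(\<lambda>i. if i < n then ?\<alpha> (n * p + i) else 0) = b"
      using A2 b0 by fastforce
    moreover have "(\<lambda>i. if i < n then row ?\<alpha> i else (\<lambda>_. 0)) = g"
      using row_g g0 by fastforce
    ultimately show "(\<lambda>\<alpha>. (\<lambda>i. if i < n then \<alpha> (n * p + i) else 0, \<lambda>i. if i < n then row \<alpha> i else (\<lambda>_. 0)))
        (case q of (b, g) \<Rightarrow> \<lambda>m. if m < n * p then g (m div p) (m mod p) else if m < N then b (m - n * p) else 0) = q"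
      unfolding q prod.case by (simp only:)
    have "(\<Sum>m<N. ?\<alpha> m) = (\<Sum>i<n. (\<Sum>j<p. ?\<alpha> (i * p + j)) + ?\<alpha> (n * p + i))"
      unfolding N_def by (rule sum.split_rows)
    also have "\<dots> = (\<Sum>i<n. (\<Sum>j<p. g i j) + b i)"
      using A1 A2 by (intro sum.cong arg_cong2[where f = "(+)"]) auto
    also have "\<dots> = 2 * sum b {..<n}"
      by (simp add: gs sum_distrib_left mult_2)
    finally have "(\<Sum>m<N. ?\<alpha> m) \<le> D" using b by (simp add: B_def)
    then have "?\<alpha> \<in> exponents N D" by (simp add: exponents_def N_def)
    moreover have "(\<Sum>j<p. ?\<alpha> (i * p + j)) = ?\<alpha> (n * p + i)" if "i < n" for i
    proof -
      have "(\<Sum>j<p. ?\<alpha> (i * p + j)) = (\<Sum>j<p. g i j)" using A1[OF that] by (intro sum.cong) auto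
      then show ?thesis using gs(1)[OF that] A2[OF that] by simp
    qed
    ultimately have "?\<alpha> \<in> K" by (simp add: K_def)
    then show "(case q of (b, g) \<Rightarrow> \<lambda>m. if m < n * p then g (m div p) (m mod p) else if m < N then b (m - n * p) else 0) \<in> K"
      unfolding q prod.case .
  qed
  also have "\<dots> = (\<Sum>b\<in>B. \<Sum>g\<in>S b. \<Prod>i<n. G (g i) (b i))"
  proof (rule sum.Sigma[symmetric])
    show "finite B"
    proof (rule finite_subset)
      show "B \<subseteq> {b. \<forall>i. (i \<in> {..<n} \<longrightarrow> b i \<in> {..D}) \<and> (i \<notin> {..<n} \<longrightarrow> b i = 0)}"
      proof
        fix b assume b: "b \<in> B"
        have "b i \<le> D" if "i < n" for i
          using b member_le_sum[of i "{..<n}" b] that by (auto simp: B_def)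
        with b show "b \<in> {b. \<forall>i. (i \<in> {..<n} \<longrightarrow> b i \<in> {..D}) \<and> (i \<notin> {..<n} \<longrightarrow> b i = 0)}"
          by (auto simp: B_def)
      qed
      show "finite {b. \<forall>i. (i \<in> {..<n} \<longrightarrow> b i \<in> {..D}) \<and> (i \<notin> {..<n} \<longrightarrow> b i = (0::nat))}"
        by (rule finite_set_of_finite_funs) auto
    qed
    show "\<forall>b\<in>B. finite (S b)" by (auto simp: S_def intro!: finite_PiE_dflt)
  qed
  also have "\<dots> = (\<Sum>b\<in>B. t ^ sum b {..<n})"
  proof (rule sum.cong[OF refl])
    fix b assume "b \<in> B"
    \<comment> \<open>Given the response exponents, the rows are chosen independently, so the sum
      factorises and the multinomial theorem collapses each factor to a power of
      \<open>t\<close>.\<close>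
    have "(\<Sum>g\<in>S b. \<Prod>i<n. G (g i) (b i)) = (\<Prod>i<n. \<Sum>a\<in>multi {..<p} (b i). G a (b i))"
      unfolding S_def by (rule prod_sum_PiE_dflt[symmetric]) auto
    also have "\<dots> = (\<Prod>i<n. t ^ b i)"
      unfolding t_def
      by (intro prod.cong refl, subst multinomial_sum) (simp_all add: G_def sum_distrib_left)
    finally show "(\<Sum>g\<in>S b. \<Prod>i<n. G (g i) (b i)) = t ^ sum b {..<n}"
      by (simp add: power_sum)
  qed
  also have "\<dots> = (\<Sum>M\<le>D div 2. \<Sum>b\<in>{b\<in>B. sum b {..<n} = M}. t ^ sum b {..<n})"
  proof (rule sum.group[symmetric])
    show "finite B"
    proof (rule finite_subset)
      show "B \<subseteq> (\<Union>M\<le>D. multi {..<n} M)" by (auto simp: B_def multi_def)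
    qed simp
    show "(\<lambda>b. sum b {..<n}) ` B \<subseteq> {..D div 2}" by (auto simp: B_def)
  qed simp
  also have "\<dots> = (\<Sum>M\<le>D div 2. \<Sum>b\<in>multi {..<n} M. t ^ sum b {..<n})"
    by (intro sum.cong refl) (auto simp: B_def multi_def)
  finally show ?thesis by (simp add: N_def t_def)
qed

section \<open>The Hermite basis for the null distribution\<close>

context slr_model
begin

lemma integral_Q:
  fixes f :: "(nat \<Rightarrow> real) \<Rightarrow> real"
  assumes "f \<in> borel_measurable (real_space N)"
  shows "(\<integral>z. f z \<partial>Q) = (\<integral>x. f (row_data n p \<tau> x) \<partial>R)"
    and "integrable Q f \<longleftrightarrow> integrable R (\<lambda>x. f (row_data n p \<tau> x))"
  unfolding Q_eq
  using assms by (intro integral_distr integrable_distr_eq measurable_row_data; simp)+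

text \<open>Under the null a response has standard deviation \<open>\<tau>\<close>, so it is
  rescaled before the Hermite polynomial is applied.\<close>

definition basis_factor :: "nat \<Rightarrow> nat \<Rightarrow> real \<Rightarrow> real" where
  "basis_factor i k x = nhermite k (if i < n * p then x else x / \<tau>)"

definition basis :: "(nat \<Rightarrow> nat) \<Rightarrow> (nat \<Rightarrow> real) \<Rightarrow> real" where
  "basis \<alpha> z = (\<Prod>i<N. basis_factor i (\<alpha> i) (z i))"

lemma polynomials_eq: "polynomials N D = product_span N D basis_factor"
proof -
  have "polynomials N D = product_span N D (\<lambda>i k x. x ^ k)"
    by (simp add: polynomials_def product_span_def)
  also have "\<dots> = product_span N D basis_factor"
  proof
    show "product_span N D (\<lambda>i k x. x ^ k) \<subseteq> product_span N D basis_factor"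
    proof (rule product_span_mono)
      fix i m :: nat
      obtain c where c: "\<And>x. x ^ m = (\<Sum>k\<le>m. c k * nhermite k x)"
        using power_in_span_nhermite by blast
      show "\<exists>c. \<forall>x. x ^ m = (\<Sum>k\<le>m. c k * basis_factor i k x)"
      proof (cases "i < n * p")
        case True
        then show ?thesis using c by (auto simp: basis_factor_def)
      next
        case False
        have "x ^ m = (\<Sum>k\<le>m. (\<tau> ^ m * c k) * basis_factor i k x)" for x
        proof -
          have "x ^ m = \<tau> ^ m * (x / \<tau>) ^ m" using \<tau>_nonzero by (simp add: power_divide)
          then show ?thesis using False by (simp add: c basis_factor_def sum_distrib_left mult.assoc)
        qed
        then have "\<forall>x. x ^ m = (\<Sum>k\<le>m. (\<tau> ^ m * c k) * basis_factor i k x)" ..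
        then show ?thesis by (rule exI[of _ "\<lambda>k. \<tau> ^ m * c k"])
      qed
    qed
    show "product_span N D basis_factor \<subseteq> product_span N D (\<lambda>i k x. x ^ k)"
    proof (rule product_span_mono)
      fix i m :: nat
      obtain c where c: "\<And>x. nhermite m x = (\<Sum>k\<le>m. c k * x ^ k)"
        using nhermite_in_span_powers by blast
      have "\<forall>x. basis_factor i m x = (\<Sum>k\<le>m. (if i < n * p then c k else c k / \<tau> ^ k) * x ^ k)"
        by (simp add: basis_factor_def c power_divide)
      then show "\<exists>c. \<forall>x. basis_factor i m x = (\<Sum>k\<le>m. c k * x ^ k)"
        by (rule exI[of _ "\<lambda>k. if i < n * p then c k else c k / \<tau> ^ k"])
    qed
  qed
  finally show ?thesis .
qed

lemma measurable_basis [measurable]: "basis \<alpha> \<in> borel_measurable (real_space N)"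
proof -
  have "(\<lambda>z. basis_factor i (\<alpha> i) (z i)) \<in> borel_measurable (real_space N)" if "i < N" for i
  proof (rule measurable_compose[OF measurable_component_singleton])
    show "basis_factor i (\<alpha> i) \<in> borel_measurable borel"
      unfolding basis_factor_def by measurable
  qed (use that in simp)
  then show ?thesis
    unfolding basis_def by (intro borel_measurable_prod) auto
qed

lemma basis_rows:
  assumes "\<And>i j. i < n \<Longrightarrow> j < p \<Longrightarrow> z (i * p + j) = x i j" "\<And>i. i < n \<Longrightarrow> z (n * p + i) = \<tau> * y i"
  shows "basis \<alpha> z = (\<Prod>i<n. (\<Prod>j<p. nhermite (\<alpha> (i * p + j)) (x i j)) * nhermite (\<alpha> (n * p + i)) (y i))"
  unfolding basis_def prod.split_rows
proof (intro prod.cong refl arg_cong2[where f = "(*)"])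
  fix i assume i: "i \<in> {..<n}"
  show "basis_factor (i * p + j) (\<alpha> (i * p + j)) (z (i * p + j)) = nhermite (\<alpha> (i * p + j)) (x i j)"
    if "j \<in> {..<p}" for j
    using that i mult_add_less[of i n j p] assms(1) by (simp add: basis_factor_def)
  show "basis_factor (n * p + i) (\<alpha> (n * p + i)) (z (n * p + i)) = nhermite (\<alpha> (n * p + i)) (y i)"
    using i assms(2) \<tau>_nonzero by (simp add: basis_factor_def)
qed

definition entry_index :: "nat \<Rightarrow> nat \<Rightarrow> nat" where
  "entry_index i j = (if j < p then i * p + j else n * p + i)"

lemma basis_row_data:
  "basis \<alpha> (row_data n p \<tau> x) = (\<Prod>i<n. \<Prod>j\<le>p. nhermite (\<alpha> (entry_index i j)) (x i j))"
proof -
  have "basis \<alpha> (row_data n p \<tau> x) = (\<Prod>i<n. (\<Prod>j<p. nhermite (\<alpha> (i * p + j)) (x i j)) * nhermite (\<alpha> (n * p + i)) (x i p))"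
    by (rule basis_rows) (simp_all add: row_data_nth)
  then show ?thesis by (simp add: entry_index_def lessThan_Suc_atMost[symmetric])
qed

lemma integral_basis_mult:
  shows "integrable Q (\<lambda>z. basis \<alpha> z * basis \<gamma> z)"
    and "\<alpha> \<in> exponents N D \<Longrightarrow> \<gamma> \<in> exponents N D \<Longrightarrow>
      (\<integral>z. basis \<alpha> z * basis \<gamma> z \<partial>Q) = (if \<alpha> = \<gamma> then 1 else 0)"
proof -
  define f where "f i j y = nhermite (\<alpha> (entry_index i j)) y * nhermite (\<gamma> (entry_index i j)) y" for i j y
  have f: "integrable gauss (f i j)" "(\<integral>y. f i j y \<partial>gauss) = (if \<alpha> (entry_index i j) = \<gamma> (entry_index i j) then 1 else 0)" for i j
    by (simp_all add: f_def[abs_def] integrable_nhermite_mult integral_nhermite_mult)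
  have eq: "basis \<alpha> (row_data n p \<tau> x) * basis \<gamma> (row_data n p \<tau> x) = (\<Prod>i<n. \<Prod>j\<le>p. f i j (x i j))" for x
    by (simp add: basis_row_data f_def prod.distrib)
  have row: "integrable (std_gaussian {..p}) (\<lambda>x. \<Prod>j\<le>p. f i j (x j))" for i
    using f by (intro integral_std_gaussian_prod) auto
  show "integrable Q (\<lambda>z. basis \<alpha> z * basis \<gamma> z)"
    by (subst integral_Q) (simp_all add: eq integral_gauss_rows_prod(1)[where f = "\<lambda>i x. \<Prod>j\<le>p. f i j (x j)"] row)
  assume *: "\<alpha> \<in> exponents N D" "\<gamma> \<in> exponents N D"
  have "(\<integral>z. basis \<alpha> z * basis \<gamma> z \<partial>Q) = (\<integral>x. (\<Prod>i<n. \<Prod>j\<le>p. f i j (x i j)) \<partial>R)"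
    by (subst integral_Q) (simp_all add: eq)
  also have "\<dots> = (\<Prod>i<n. \<integral>x. (\<Prod>j\<le>p. f i j (x j)) \<partial>std_gaussian {..p})"
    by (rule integral_gauss_rows_prod) (rule row)
  also have "\<dots> = (\<Prod>i<n. \<Prod>j\<le>p. if \<alpha> (entry_index i j) = \<gamma> (entry_index i j) then 1 else 0)"
    using f by (simp add: integral_std_gaussian_prod)
  also have "\<dots> = (if \<alpha> = \<gamma> then 1 else 0)"
  proof (cases "\<alpha> = \<gamma>")
    case False
    then obtain m where m: "\<alpha> m \<noteq> \<gamma> m" by auto
    have "m < N" using m * by (cases "m < N") (auto simp: exponents_def)
    \<comment> \<open>Every position of the data vector is some entry of some row, so two different
      exponents differ at an entry, and the factor there is 0.\<close>
    have "\<exists>i<n. \<exists>j\<le>p. m = entry_index i j"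
    proof (cases "m < n * p")
      case True
      then show ?thesis using div_mod_less[OF True]
        by (intro exI[of _ "m div p"] conjI exI[of _ "m mod p"]) (auto simp: entry_index_def)
    next
      case False
      then show ?thesis using \<open>m < N\<close>
        by (intro exI[of _ "m - n * p"] conjI exI[of _ p]) (auto simp: entry_index_def)
    qed
    then obtain i j where "i < n" "j \<le> p" "\<alpha> (entry_index i j) \<noteq> \<gamma> (entry_index i j)"
      using m by auto
    then have "(\<Prod>j\<le>p. if \<alpha> (entry_index i j) = \<gamma> (entry_index i j) then 1 else (0::real)) = 0"
      by (intro prod_zero[OF finite_atMost] bexI[of _ j]) simp_all
    then have "(\<Prod>i<n. \<Prod>j\<le>p. if \<alpha> (entry_index i j) = \<gamma> (entry_index i j) then 1 else (0::real)) = 0"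
      using \<open>i < n\<close> by (intro prod_zero[OF finite_lessThan] bexI[of _ i]) simp_all
    then show ?thesis using False by simp
  qed simp
  finally show "(\<integral>z. basis \<alpha> z * basis \<gamma> z \<partial>Q) = (if \<alpha> = \<gamma> then 1 else 0)" .
qed

lemma square_integrable_basis: "square_integrable Q (basis \<alpha>)"
  using integral_basis_mult(1)[of \<alpha> \<alpha>] measurable_basis[of \<alpha>]
  by (simp add: square_integrable_def power2_eq_square measurable_cong_sets[OF sets_Q refl])

lemma integral_basis_tilted:
  assumes "L2_set \<beta> {..<p} = r"
  shows "(\<integral>x. basis \<alpha> (tilted \<beta> x) \<partial>R) = moment n p (direction \<beta>) \<alpha>"
proof -
  \<comment> \<open>The noise is treated as one more regressor, with weight
    \<open>1 / \<tau>\<close>; this completes the direction to a unit vector.\<close>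
  define w where "w j = (if j < p then direction \<beta> j else 1 / \<tau>)" for j
  have w1: "(\<Sum>j\<le>p. (w j)\<^sup>2) = 1"
    using direction_norm[OF assms] by (simp add: lessThan_Suc_atMost[symmetric] w_def power_divide)
  have wx: "(\<Sum>j\<le>p. w j * x j) = (\<Sum>j<p. direction \<beta> j * x j) + 1 / \<tau> * x p" for x
    by (simp add: lessThan_Suc_atMost[symmetric] w_def)
  have "basis \<alpha> (tilted \<beta> x) = (\<Prod>i<n. (\<Prod>j<p. nhermite (\<alpha> (i * p + j)) (x i j)) *
      nhermite (\<alpha> (n * p + i)) (\<Sum>j\<le>p. w j * x i j))" for x
    by (rule basis_rows) (simp_all add: row_data_nth tilt_rows_def tilt_def wx)
  then have "(\<integral>x. basis \<alpha> (tilted \<beta> x) \<partial>R) = (\<integral>x. (\<Prod>i<n. (\<Prod>j<p. nhermite (\<alpha> (i * p + j)) (x i j)) *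
      nhermite (\<alpha> (n * p + i)) (\<Sum>j\<le>p. w j * x i j)) \<partial>R)"
    by simp
  also have "\<dots> = (\<Prod>i<n. \<integral>x. (\<Prod>j<p. nhermite (\<alpha> (i * p + j)) (x j)) *
      nhermite (\<alpha> (n * p + i)) (\<Sum>j\<le>p. w j * x j) \<partial>std_gaussian {..p})"
    by (rule integral_gauss_rows_prod) (rule integral_row_moment(1)[OF w1])
  also have "\<dots> = moment n p (direction \<beta>) \<alpha>"
  proof -
    have "row_moment p w a b = row_moment p (direction \<beta>) a b" for a b
      by (auto simp: row_moment_def w_def intro!: prod.cong)
    then show ?thesis unfolding integral_row_moment(2)[OF w1] moment_def by simp
  qed
  finally show ?thesis .
qed

lemma measurable_moment: "(\<lambda>\<beta>. moment n p (direction \<beta>) \<alpha>) \<in> borel_measurable \<pi>"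
proof -
  have "(\<lambda>\<beta>. row_moment p (direction \<beta>) a b) \<in> borel_measurable \<pi>" for a b
    unfolding row_moment_def
    by (cases "(\<Sum>j<p. a j) = b")
      (auto intro!: borel_measurable_times borel_measurable_prod borel_measurable_divide
        borel_measurable_power measurable_direction)
  then show ?thesis unfolding moment_def by (intro borel_measurable_prod)
qed

text \<open>Integrability under \<open>P\<close> comes from Cauchy-Schwarz: both the likelihood
  ratio and the basis element are square integrable under \<open>Q\<close>. This justifies Fubini,
  and the mean for a fixed signal is already known.\<close>

lemma integral_basis_P:
  shows "integrable \<pi> (\<lambda>\<beta>. moment n p (direction \<beta>) \<alpha>)"
    and "(\<integral>z. basis \<alpha> z \<partial>P) = (\<integral>\<beta>. moment n p (direction \<beta>) \<alpha> \<partial>\<pi>)"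
proof -
  interpret R: pair_sigma_finite \<pi> R
    by (simp add: pair_sigma_finite_def sigma_finite_prior sigma_finite_R)
  have meas: "basis \<alpha> \<in> borel_measurable Q"
    using measurable_basis by (simp add: measurable_cong_sets[OF sets_Q refl])
  have "integrable P (basis \<alpha>)"
    by (subst likelihood_ratio_integral(2)[OF prob_space_P prob_space_Q _ absolutely_continuous_P meas])
      (simp_all add: sets_P sets_Q integrable_mult_square_integrable
        square_integrable_likelihood_ratio square_integrable_basis)
  then have int: "integrable (\<pi> \<Otimes>\<^sub>M R) (\<lambda>(\<beta>, x). basis \<alpha> (tilted \<beta> x))"
    unfolding P_eq using integrable_distr[OF measurable_tilted] by (simp only: split_beta')
  have ae: "AE \<beta> in \<pi>. (\<integral>x. basis \<alpha> (tilted \<beta> x) \<partial>R) = moment n p (direction \<beta>) \<alpha>"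
    using norm_prior by eventually_elim (rule integral_basis_tilted)
  have int1: "integrable \<pi> (\<lambda>\<beta>. \<integral>x. basis \<alpha> (tilted \<beta> x) \<partial>R)"
    using R.integrable_fst[OF int] .
  show "integrable \<pi> (\<lambda>\<beta>. moment n p (direction \<beta>) \<alpha>)"
    using integrable_cong_AE_imp[OF int1 measurable_moment] ae by (auto simp: eq_commute)
  have "(\<integral>z. basis \<alpha> z \<partial>P) = (\<integral>\<omega>. (case \<omega> of (\<beta>, x) \<Rightarrow> basis \<alpha> (tilted \<beta> x)) \<partial>(\<pi> \<Otimes>\<^sub>M R))"
    unfolding P_eq by (subst integral_distr[OF measurable_tilted]) (simp_all add: split_beta')
  also have "\<dots> = (\<integral>\<beta>. \<integral>x. basis \<alpha> (tilted \<beta> x) \<partial>R \<partial>\<pi>)"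
    using R.integral_fst[OF int] by simp
  also have "\<dots> = (\<integral>\<beta>. moment n p (direction \<beta>) \<alpha> \<partial>\<pi>)"
    using ae measurable_moment int1 by (intro integral_cong_AE) auto
  finally show "(\<integral>z. basis \<alpha> z \<partial>P) = (\<integral>\<beta>. moment n p (direction \<beta>) \<alpha> \<partial>\<pi>)" .
qed

section \<open>The average over two independent signals\<close>

definition kernel :: "nat \<Rightarrow> (nat \<Rightarrow> real) \<Rightarrow> (nat \<Rightarrow> real) \<Rightarrow> real" where
  "kernel D \<beta> \<beta>' = (\<Sum>\<alpha>\<in>exponents N D. moment n p (direction \<beta>) \<alpha> * moment n p (direction \<beta>') \<alpha>)"

text \<open>The square of an average over the prior is the average of a product over two independent
  signals. The sum over exponents is finite and moves inside.\<close>

lemma chi2_eq_kernel: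
  shows "chi2_low_degree N P Q D + 1 = (\<integral>\<beta>'. (\<integral>\<beta>. kernel D \<beta> \<beta>' \<partial>\<pi>) \<partial>\<pi>)"
    and "integrable \<pi> (\<lambda>\<beta>. kernel D \<beta> \<beta>')"
    and "integrable \<pi> (\<lambda>\<beta>'. \<integral>\<beta>. kernel D \<beta> \<beta>' \<partial>\<pi>)"
proof -
  note int = integral_basis_P(1)
  show "integrable \<pi> (\<lambda>\<beta>. kernel D \<beta> \<beta>')"
    unfolding kernel_def by (intro Bochner_Integration.integrable_sum integrable_mult_left int)
  have eq: "(\<integral>\<beta>. kernel D \<beta> \<beta>' \<partial>\<pi>) =
      (\<Sum>\<alpha>\<in>exponents N D. (\<integral>\<beta>. moment n p (direction \<beta>) \<alpha> \<partial>\<pi>) * moment n p (direction \<beta>') \<alpha>)" for \<beta>'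
    unfolding kernel_def using int by (subst Bochner_Integration.integral_sum) auto
  show "integrable \<pi> (\<lambda>\<beta>'. \<integral>\<beta>. kernel D \<beta> \<beta>' \<partial>\<pi>)"
    unfolding eq by (intro Bochner_Integration.integrable_sum integrable_mult_right int)
  have "chi2_low_degree N P Q D + 1 = (\<Sum>\<alpha>\<in>exponents N D. (\<integral>z. basis \<alpha> z \<partial>P)\<^sup>2)"
  proof (rule chi2_low_degree_orthonormal[OF prob_space_P prob_space_Q _ absolutely_continuous_P
        square_integrable_likelihood_ratio polynomials_eq])
    show "basis \<alpha> = (\<lambda>z. \<Prod>i<N. basis_factor i (\<alpha> i) (z i))" for \<alpha>
      by (simp add: basis_def[abs_def])
  qed (simp_all add: sets_P sets_Q square_integrable_basis integral_basis_mult(2))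
  also have "\<dots> = (\<integral>\<beta>'. (\<integral>\<beta>. kernel D \<beta> \<beta>' \<partial>\<pi>) \<partial>\<pi>)"
    unfolding eq using int
    by (subst Bochner_Integration.integral_sum) (auto simp: integral_basis_P(2) power2_eq_square)
  finally show "chi2_low_degree N P Q D + 1 = (\<integral>\<beta>'. (\<integral>\<beta>. kernel D \<beta> \<beta>' \<partial>\<pi>) \<partial>\<pi>)" .
qed

text \<open>Only the common support contributes to the inner product, and each of its terms is at
  most \<open>c\<^sup>2\<close>. The bound has the form of a power of a constant, so that its mean
  becomes a generating function of the overlap.\<close>

lemma kernel_le:
  assumes c: "\<And>j. j < p \<Longrightarrow> \<bar>direction \<beta> j\<bar> \<le> c" "\<And>j. j < p \<Longrightarrow> \<bar>direction \<beta>' j\<bar> \<le> c"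
  shows "kernel D \<beta> \<beta>' \<le> exp ((real n + real (D div 2)) * c\<^sup>2) ^ card {j\<in>{j. j < p \<and> \<beta>' j \<noteq> 0}. \<beta> j \<noteq> 0}"
proof -
  define S where "S = {j\<in>{j. j < p \<and> \<beta>' j \<noteq> 0}. \<beta> j \<noteq> 0}"
  have S: "finite S" "S \<subseteq> {..<p}" by (auto simp: S_def)
  have "\<bar>\<Sum>j<p. direction \<beta> j * direction \<beta>' j\<bar> = \<bar>\<Sum>j\<in>S. direction \<beta> j * direction \<beta>' j\<bar>"
    using S by (intro arg_cong[where f = abs] sum.mono_neutral_right) (auto simp: S_def direction_def)
  also have "\<dots> \<le> (\<Sum>j\<in>S. \<bar>direction \<beta> j * direction \<beta>' j\<bar>)" by (rule sum_abs)
  also have "\<dots> \<le> (\<Sum>j\<in>S. c * c)"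
    unfolding abs_mult using S c by (intro sum_mono mult_mono) (auto intro: order_trans[OF abs_ge_zero])
  also have "\<dots> = real (card S) * c\<^sup>2" by (simp add: power2_eq_square)
  finally have "kernel D \<beta> \<beta>' \<le> exp ((real n + real (D div 2)) * (real (card S) * c\<^sup>2))"
    unfolding kernel_def sum_moment_mult by (rule sum_multi_power_le)
  also have "\<dots> = exp ((real n + real (D div 2)) * c\<^sup>2) ^ card S"
    by (simp add: exp_of_nat_mult[symmetric] mult_ac)
  finally show ?thesis by (simp add: S_def)
qed

text \<open>For a fixed second signal the kernel bound involves only its support, a set of size
  \<open>k\<close>. A bound on the inner average that is uniform in this set bounds the outer
  average.\<close>

lemma chi2_le:
  assumes entries: "AE \<beta> in \<pi>. \<forall>j<p. \<bar>direction \<beta> j\<bar> \<le> c"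
    and card: "AE \<beta> in \<pi>. card {j. j < p \<and> \<beta> j \<noteq> 0} = k"
    and overlap: "\<And>S. S \<subseteq> {..<p} \<Longrightarrow> card S = k \<Longrightarrow>
      integrable \<pi> (\<lambda>\<beta>. exp ((real n + real (D div 2)) * c\<^sup>2) ^ card {j\<in>S. \<beta> j \<noteq> 0}) \<and>
      (\<integral>\<beta>. exp ((real n + real (D div 2)) * c\<^sup>2) ^ card {j\<in>S. \<beta> j \<noteq> 0} \<partial>\<pi>) \<le> B"
  shows "chi2_low_degree N P Q D + 1 \<le> B"
proof -
  interpret prior: prob_space \<pi> by (rule prob_prior)
  have "chi2_low_degree N P Q D + 1 = (\<integral>\<beta>'. (\<integral>\<beta>. kernel D \<beta> \<beta>' \<partial>\<pi>) \<partial>\<pi>)"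
    by (rule chi2_eq_kernel)
  also have "\<dots> \<le> (\<integral>\<beta>'. B \<partial>\<pi>)"
  proof (rule integral_mono_AE)
    show "AE \<beta>' in \<pi>. (\<integral>\<beta>. kernel D \<beta> \<beta>' \<partial>\<pi>) \<le> B"
      using entries card
    proof eventually_elim
      case (elim \<beta>')
      let ?S = "{j. j < p \<and> \<beta>' j \<noteq> 0}"
      have S: "?S \<subseteq> {..<p}" by auto
      have "(\<integral>\<beta>. kernel D \<beta> \<beta>' \<partial>\<pi>) \<le> (\<integral>\<beta>. exp ((real n + real (D div 2)) * c\<^sup>2) ^ card {j\<in>?S. \<beta> j \<noteq> 0} \<partial>\<pi>)"
      proof (rule integral_mono_AE)
        show "AE \<beta> in \<pi>. kernel D \<beta> \<beta>' \<le> exp ((real n + real (D div 2)) * c\<^sup>2) ^ card {j\<in>?S. \<beta> j \<noteq> 0}"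
          using entries by eventually_elim (rule kernel_le; use elim in blast)
      qed (use overlap[OF S elim(2)] chi2_eq_kernel in auto)
      also have "\<dots> \<le> B" using overlap[OF S elim(2)] by simp
      finally show ?case .
    qed
  qed (use chi2_eq_kernel in auto)
  also have "\<dots> = B" by (simp add: prior.prob_space)
  finally show ?thesis .
qed

end

section \<open>Exchangeability of the prior\<close>

lemma euclid_dist_permute:
  assumes "\<rho> permutes {..<p}"
  shows "euclid_dist p (x \<circ> \<rho>) (y \<circ> \<rho>) = euclid_dist p x y"
proof -
  have "(\<Sum>i<p. (x (\<rho> i) - y (\<rho> i))\<^sup>2) = (\<Sum>i<p. (x i - y i)\<^sup>2)"
    using sum.reindex_bij_betw[OF permutes_imp_bij[OF assms], of "\<lambda>i. (x i - y i)\<^sup>2"] .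
  then show ?thesis by (simp add: euclid_dist_def L2_set_def)
qed

lemma diam_power_permute:
  assumes "\<rho> permutes {..<p}"
  shows "diam_power p s ((\<lambda>x. x \<circ> \<rho>) ` U) = diam_power p s U"
proof -
  let ?g = "\<lambda>x :: nat \<Rightarrow> real. x \<circ> \<rho>"
  have "?g ` U \<times> ?g ` U = map_prod ?g ?g ` (U \<times> U)" by auto
  then have "(\<lambda>(x, y). euclid_dist p x y) ` (?g ` U \<times> ?g ` U) = (\<lambda>(x, y). euclid_dist p x y) ` (U \<times> U)"
    by (simp add: image_image split_beta' euclid_dist_permute[OF assms])
  then show ?thesis by (simp add: diam_power_def)
qed

text \<open>A permutation of the coordinates is an isometry, so it maps an admissible cover to an
  admissible cover with the same diameters. Equality follows from the inverse permutation.\<close>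

lemma hausdorff_measure_permute_le:
  assumes \<rho>: "\<rho> permutes {..<p}"
  shows "hausdorff_measure p s ((\<lambda>x. x \<circ> \<rho>) ` A) \<le> hausdorff_measure p s A"
  unfolding hausdorff_measure_def
proof (rule SUP_mono, rule bexI)
  fix \<delta> :: real assume \<delta>: "\<delta> \<in> {0<..}"
  show "\<delta> \<in> {0<..}" by fact
  let ?g = "\<lambda>x :: nat \<Rightarrow> real. x \<circ> \<rho>"
  define C where "C A = {U :: nat \<Rightarrow> (nat \<Rightarrow> real) set. A \<subseteq> (\<Union>i. U i) \<and>
      (\<forall>i. \<forall>x\<in>U i. \<forall>y\<in>U i. euclid_dist p x y \<le> \<delta>)}" for A
  have "(INF U\<in>C (?g ` A). \<Sum>i. diam_power p s (U i)) \<le> (INF U\<in>C A. \<Sum>i. diam_power p s (U i))"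
  proof (rule INF_greatest)
    fix U assume U: "U \<in> C A"
    have "?g ` A \<subseteq> ?g ` (\<Union>i. U i)"
      using U by (intro image_mono) (simp add: C_def)
    then have "(\<lambda>i. ?g ` U i) \<in> C (?g ` A)"
      using U by (simp add: C_def euclid_dist_permute[OF \<rho>] image_UN)
    then have "(INF U\<in>C (?g ` A). \<Sum>i. diam_power p s (U i)) \<le> (\<Sum>i. diam_power p s (?g ` U i))"
      by (rule INF_lower2) simp
    then show "(INF U\<in>C (?g ` A). \<Sum>i. diam_power p s (U i)) \<le> (\<Sum>i. diam_power p s (U i))"
      by (simp add: diam_power_permute[OF \<rho>])
  qed
  then show "(INF U\<in>{U. ?g ` A \<subseteq> (\<Union>i. U i) \<and> (\<forall>i. \<forall>x\<in>U i. \<forall>y\<in>U i. euclid_dist p x y \<le> \<delta>)}.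
        \<Sum>i. diam_power p s (U i)) \<le>
      (INF U\<in>{U. A \<subseteq> (\<Union>i. U i) \<and> (\<forall>i. \<forall>x\<in>U i. \<forall>y\<in>U i. euclid_dist p x y \<le> \<delta>)}.
        \<Sum>i. diam_power p s (U i))"
    by (simp add: C_def)
qed

lemma hausdorff_measure_permute:
  assumes \<rho>: "\<rho> permutes {..<p}"
  shows "hausdorff_measure p s ((\<lambda>x. x \<circ> \<rho>) ` A) = hausdorff_measure p s A"
proof (rule antisym)
  show "hausdorff_measure p s ((\<lambda>x. x \<circ> \<rho>) ` A) \<le> hausdorff_measure p s A"
    by (rule hausdorff_measure_permute_le[OF \<rho>])
  have "(\<lambda>x. x \<circ> inv \<rho>) ` ((\<lambda>x. x \<circ> \<rho>) ` A) = A"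
    by (simp add: image_image comp_assoc permutes_inv_o[OF \<rho>])
  then show "hausdorff_measure p s A \<le> hausdorff_measure p s ((\<lambda>x. x \<circ> \<rho>) ` A)"
    using hausdorff_measure_permute_le[OF permutes_inv[OF \<rho>], of s "(\<lambda>x. x \<circ> \<rho>) ` A"] by simp
qed

lemma sparse_signals_permute:
  assumes \<rho>: "\<rho> permutes {..<p}" and x: "x \<in> sparse_signals p k \<D> r"
  shows "x \<circ> \<rho> \<in> sparse_signals p k \<D> r"
proof -
  have lt: "\<rho> j < p \<longleftrightarrow> j < p" for j
    using permutes_in_image[OF \<rho>, of j] by simp
  have "{j. j < p \<and> x j \<noteq> 0} = \<rho> ` {j. j < p \<and> x (\<rho> j) \<noteq> 0}"
    using lt permutes_inv_eq[OF \<rho>] by (auto simp: image_iff) (metis permutes_inverses(1)[OF \<rho>])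
  then have "card {j. j < p \<and> x (\<rho> j) \<noteq> 0} = card {j. j < p \<and> x j \<noteq> 0}"
    by (simp add: card_image permutes_inj_on[OF \<rho>])
  moreover have "(\<Sum>i<p. (x (\<rho> i))\<^sup>2) = (\<Sum>i<p. (x i)\<^sup>2)"
    using sum.reindex_bij_betw[OF permutes_imp_bij[OF \<rho>], of "\<lambda>i. (x i)\<^sup>2"] .
  moreover have "x \<circ> \<rho> \<in> extensional {..<p}"
    using x permutes_not_in[OF \<rho>] by (auto simp: sparse_signals_def extensional_def)
  ultimately show ?thesis
    using x lt by (auto simp: sparse_signals_def L2_set_def)
qed

text \<open>Glue a bijection between the two sets with one between their complements, which have
  equal size as well.\<close>

lemma ex_permutes_image:
  assumes "T \<subseteq> {..<p}" "T' \<subseteq> {..<p}" "card T = card T'"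
  obtains \<rho> where "\<rho> permutes {..<(p::nat)}" "\<rho> ` T' = T"
proof -
  have fin: "finite T" "finite T'" using assms finite_subset by blast+
  obtain f where f: "bij_betw f T' T"
    using finite_same_card_bij[OF fin(2,1)] assms by auto
  obtain g where g: "bij_betw g ({..<p} - T') ({..<p} - T)"
    using finite_same_card_bij[of "{..<p} - T'" "{..<p} - T"] assms fin by (auto simp: card_Diff_subset)
  define \<rho> where "\<rho> j = (if j \<in> T' then f j else if j < p then g j else j)" for j
  have 1: "bij_betw \<rho> T' T"
    using f by (rule bij_betw_cong[THEN iffD1, rotated]) (simp add: \<rho>_def)
  have 2: "bij_betw \<rho> ({..<p} - T') ({..<p} - T)"
    using g by (rule bij_betw_cong[THEN iffD1, rotated]) (auto simp: \<rho>_def)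
  have "bij_betw \<rho> (T' \<union> ({..<p} - T')) (T \<union> ({..<p} - T))"
    using 1 2 by (rule bij_betw_combine) auto
  moreover have "T' \<union> ({..<p} - T') = {..<p}" "T \<union> ({..<p} - T) = {..<p}" using assms by auto
  ultimately have "bij_betw \<rho> {..<p} {..<p}" by simp
  then have "\<rho> permutes {..<p}"
    by (rule bij_imp_permutes) (use assms in \<open>auto simp: \<rho>_def\<close>)
  then show ?thesis using that bij_betw_imp_surj_on[OF 1] by blast
qed

section \<open>Support events\<close>

definition nonzero_on :: "nat \<Rightarrow> nat set \<Rightarrow> (nat \<Rightarrow> real) set" where
  "nonzero_on p T = {\<beta> \<in> space (real_space p). \<forall>j\<in>T. \<beta> j \<noteq> 0}"

lemma sets_nonzero_on [measurable]:
  assumes "T \<subseteq> {..<p}"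
  shows "nonzero_on p T \<in> sets (real_space p)"
proof -
  have "Measurable.pred (real_space p) (\<lambda>\<beta>. \<beta> j \<noteq> 0)" if "j \<in> T" for j
  proof -
    have [measurable]: "(\<lambda>\<beta>. \<beta> j) \<in> borel_measurable (real_space p)"
      using that assms by (intro measurable_component_singleton) auto
    show ?thesis by measurable
  qed
  then have "Measurable.pred (real_space p) (\<lambda>\<beta>. \<forall>j\<in>T. \<beta> j \<noteq> 0)"
    using finite_subset[OF assms] by (intro pred_intros_finite) auto
  then show ?thesis unfolding nonzero_on_def by simp
qed

text \<open>The set of signals and its Hausdorff measure, in whichever dimension, are invariant
  under permutations. Composition with \<open>\<rho>\<close> pulls supports back, which is why
  \<open>\<rho>\<close> has to map \<open>T'\<close> onto \<open>T\<close>.\<close>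

lemma uniform_on_exchangeable:
  assumes "uniform_on p (sparse_signals p k \<D> r) \<pi>"
    and T: "T \<subseteq> {..<p}" "T' \<subseteq> {..<p}" "card T = card T'"
  shows "emeasure \<pi> (nonzero_on p T) = emeasure \<pi> (nonzero_on p T')"
proof -
  let ?A = "sparse_signals p k \<D> r"
  obtain \<rho> where \<rho>: "\<rho> permutes {..<p}" "\<rho> ` T' = T"
    using ex_permutes_image[OF T] by blast
  have A: "?A \<subseteq> space (real_space p)"
    by (auto simp: sparse_signals_def space_PiM PiE_def)
  have "(\<lambda>x. x \<circ> \<rho>) ` (?A \<inter> nonzero_on p T) = ?A \<inter> nonzero_on p T'"
  proof (intro equalityI subsetI)
    fix y assume "y \<in> (\<lambda>x. x \<circ> \<rho>) ` (?A \<inter> nonzero_on p T)"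
    then obtain x where x: "y = x \<circ> \<rho>" "x \<in> ?A" "x \<in> nonzero_on p T" by auto
    then have "y \<in> ?A" using sparse_signals_permute[OF \<rho>(1)] by auto
    with x \<rho>(2) A show "y \<in> ?A \<inter> nonzero_on p T'" by (auto simp: nonzero_on_def)
  next
    fix y assume y: "y \<in> ?A \<inter> nonzero_on p T'"
    then have "y \<circ> inv \<rho> \<in> ?A" using sparse_signals_permute[OF permutes_inv[OF \<rho>(1)]] by auto
    moreover have "(y \<circ> inv \<rho>) j \<noteq> 0" if "j \<in> T" for j
      using that y \<rho>(2) permutes_inverses(2)[OF \<rho>(1)] by (auto simp: nonzero_on_def)
    ultimately have "y \<circ> inv \<rho> \<in> ?A \<inter> nonzero_on p T" using A by (auto simp: nonzero_on_def)
    moreover have "y = (y \<circ> inv \<rho>) \<circ> \<rho>" by (simp add: comp_assoc permutes_inv_o[OF \<rho>(1)])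
    ultimately show "y \<in> (\<lambda>x. x \<circ> \<rho>) ` (?A \<inter> nonzero_on p T)" by blast
  qed
  then have "hausdorff_measure p s (?A \<inter> nonzero_on p T) = hausdorff_measure p s (?A \<inter> nonzero_on p T')" for s
    using hausdorff_measure_permute[OF \<rho>(1)] by metis
  then show ?thesis
    using assms(1) sets_nonzero_on[OF T(1)] sets_nonzero_on[OF T(2)]
    unfolding uniform_on_def by auto
qed

text \<open>Stated for a measurable superset because \<open>A\<close> itself need not be measurable.
  The probability is a quotient of equal numbers, which is 1 as the Hausdorff measure is positive
  and finite.\<close>

lemma uniform_on_AE:
  assumes u: "uniform_on p A \<pi>" and B: "B \<in> sets (real_space p)" "A \<subseteq> B"
  shows "AE \<beta> in \<pi>. \<beta> \<in> B"
proof -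
  interpret prob_space \<pi> using u by (simp add: uniform_on_def)
  have "A \<inter> B = A" using B by auto
  then have "emeasure \<pi> B = 1"
    using u B unfolding uniform_on_def by (auto simp: less_top)
  then have "prob B = 1" by (simp add: measure_def)
  moreover have "B \<in> events" using u B by (simp add: uniform_on_def)
  ultimately show ?thesis by (simp add: AE_in_set_eq_1)
qed

text \<open>The quotient of the binomial coefficients is a product of factors (k - i) / (p - i),
  each at most k / p. The form without division also covers \<open>l > k\<close>, where the left
  side is 0.\<close>

lemma binomial_quotient_le:
  assumes "k \<le> p"
  shows "real (k choose l) * real p ^ l \<le> real (p choose l) * real k ^ l"
proof (induction l)
  case (Suc l)
  have rec: "real (m choose Suc l) * real (Suc l) = real (m choose l) * (real m - real l)" for m
  proof (cases "l \<le> m")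
    case True
    have "(m choose Suc l) * Suc l = (m choose l) * (m - l)"
      using binomial_absorb_comp[of m l] binomial_absorption[of l m] by (cases m) (simp_all add: mult.commute)
    then have "real ((m choose Suc l) * Suc l) = real ((m choose l) * (m - l))" by simp
    then show ?thesis using True by (simp only: of_nat_mult of_nat_diff)
  qed (simp add: binomial_eq_0)
  show ?case
  proof (cases "l < k")
    case True
    have "(real (k choose Suc l) * real p ^ Suc l) * real (Suc l) =
        (real (k choose l) * real p ^ l) * ((real k - real l) * real p)"
      using rec[of k] by (simp add: mult_ac del: of_nat_Suc)
    also have "\<dots> \<le> (real (p choose l) * real k ^ l) * ((real p - real l) * real k)"
    proof (rule mult_mono[OF Suc.IH])
      show "(real k - real l) * real p \<le> (real p - real l) * real k"
        using mult_left_mono[of "real k" "real p" "real l"] assms by (simp add: algebra_simps)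
    qed (use True in simp_all)
    also have "\<dots> = (real (p choose Suc l) * real k ^ Suc l) * real (Suc l)"
      using rec[of p] by (simp add: mult_ac del: of_nat_Suc)
    finally show ?thesis by (rule mult_right_le_imp_le) simp
  next
    case False
    then show ?thesis by (simp add: binomial_eq_0)
  qed
qed simp

text \<open>Expand \<open>a\<close> to the power of the overlap over the subsets of
  \<open>S\<close>. The probability that the support contains a given set is at most what
  independent inclusion with probability k / p would give, and for independent inclusion the
  expansion sums to a \<open>k\<close>-th power.\<close>

lemma overlap_integral_le:
  assumes prob: "prob_space \<pi>" and sets: "sets \<pi> = sets (real_space p)"
    and card: "AE \<beta> in \<pi>. card {j. j < p \<and> \<beta> j \<noteq> 0} = k"
    and exch: "\<And>T T'. T \<subseteq> {..<p} \<Longrightarrow> T' \<subseteq> {..<p} \<Longrightarrow> card T = card T' \<Longrightarrow>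
      emeasure \<pi> (nonzero_on p T) = emeasure \<pi> (nonzero_on p T')"
    and S: "S \<subseteq> {..<p}" "card S = k" and a: "a \<ge> 1" and p: "p > 0"
  shows "integrable \<pi> (\<lambda>\<beta>. a ^ card {j\<in>S. \<beta> j \<noteq> 0}) \<and>
    (\<integral>\<beta>. a ^ card {j\<in>S. \<beta> j \<noteq> 0} \<partial>\<pi>) \<le> exp ((a - 1) * (real k)\<^sup>2 / real p)"
proof -
  interpret prob_space \<pi> by fact
  have space: "space \<pi> = space (real_space p)" using sets by (rule sets_eq_imp_space_eq)
  have events: "nonzero_on p T \<in> events" if "T \<subseteq> {..<p}" for T
    using sets_nonzero_on[OF that] sets by simp
  have kp: "k \<le> p" using card_mono[OF _ S(1)] S(2) by simp
  have int_ind: "integrable \<pi> (\<lambda>\<beta>. indicator (nonzero_on p T) \<beta> :: real)" if "T \<subseteq> {..<p}" for T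
    using events[OF that] by (simp add: integrable_indicator_iff emeasure_eq_measure)
  have q_le: "prob (nonzero_on p T) \<le> (real k / real p) ^ card T" if T: "T \<subseteq> {..<p}" for T
  proof -
    define l where "l = card T"
    define \<T> where "\<T> = {T'. T' \<subseteq> {..<p} \<and> card T' = l}"
    have \<T>: "finite \<T>" "card \<T> = p choose l"
      using n_subsets[of "{..<p}" l] by (auto simp: \<T>_def intro: finite_subset[of _ "Pow {..<p}"])
    have l: "l \<le> p" using card_mono[OF _ T] by (simp add: l_def)
    \<comment> \<open>Double counting: by symmetry all sets of size \<open>l\<close> are equally
      likely to lie in the support, and a support of size \<open>k\<close> contains exactly
      \<open>k choose l\<close> of them.\<close>
    have "real (p choose l) * prob (nonzero_on p T) = (\<Sum>T'\<in>\<T>. prob (nonzero_on p T))"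
      by (simp add: \<T>)
    also have "\<dots> = (\<Sum>T'\<in>\<T>. prob (nonzero_on p T'))"
      using exch[OF T] by (intro sum.cong refl) (auto simp: \<T>_def l_def measure_def)
    also have "\<dots> = (\<Sum>T'\<in>\<T>. \<integral>\<beta>. indicator (nonzero_on p T') \<beta> \<partial>\<pi>)"
      using events by (intro sum.cong refl) (auto simp: \<T>_def)
    also have "\<dots> = (\<integral>\<beta>. (\<Sum>T'\<in>\<T>. indicator (nonzero_on p T') \<beta>) \<partial>\<pi>)"
      using int_ind by (subst Bochner_Integration.integral_sum) (auto simp: \<T>_def)
    also have "\<dots> = (\<integral>\<beta>. real (k choose l) \<partial>\<pi>)"
    proof (rule integral_cong_AE)
      show "(\<lambda>\<beta>. \<Sum>T'\<in>\<T>. indicator (nonzero_on p T') \<beta> :: real) \<in> borel_measurable \<pi>"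
        using events by (intro borel_measurable_sum borel_measurable_indicator) (auto simp: \<T>_def)
      show "AE \<beta> in \<pi>. (\<Sum>T'\<in>\<T>. indicator (nonzero_on p T') \<beta>) = real (k choose l)"
        using card AE_space
      proof eventually_elim
        case (elim \<beta>)
        let ?S = "{j. j < p \<and> \<beta> j \<noteq> 0}"
        have "(\<Sum>T'\<in>\<T>. indicator (nonzero_on p T') \<beta>) = (\<Sum>T'\<in>\<T>. if T' \<subseteq> ?S then 1 else (0::real))"
          using elim space by (intro sum.cong refl) (auto simp: \<T>_def nonzero_on_def indicator_def)
        also have "\<dots> = real (card {T'\<in>\<T>. T' \<subseteq> ?S})"
          using \<T> by (simp add: sum.If_cases Int_def)
        also have "{T'\<in>\<T>. T' \<subseteq> ?S} = {T'. T' \<subseteq> ?S \<and> card T' = l}"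
          by (auto simp: \<T>_def)
        also have "card \<dots> = k choose l"
          using n_subsets[of ?S l] elim by simp
        finally show ?case .
      qed
    qed simp
    also have "\<dots> = real (k choose l)" by (simp add: prob_space)
    finally have "real (p choose l) * prob (nonzero_on p T) * real p ^ l \<le> real (p choose l) * real k ^ l"
      using binomial_quotient_le[OF kp, of l] by simp
    moreover have "real (p choose l) > 0" using l by simp
    ultimately have "prob (nonzero_on p T) * real p ^ l \<le> real k ^ l"
      by (simp add: mult.assoc)
    then show ?thesis using p by (simp add: l_def power_divide pos_le_divide_eq)
  qed
  have finS: "finite S" using S finite_subset by blast
  have expand: "a ^ card {j\<in>S. \<beta> j \<noteq> 0} = (\<Sum>T\<in>Pow S. (a - 1) ^ card T * indicator (nonzero_on p T) \<beta>)"
    if "\<beta> \<in> space \<pi>" for \<beta>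
  proof -
    have "a ^ card {j\<in>S. \<beta> j \<noteq> 0} = (\<Prod>j\<in>S. (a - 1) * of_bool (\<beta> j \<noteq> 0) + 1)"
    proof -
      have "(\<Prod>j\<in>S. (a - 1) * of_bool (\<beta> j \<noteq> 0) + 1) = (\<Prod>j\<in>S. if \<beta> j \<noteq> 0 then a else 1)"
        by (intro prod.cong) auto
      also have "\<dots> = (\<Prod>j\<in>{j\<in>S. \<beta> j \<noteq> 0}. a)"
        using finS by (simp add: prod.If_cases Int_def)
      finally show ?thesis by simp
    qed
    also have "\<dots> = (\<Sum>T\<in>Pow S. (\<Prod>j\<in>T. (a - 1) * of_bool (\<beta> j \<noteq> 0)) * (\<Prod>j\<in>S - T. 1))"
      by (rule prod_add[OF finS])
    also have "\<dots> = (\<Sum>T\<in>Pow S. (a - 1) ^ card T * indicator (nonzero_on p T) \<beta>)"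
    proof (rule sum.cong[OF refl])
      fix T assume "T \<in> Pow S"
      then have "finite T" using finS finite_subset by blast
      then have "(\<Prod>j\<in>T. of_bool (\<beta> j \<noteq> 0)) = (indicator (nonzero_on p T) \<beta> :: real)"
        using that space by (auto simp: nonzero_on_def indicator_def intro!: prod.neutral)
      then show "(\<Prod>j\<in>T. (a - 1) * of_bool (\<beta> j \<noteq> 0)) * (\<Prod>j\<in>S - T. 1) =
          (a - 1) ^ card T * indicator (nonzero_on p T) \<beta>"
        by (simp add: prod.distrib)
    qed
    finally show ?thesis .
  qed
  have sub: "T \<subseteq> {..<p}" if "T \<in> Pow S" for T using that S by auto
  have int: "integrable \<pi> (\<lambda>\<beta>. \<Sum>T\<in>Pow S. (a - 1) ^ card T * indicator (nonzero_on p T) \<beta>)"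
    by (intro Bochner_Integration.integrable_sum integrable_mult_right int_ind sub)
  have "(\<integral>\<beta>. a ^ card {j\<in>S. \<beta> j \<noteq> 0} \<partial>\<pi>) = (\<integral>\<beta>. (\<Sum>T\<in>Pow S. (a - 1) ^ card T * indicator (nonzero_on p T) \<beta>) \<partial>\<pi>)"
    by (rule Bochner_Integration.integral_cong) (simp_all add: expand)
  also have "\<dots> = (\<Sum>T\<in>Pow S. (a - 1) ^ card T * prob (nonzero_on p T))"
    using int_ind sub events by (subst Bochner_Integration.integral_sum) auto
  also have "\<dots> \<le> (\<Sum>T\<in>Pow S. (a - 1) ^ card T * (real k / real p) ^ card T)"
    using a by (intro sum_mono mult_left_mono q_le sub) auto
  \<comment> \<open>The same expansion read backwards, now with the constant k / p in place of the
    indicators.\<close>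
  also have "\<dots> = (\<Sum>T\<in>Pow S. (\<Prod>j\<in>T. (a - 1) * (real k / real p)) * (\<Prod>j\<in>S - T. 1))"
    by (simp only: power_mult_distrib prod_constant power_one mult_1_right)
  also have "\<dots> = (\<Prod>j\<in>S. (a - 1) * (real k / real p) + 1)"
    by (rule prod_add[OF finS, symmetric])
  also have "\<dots> = ((a - 1) * (real k / real p) + 1) ^ k" using S by simp
  also have "\<dots> \<le> exp ((a - 1) * (real k / real p)) ^ k"
    using a exp_ge_add_one_self[of "(a - 1) * (real k / real p)"] by (intro power_mono) (auto simp: add.commute)
  also have "\<dots> = exp ((a - 1) * (real k)\<^sup>2 / real p)"
    by (simp add: exp_of_nat_mult[symmetric] power2_eq_square mult_ac)
  finally have le: "(\<integral>\<beta>. a ^ card {j\<in>S. \<beta> j \<noteq> 0} \<partial>\<pi>) \<le> exp ((a - 1) * (real k)\<^sup>2 / real p)" .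
  have "integrable \<pi> (\<lambda>\<beta>. a ^ card {j\<in>S. \<beta> j \<noteq> 0})"
    using int by (rule Bochner_Integration.integrable_cong[THEN iffD1, rotated 2]) (simp_all add: expand)
  with le show ?thesis by blast
qed

section \<open>The low-degree bound\<close>

text \<open>For the empty set the defining formula gives the empty event a positive finite number
  divided by itself, hence probability 1.\<close>

lemma uniform_on_nonempty:
  assumes "uniform_on p A \<pi>"
  shows "A \<noteq> {}"
proof
  assume "A = {}"
  then obtain s where s: "0 < hausdorff_measure p s {}" "hausdorff_measure p s {} < \<infinity>"
    and "\<And>B. B \<in> sets (real_space p) \<Longrightarrow>
      emeasure \<pi> B = hausdorff_measure p s {} / hausdorff_measure p s {}"
    using assms by (auto simp: uniform_on_def)
  from this(3)[of "{}"] s show False by (auto simp: less_top)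
qed

lemma AE_sparse_signals:
  assumes "uniform_on p (sparse_signals p k \<D> r) \<pi>"
    and "Measurable.pred (real_space p) Pr" "\<And>\<beta>. \<beta> \<in> sparse_signals p k \<D> r \<Longrightarrow> Pr \<beta>"
  shows "AE \<beta> in \<pi>. Pr \<beta>"
proof -
  have "{\<beta> \<in> space (real_space p). Pr \<beta>} \<in> sets (real_space p)"
    using assms(2) by (rule predE)
  moreover have "sparse_signals p k \<D> r \<subseteq> {\<beta> \<in> space (real_space p). Pr \<beta>}"
    using assms(3) by (auto simp: sparse_signals_def space_PiM PiE_def)
  ultimately have "AE \<beta> in \<pi>. \<beta> \<in> {\<beta> \<in> space (real_space p). Pr \<beta>}"
    by (rule uniform_on_AE[OF assms(1)])
  then show ?thesis by eventually_elim simp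
qed

lemma pred_card_support: "Measurable.pred (real_space p) (\<lambda>\<beta>. card {j. j < p \<and> \<beta> j \<noteq> 0} = k)"
proof -
  have "card {j. j < p \<and> \<beta> j \<noteq> 0} = k \<longleftrightarrow> (\<Sum>j<p. if \<beta> j = 0 then 0 else 1) = real k" for \<beta> :: "nat \<Rightarrow> real"
  proof -
    have "(\<Sum>j<p. if \<beta> j = 0 then 0 else 1) = real (card {j. j < p \<and> \<beta> j \<noteq> 0})"
      by (simp add: sum.If_cases Int_def Compl_eq)
    then show ?thesis by simp
  qed
  moreover have "Measurable.pred (real_space p) (\<lambda>\<beta>. (\<Sum>j<p. if \<beta> j = 0 then 0 else 1) = real k)"
  proof -
    have "(\<lambda>\<beta>. if \<beta> j = 0 then 0 else 1 :: real) \<in> borel_measurable (real_space p)" if "j \<in> {..<p}" for j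
    proof -
      have [measurable]: "(\<lambda>\<beta>. \<beta> j) \<in> borel_measurable (real_space p)"
        using that by (intro measurable_component_singleton) auto
      show ?thesis by measurable
    qed
    then have [measurable]: "(\<lambda>\<beta>. \<Sum>j<p. if \<beta> j = 0 then 0 else 1 :: real) \<in> borel_measurable (real_space p)"
      by (intro borel_measurable_sum)
    show ?thesis by measurable
  qed
  ultimately show ?thesis by simp
qed

lemma sparse_signals_norm_pos:
  assumes "\<beta> \<in> sparse_signals p k \<D> r" "k \<ge> 1"
  shows "r > 0" "max_norm p \<beta> > 0" "\<And>j. j < p \<Longrightarrow> \<bar>\<beta> j\<bar> \<le> max_norm p \<beta>"
proof -
  show le: "\<bar>\<beta> j\<bar> \<le> max_norm p \<beta>" if "j < p" for j
    unfolding max_norm_def using that by (intro Max_ge) auto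
  have "card {j. j < p \<and> \<beta> j \<noteq> 0} \<noteq> 0" using assms by (auto simp: sparse_signals_def)
  then have "{j. j < p \<and> \<beta> j \<noteq> 0} \<noteq> {}" by (metis card.empty)
  then obtain j where j: "j < p" "\<beta> j \<noteq> 0" by auto
  show "max_norm p \<beta> > 0" using le[OF j(1)] j by linarith
  have "L2_set \<beta> {..<p} \<noteq> 0" using j by (auto simp: L2_set_eq_0_iff)
  then show "r > 0" using assms L2_set_nonneg[of \<beta> "{..<p}"] by (auto simp: sparse_signals_def)
qed

text \<open>Some signal exists, and as it has a nonzero entry its norm \<open>r\<close> is
  positive.\<close>

lemma slr_modelI:
  assumes "\<sigma> > 0" "k \<ge> 1" and u: "uniform_on p (sparse_signals p k \<D> r) \<pi>"
  shows "slr_model p r \<sigma> \<pi>"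
proof (rule slr_model.intro)
  show "prob_space \<pi>" "sets \<pi> = sets (real_space p)" using u by (simp_all add: uniform_on_def)
  show "r > 0" using uniform_on_nonempty[OF u] sparse_signals_norm_pos assms(2) by blast
  show "AE \<beta> in \<pi>. L2_set \<beta> {..<p} = r"
  proof (rule AE_sparse_signals[OF u])
    have "(\<lambda>\<beta>. \<beta> j) \<in> borel_measurable (real_space p)" if "j \<in> {..<p}" for j
      using that by (intro measurable_component_singleton) auto
    then have [measurable]: "(\<lambda>\<beta>. L2_set \<beta> {..<p}) \<in> borel_measurable (real_space p)"
      unfolding L2_set_def
      by (intro measurable_compose[OF _ borel_measurable_sqrt] borel_measurable_sum borel_measurable_power)
    show "Measurable.pred (real_space p) (\<lambda>\<beta>. L2_set \<beta> {..<p} = r)" by measurable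
  qed (simp add: sparse_signals_def)
qed fact

lemma slr_chi2_le:
  fixes n p k D :: nat and r \<sigma> \<theta> \<epsilon> C :: real
  assumes \<sigma>: "\<sigma> > 0" and k: "k \<ge> 1" and u: "uniform_on p (sparse_signals p k \<D> r) \<pi>"
    and \<theta>: "\<theta> \<le> 1/2" and \<epsilon>: "0 < \<epsilon>" "\<epsilon> < 1" and p: "p \<ge> 2" and n: "n \<ge> 1"
    and k_le: "real k \<le> C * real p powr \<theta>" and D: "real D \<le> \<epsilon> * real n"
    and n_le: "\<And>\<beta>. \<beta> \<in> sparse_signals p k \<D> r \<Longrightarrow> real n \<le> (1 - \<epsilon>) * (1 - 2 * \<theta>) * (r\<^sup>2 / (max_norm p \<beta>)\<^sup>2) *
      ((snr r \<sigma> + 1) / snr r \<sigma>) * ln (real p)"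
  shows "chi2_low_degree (n * p + n) (slr_alternative n p \<sigma> \<pi>) (slr_null n p r \<sigma>) D + 1 \<le> exp (C\<^sup>2)"
proof -
  interpret slr_model n p r \<sigma> \<pi> using \<sigma> k u by (rule slr_modelI)
  define b where "b = (1 - \<epsilon>) * (1 - 2 * \<theta>) * ln (real p)"
  have ln_p: "ln (real p) > 0" using p by simp
  have b: "b \<ge> 0" using \<epsilon> \<theta> ln_p by (simp add: b_def)
  \<comment> \<open>Chosen such that \<open>n * c\<^sup>2 = b\<close>: the bound on \<open>n\<close>
    says precisely that the entries of the direction are at most \<open>c\<close> in absolute
    value.\<close>
  define c where "c = sqrt (b / real n)"
  have c2: "c\<^sup>2 = b / real n" using b by (simp add: c_def)
  have dir: "\<bar>direction \<beta> j\<bar> \<le> c" if \<beta>: "\<beta> \<in> sparse_signals p k \<D> r" and j: "j < p" for \<beta> j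
  proof -
    define m where "m = max_norm p \<beta>"
    have m: "m > 0" "\<bar>\<beta> j\<bar> \<le> m" using sparse_signals_norm_pos[OF \<beta> k] j by (auto simp: m_def)
    have t2: "\<tau>\<^sup>2 = snr r \<sigma> + 1" by (simp add: \<tau>_def snr_def)
    have s: "snr r \<sigma> > 0" using r \<sigma> by (simp add: snr_def)
    \<comment> \<open>The factor (SNR + 1) / SNR converts the squared signal norm into the squared
      normalisation \<open>(\<sigma> * \<tau>)\<^sup>2\<close> of the direction.\<close>
    have "(r\<^sup>2 / m\<^sup>2) * ((snr r \<sigma> + 1) / snr r \<sigma>) = (\<sigma> * \<tau>)\<^sup>2 / m\<^sup>2"
    proof -
      have "(snr r \<sigma> + 1) / snr r \<sigma> = (snr r \<sigma> + 1) * (\<sigma>\<^sup>2 / r\<^sup>2)" by (simp add: snr_def)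
      then show ?thesis unfolding power_mult_distrib t2 using r by simp
    qed
    moreover have "real n \<le> b * ((r\<^sup>2 / m\<^sup>2) * ((snr r \<sigma> + 1) / snr r \<sigma>))"
      using n_le[OF \<beta>] by (simp only: b_def m_def mult_ac)
    ultimately have "real n \<le> b * ((\<sigma> * \<tau>)\<^sup>2 / m\<^sup>2)"
      by (simp only:)
    then have "m\<^sup>2 / (\<sigma> * \<tau>)\<^sup>2 \<le> b / real n"
      using m n \<sigma> \<tau>_nonzero by (simp add: field_simps)
    then have "(m / (\<sigma> * \<tau>))\<^sup>2 \<le> c\<^sup>2" by (simp add: c2 power_divide)
    then have "m / (\<sigma> * \<tau>) \<le> c" by (rule power2_le_imp_le) (simp add: c_def b)
    moreover have "\<bar>direction \<beta> j\<bar> \<le> m / (\<sigma> * \<tau>)"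
      using m \<sigma> \<tau>_nonzero by (simp add: direction_def abs_mult divide_right_mono)
    ultimately show ?thesis by linarith
  qed
  define a where "a = exp ((real n + real (D div 2)) * c\<^sup>2)"
  have "a \<ge> 1" by (simp add: a_def)
  have a_le: "a \<le> real p powr (1 - 2 * \<theta>)"
  proof -
    have "real (D div 2) \<le> \<epsilon> / 2 * real n" using D by (simp add: field_simps)
    then have "(real n + real (D div 2)) * c\<^sup>2 \<le> ((1 + \<epsilon> / 2) * real n) * c\<^sup>2"
      by (intro mult_right_mono) (simp_all add: algebra_simps)
    also have "\<dots> = (1 + \<epsilon> / 2) * b" using n by (simp add: c2)
    also have "\<dots> = ((1 + \<epsilon> / 2) * (1 - \<epsilon>)) * ((1 - 2 * \<theta>) * ln (real p))" by (simp add: b_def)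
    \<comment> \<open>(1 + \<epsilon>/2) (1 - \<epsilon>) = 1 - \<epsilon>/2 - \<epsilon>^2/2: the
      slack in the bound on \<open>n\<close> outweighs the contribution of the degree.\<close>
    also have "\<dots> \<le> 1 * ((1 - 2 * \<theta>) * ln (real p))"
      using \<epsilon> \<theta> ln_p by (intro mult_right_mono) (simp_all add: algebra_simps)
    finally show ?thesis using p by (simp add: a_def powr_def)
  qed
  have bound: "(a - 1) * (real k)\<^sup>2 / real p \<le> C\<^sup>2"
  proof -
    \<comment> \<open>The exponents 1 - 2 \<theta> from \<open>a\<close> and 2 \<theta> from the
      squared sparsity add up to 1, which cancels the division by \<open>p\<close>.\<close>
    have "(a - 1) * (real k)\<^sup>2 \<le> real p powr (1 - 2 * \<theta>) * (C * real p powr \<theta>)\<^sup>2"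
      using a_le \<open>a \<ge> 1\<close> k_le by (intro mult_mono power_mono) auto
    also have "\<dots> = C\<^sup>2 * (real p powr (1 - 2 * \<theta>) * (real p powr \<theta> * real p powr \<theta>))"
      by (simp add: power2_eq_square mult_ac)
    also have "real p powr (1 - 2 * \<theta>) * (real p powr \<theta> * real p powr \<theta>) = real p"
      using p by (simp add: powr_add[symmetric])
    finally show ?thesis using p by (simp add: pos_divide_le_eq)
  qed
  have card: "AE \<beta> in \<pi>. card {j. j < p \<and> \<beta> j \<noteq> 0} = k"
    by (rule AE_sparse_signals[OF u pred_card_support]) (simp add: sparse_signals_def)
  show ?thesis
  proof (rule chi2_le[OF _ card, where c = c])
    show "AE \<beta> in \<pi>. \<forall>j<p. \<bar>direction \<beta> j\<bar> \<le> c"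
    proof (rule AE_sparse_signals[OF u])
      have "Measurable.pred (real_space p) (\<lambda>\<beta>. \<bar>direction \<beta> j\<bar> \<le> c)" if "j < p" for j
      proof -
        have [measurable]: "(\<lambda>\<beta>. \<beta> j) \<in> borel_measurable (real_space p)"
          using that by (intro measurable_component_singleton) auto
        show ?thesis unfolding direction_def by measurable
      qed
      then have "Measurable.pred (real_space p) (\<lambda>\<beta>. \<forall>j\<in>{..<p}. \<bar>direction \<beta> j\<bar> \<le> c)"
        by (intro pred_intros_finite) auto
      then show "Measurable.pred (real_space p) (\<lambda>\<beta>. \<forall>j<p. \<bar>direction \<beta> j\<bar> \<le> c)"
        by (simp add: Ball_def)
    qed (use dir in auto)
    fix S assume S: "S \<subseteq> {..<p}" "card S = k"
    have "integrable \<pi> (\<lambda>\<beta>. a ^ card {j\<in>S. \<beta> j \<noteq> 0}) \<and>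
        (\<integral>\<beta>. a ^ card {j\<in>S. \<beta> j \<noteq> 0} \<partial>\<pi>) \<le> exp ((a - 1) * (real k)\<^sup>2 / real p)"
      using p by (intro overlap_integral_le[OF prob_prior sets_prior card _ S \<open>a \<ge> 1\<close>]
          uniform_on_exchangeable[OF u]) auto
    then show "integrable \<pi> (\<lambda>\<beta>. exp ((real n + real (D div 2)) * c\<^sup>2) ^ card {j\<in>S. \<beta> j \<noteq> 0}) \<and>
      (\<integral>\<beta>. exp ((real n + real (D div 2)) * c\<^sup>2) ^ card {j\<in>S. \<beta> j \<noteq> 0} \<partial>\<pi>) \<le> exp (C\<^sup>2)"
      using bound order_trans unfolding a_def by fastforce
  qed
qed

text \<open>The dimension is n (p + 1), so its logarithm splits into ln n, which is o(n) as n tends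
  to infinity, and ln (p + 1), which is O(ln p). It follows that a degree proportional to
  \<open>n\<close> is large enough for the conjecture.\<close>

lemma ln_slr_dimension_smallo:
  assumes n: "(\<lambda>p. real (n p)) \<in> \<omega>(\<lambda>p. ln (real p))"
    and n_top: "filterlim (\<lambda>p. real (n p)) at_top sequentially"
  shows "(\<lambda>p. ln (real (slr_dimension n p))) \<in> o(\<lambda>p. real (n p))"
proof -
  have "(\<lambda>x::real. ln x) \<in> o(\<lambda>x. x)"
    using ln_x_over_x_tendsto_0 by (intro smalloI_tendsto) (auto simp: eventually_at_top_dense)
  from landau_o.small.compose[OF this n_top] have 1: "(\<lambda>p. ln (real (n p))) \<in> o(\<lambda>p. real (n p))" .
  have "(\<lambda>p. ln (real p + 1)) \<in> O(\<lambda>p. ln (real p))"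
  proof (rule bigoI[of _ 2])
    show "\<forall>\<^sub>F p in sequentially. norm (ln (real p + 1)) \<le> 2 * norm (ln (real p))"
      using eventually_ge_at_top[of 2]
    proof eventually_elim
      case (elim p)
      have "real p + 1 \<le> real p * 2" using elim by simp
      also have "\<dots> \<le> real p * real p" using elim by (intro mult_left_mono) auto
      finally have "ln (real p + 1) \<le> ln (real p * real p)" using elim by simp
      also have "\<dots> = 2 * ln (real p)" using elim by (simp add: ln_mult)
      finally show ?case using elim by simp
    qed
  qed
  moreover have "(\<lambda>p. ln (real p)) \<in> o(\<lambda>p. real (n p))"
    using n by (simp add: smallomega_iff_smallo)
  ultimately have 2: "(\<lambda>p. ln (real p + 1)) \<in> o(\<lambda>p. real (n p))"
    by (rule landau_o.big_small_trans)
  have "\<forall>\<^sub>F p in sequentially. ln (real (slr_dimension n p)) = ln (real (n p)) + ln (real p + 1)"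
    using filterlim_at_top_dense[THEN iffD1, OF n_top, rule_format, of 0]
  proof eventually_elim
    case (elim p)
    have "real (slr_dimension n p) = real (n p) * (real p + 1)"
      by (simp add: slr_dimension_def distrib_left)
    then show ?case using elim by (simp add: ln_mult)
  qed
  from landau_o.small.in_cong[OF this] show ?thesis
    using sum_in_smallo(1)[OF 1 2] by simp
qed

section \<open>From the low-degree bound to the running time\<close>

theorem theorem2p8:
  fixes \<theta> \<epsilon> :: real
    and k n :: "nat \<Rightarrow> nat"
    and \<D> :: "nat \<Rightarrow> real set"
    and r \<sigma> :: "nat \<Rightarrow> real"
    and \<pi> :: "nat \<Rightarrow> (nat \<Rightarrow> real) measure"
    and \<C> :: "detection_problem set"
  assumes theta: "0 < \<theta>" "\<theta> \<le> 1/2"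
    and eps: "0 < \<epsilon>" "\<epsilon> < 1"
    and sigma: "\<forall>\<^sub>F p in sequentially. \<sigma> p > 0"
    and entries: "\<forall>\<^sub>F p in sequentially. \<exists>b\<in>\<D> p. 0 < \<bar>b\<bar> \<and> (\<forall>b'\<in>\<D> p. \<bar>b\<bar> \<le> \<bar>b'\<bar>)"
    and prior: "\<forall>\<^sub>F p in sequentially. uniform_on p (sparse_signals p (k p) (\<D> p) (r p)) (\<pi> p)"
    and k_pos: "\<forall>\<^sub>F p in sequentially. k p \<ge> 1"
    and k_theta: "(\<lambda>p. real (k p)) \<in> O(\<lambda>p. real p powr \<theta>)"
    and k_sqrt: "\<forall>\<^sub>F p in sequentially. real (k p) \<le> sqrt (real p)"
    and n_large: "(\<lambda>p. real (n p)) \<in> \<omega>(\<lambda>p. ln (real p))"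
    and n_small: "\<forall>\<^sub>F p in sequentially. \<forall>\<beta>\<in>sparse_signals p (k p) (\<D> p) (r p).
      real (n p) \<le> (1 - \<epsilon>) * (1 - 2 * \<theta>) * ((r p)\<^sup>2 / (max_norm p \<beta>)\<^sup>2) *
                   ((snr (r p) (\<sigma> p) + 1) / snr (r p) (\<sigma> p)) * ln (real p)"
    and LDC: "low_degree_conjecture \<C>" "slr_detection n r \<sigma> \<pi> \<in> \<C>"
  shows "requires_exp_time (slr_dimension n) (strong_detection (slr_detection n r \<sigma> \<pi>))
           (\<lambda>p. real (n p))"
proof -
  define N where "N = slr_dimension n"
  define P where "P p = slr_alternative (n p) p (\<sigma> p) (\<pi> p)" for p
  define Q where "Q p = slr_null (n p) p (r p) (\<sigma> p)" for p
  have problem: "slr_detection n r \<sigma> \<pi> = (N, P, Q)"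
    by (simp add: slr_detection_def N_def P_def[abs_def] Q_def[abs_def])
  obtain C where "\<forall>\<^sub>F p in sequentially. norm (real (k p)) \<le> C * norm (real p powr \<theta>)"
    using landau_o.bigE[OF k_theta] by blast
  then have C: "\<forall>\<^sub>F p in sequentially. real (k p) \<le> C * real p powr \<theta>"
    by eventually_elim simp
  have "\<forall>\<^sub>F p in sequentially. 1 * norm (ln (real p)) \<le> norm (real (n p))"
    by (rule landau_omega.smallD[OF n_large]) simp
  then have "\<forall>\<^sub>F p in sequentially. ln (real p) \<le> real (n p)"
    by eventually_elim simp
  moreover have "filterlim (\<lambda>p. ln (real p)) at_top sequentially"
    using filterlim_compose[OF ln_at_top filterlim_real_sequentially] .
  ultimately have n_top: "filterlim (\<lambda>p. real (n p)) at_top sequentially"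
    by (rule filterlim_at_top_mono[rotated])
  have n_ge: "\<forall>\<^sub>F p in sequentially. x \<le> real (n p)" for x
    using n_top by (simp add: filterlim_at_top)
  have ln_N: "(\<lambda>p. ln (real (N p))) \<in> o(\<lambda>p. real (n p))"
    unfolding N_def by (rule ln_slr_dimension_smallo[OF n_large n_top])
  \<comment> \<open>Proportional to \<open>n\<close>, so that the exponents in \<open>D\<close> and
    in \<open>n\<close> agree up to a constant; the factor \<open>\<epsilon>\<close> is the degree
    that the slack in the bound on \<open>n\<close> can pay for.\<close>
  define D where "D p = nat \<lfloor>\<epsilon> * real (n p)\<rfloor>" for p
  have D_le: "real (D p) \<le> \<epsilon> * real (n p)" for p
    using eps by (simp add: D_def)
  \<comment> \<open>Once \<open>\<epsilon> * real (n p) \<ge> 2\<close>, rounding down loses at most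
    half of the value.\<close>
  have D_ge: "\<forall>\<^sub>F p in sequentially. \<epsilon> / 2 * real (n p) \<le> real (D p)"
    using n_ge[of "2 / \<epsilon>"]
  proof eventually_elim
    case (elim p)
    then have "\<epsilon> * real (n p) \<ge> 2" using eps by (simp add: field_simps)
    then show ?case unfolding D_def by linarith
  qed
  have "(\<lambda>p. real (n p)) \<in> O(\<lambda>p. real (D p))"
    using D_ge by (intro bigoI[of _ "2 / \<epsilon>"], eventually_elim) (use eps in \<open>simp add: field_simps\<close>)
  with ln_N have D_large: "(\<lambda>p. real (D p)) \<in> \<omega>(\<lambda>p. ln (real (N p)))"
    unfolding smallomega_iff_smallo by (rule landau_o.small_big_trans)
  have admissible: "admissible_problem (N, P, Q)"
    unfolding admissible_problem.simps
  proof
    show "filterlim N at_top sequentially"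
    proof (rule filterlim_at_top_mono[OF filterlim_ident])
      show "\<forall>\<^sub>F p in sequentially. p \<le> N p"
        using n_ge[of 1] by eventually_elim (auto simp: N_def slr_dimension_def intro: trans_le_add1)
    qed
    show "\<forall>\<^sub>F p in sequentially. prob_space (P p) \<and> prob_space (Q p) \<and>
        sets (P p) = sets (real_space (N p)) \<and> sets (Q p) = sets (real_space (N p)) \<and>
        absolutely_continuous (Q p) (P p) \<and> square_integrable (Q p) (likelihood_ratio (P p) (Q p))"
      using sigma prior k_pos
    proof eventually_elim
      case (elim p)
      interpret slr_model "n p" p "r p" "\<sigma> p" "\<pi> p" using elim by (intro slr_modelI)
      show ?case
        unfolding P_def Q_def N_def slr_dimension_def
        using prob_space_P prob_space_Q sets_P sets_Q absolutely_continuous_P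
          square_integrable_likelihood_ratio by blast
    qed
  qed
  have "(\<lambda>p. chi2_low_degree (N p) (P p) (Q p) (D p)) \<in> O(\<lambda>_. 1)"
  proof (rule bigoI[of _ "exp (C\<^sup>2) + 1"])
    show "\<forall>\<^sub>F p in sequentially. norm (chi2_low_degree (N p) (P p) (Q p) (D p)) \<le> (exp (C\<^sup>2) + 1) * norm (1::real)"
      using sigma prior k_pos C n_small n_ge[of 1] eventually_ge_at_top[of 2]
    proof eventually_elim
      case (elim p)
      have "chi2_low_degree (N p) (P p) (Q p) (D p) + 1 \<le> exp (C\<^sup>2)"
        unfolding N_def slr_dimension_def P_def Q_def
        using elim eps theta D_le by (intro slr_chi2_le) auto
      \<comment> \<open>Boundedness concerns the absolute value. From below the divergence is the
        integral of a square minus 1.\<close>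
      moreover have "chi2_low_degree (N p) (P p) (Q p) (D p) \<ge> - 1"
        by (simp add: chi2_low_degree_def)
      ultimately show ?case using exp_gt_zero[of "C\<^sup>2"] by simp
    qed
  qed
  then have req: "requires_exp_time N (strong_detection (N, P, Q)) (\<lambda>p. real (D p))"
    using LDC admissible D_large unfolding problem low_degree_conjecture_def by blast
  show ?thesis
    unfolding problem N_def[symmetric] requires_exp_time_def
  proof (intro allI impI)
    fix A T assume "runs_in_time N A T \<and> strong_detection (N, P, Q) A"
    then obtain c E where c: "c > 0"
      and T: "\<forall>\<^sub>F p in sequentially. exp (c * real (D p) / ln (real (N p)) ^ E) \<le> real (T p)"
      using req unfolding requires_exp_time_def by blast
    \<comment> \<open>The factor \<open>\<epsilon> / 2\<close> between degree and \<open>n\<close>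
      is absorbed by the constant, while the power of the logarithm stays the same.\<close>
    have "\<forall>\<^sub>F p in sequentially. exp (c * \<epsilon> / 2 * real (n p) / ln (real (N p)) ^ E) \<le> real (T p)"
      using T D_ge
    proof eventually_elim
      case (elim p)
      have "ln (real (N p)) \<ge> 0" by (cases "N p") auto
      moreover have "c * (\<epsilon> / 2 * real (n p)) \<le> c * real (D p)"
        using elim c by (intro mult_left_mono) auto
      ultimately have "c * \<epsilon> / 2 * real (n p) / ln (real (N p)) ^ E \<le> c * real (D p) / ln (real (N p)) ^ E"
        by (intro divide_right_mono) (simp_all add: mult.assoc)
      with elim show ?case by (meson exp_le_cancel_iff order_trans)
    qed
    then show "\<exists>c>0. \<exists>E::nat. \<forall>\<^sub>F p in sequentially. exp (c * real (n p) / ln (real (N p)) ^ E) \<le> real (T p)"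
      using c eps by (intro exI[of _ "c * \<epsilon> / 2"]) auto
  qed
qed

end
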